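(* Let $T$ be the monoid given by the monoid presentation $$T=\langle a,b,c,x_n,y_n\ (n\in\mathbb{Z}) : abx_n=bx_n,\ aby_n=by_{n+1},\ cbx_n=bx_{n+1},\ cby_n=by_n\ (n\in\mathbb{Z})\rangle.$$ Then $T$ is left cancellative. It is not C$^*$-regular; furthermore, the homomorphism $\rho_{\chi_e}\colon C^*_r(\mathcal{G}(T))\to C^*_r(T)$ has nontrivial kernel.
   Context: Monoid. Let $S$ be a left cancellative monoid with identity $e$ (below applied to $S=T$). $C^*_r(S)\subset B(\ell^2(S))$ is the C$^*$-algebra generated by the operators $\lambda_s$, $\lambda_s\delta_t=\delta_{st}$. The left inverse hull $I_\ell(S)$ is the inverse semigroup of partial bijections of $S$ generated by the left translations $t\mapsto st$ ($s\in S$); $S$ is viewed as a subset of $I_\ell(S)$, and $s^{-1}\in I_\ell(S)$ is the bijection $sS\to S$ inverse to $t\mapsto st$. $E(S)$ is the semigroup of idempotents of $I_\ell(S)$; each of them is the identity map $p_X$ on a constructible right ideal $X=s_1^{-1}t_1\dots s_n^{-1}t_nS$, and $\mathcal{J}(S)$ is the set of constructible right ideals. $\bar{\mathcal{J}}(S)$ is the collection of subsets of $S$ consisting of $\mathcal{J}(S)$ and all sets $X\setminus\bigcup_{i=1}^mX_i$ with $X,X_1,\dots,X_m\in\mathcal{J}(S)$. C$^*$-regularity. $S$ is C$^*$-regular if, given $h_1,\dots,h_n\in I_\ell(S)$ and $X\in\bar{\mathcal{J}}(S)$ satisfying $\emptyset\ne X\subset\bigcup_{k=1}^n\{s\in S:h_ks=s\}$,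 there are $Y_1,\dots,Y_l\in\bar{\mathcal{J}}(S)$ and indices $1\le k_j\le n$ ($j=1,\dots,l$) such that $X\subset\bigcup_{j=1}^lY_j$ and $h_{k_j}|_{Y_j}=\mathrm{id}$ for all $1\le j\le l$. (Here $h_ks=s$ means that $s$ is in the domain of $h_k$ and is fixed by it.) Groupoids. $\widehat{E(S)}$ is the compact space (topology of pointwise convergence) of not identically zero semigroup homomorphisms $E(S)\to\{0,1\}$. For $s\in S$, $\chi_s(p_X)=1$ if $s\in X$ and $0$ otherwise. The Paterson groupoid $\mathcal{G}(I_\ell(S))$ is the set of classes $[g,\chi]$ of pairs $(g,\chi)\in I_\ell(S)\times\widehat{E(S)}$ with $\chi(g^{-1}g)=1$, where $(g_1,\chi_1)$, $(g_2,\chi_2)$ are equivalent iff $\chi_1=\chi_2$ and $g_1p=g_2p$ for some $p\in E(S)$ with $\chi_1(p)=1$. Product: $[g,\chi][h,\psi]=[gh,\psi]$ if $\chi=\psi(h^{-1}\cdot h)$; the unit space is identified with $\widehat{E(S)}$ via $\chi\mapsto[p_S,\chi]$; $s([g,\chi])=\chi$, $r([g,\chi])=\chi(g^{-1}\cdot g)$. A basis of the topology is given by the sets $D(g,U)=\{[g,\chi]:\chi\in U\}$, $U$ an open subset of $\{\chi:\chi(g^{-1}g)=1\}$. Let $\Omega(S)$ be the closure of $\{\chi_s:s\in S\}$ in $\widehat{E(S)}$ (an invariant set), and $\mathcal{G}_P(S)=\mathcal{G}(I_\ell(S))_{\Omega(S)}=r^{-1}(\Omega(S))=s^{-1}(\Omega(S))$.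 Each $\chi\in\Omega(S)$ extends to $\bar{\mathcal{J}}(S)$: for $X,X_i\in\mathcal{J}(S)$, $\chi(p_{X\setminus\bigcup_iX_i})=1$ if $\chi(p_X)=1$ and $\chi(p_{X_i})=0$ for all $i$, and it is $0$ otherwise. Then $\mathcal{G}(S)=\mathcal{G}_P(S)/{\sim}$ is the quotient (étale, possibly non-Hausdorff) groupoid, where $[g,\chi]\sim[h,\chi]$ iff there is $X\in\bar{\mathcal{J}}(S)$ with $\chi(p_X)=1$ and $g|_X=h|_X$. Reduced C$^*$-algebra. For a locally compact étale groupoid $\mathcal{G}$, $C_c(\mathcal{G})$ is the linear span, inside functions on $\mathcal{G}$, of $C_c(V)$ (extended by zero) over open Hausdorff $V\subset\mathcal{G}$, with convolution $(f_1*f_2)(g)=\sum_{h\in\mathcal{G}^{r(g)}}f_1(h)f_2(h^{-1}g)$ and $f^*(g)=\overline{f(g^{-1})}$; for $x\in\mathcal{G}^{(0)}$, $\rho_x$ is the representation on $\ell^2(\mathcal{G}_x)$, $\mathcal{G}_x=s^{-1}(x)$, given by $(\rho_x(f)\xi)(g)=\sum_{h\in\mathcal{G}^{r(g)}}f(h)\xi(h^{-1}g)$, and $C^*_r(\mathcal{G})$ is the completion in $\|f\|_r=\sup_x\|\rho_x(f)\|$. For $\mathcal{G}=\mathcal{G}(S)$, the map $s\mapsto[s,\chi_e]$ is a bijection $S\to\mathcal{G}_{\chi_e}$, so $\rho_{\chi_e}$ is viewed as a representation on $\ell^2(S)$; it gives a surjective $*$-homomorphism $C^*_r(\mathcal{G}(S))\to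 C^*_r(S)$. *)

theory Defs
  imports "HOL-Analysis.Analysis"
begin

section \<open>Monoids and their left inverse hulls\<close>

definition left_cancellative :: "'s::monoid_mult itself \<Rightarrow> bool" where
  "left_cancellative _ \<longleftrightarrow> (\<forall>s t u :: 's. s * t = s * u \<longrightarrow> t = u)"

text \<open>Partial bijections of a set are partial maps \<open>'s \<rightharpoonup> 's\<close>; the product \<open>gh\<close> is the
  composition \<open>g \<circ>\<^sub>m h\<close>.\<close>

definition left_translation :: "'s::monoid_mult \<Rightarrow> ('s \<rightharpoonup> 's)" where
  "left_translation s = (\<lambda>t. Some (s * t))"

definition pinverse :: "('a \<rightharpoonup> 'b) \<Rightarrow> ('b \<rightharpoonup> 'a)" where
  "pinverse g = (\<lambda>t. if t \<in> ran g then Some (THE s. g s = Some t) else None)"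

definition pid :: "'a set \<Rightarrow> ('a \<rightharpoonup> 'a)" where
  "pid X = Some |` X"

inductive_set left_inverse_hull :: "('s::monoid_mult \<rightharpoonup> 's) set" where
  left_translation: "left_translation s \<in> left_inverse_hull"
| pinverse: "g \<in> left_inverse_hull \<Longrightarrow> pinverse g \<in> left_inverse_hull"
| mult: "g \<in> left_inverse_hull \<Longrightarrow> h \<in> left_inverse_hull \<Longrightarrow> g \<circ>\<^sub>m h \<in> left_inverse_hull"

definition hull_idempotents :: "('s::monoid_mult \<rightharpoonup> 's) set" where
  "hull_idempotents = {p \<in> left_inverse_hull. p \<circ>\<^sub>m p = p}"

text \<open>The sets \<open>s\<^sub>1\<^sup>-\<^sup>1 t\<^sub>1 \<dots> s\<^sub>n\<^sup>-\<^sup>1 t\<^sub>n S\<close>, where \<open>s\<^sup>-\<^sup>1 Y\<close> is the image of \<open>Y \<inter> sS\<close> under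
  \<open>s\<^sup>-\<^sup>1 : sS \<rightarrow> S\<close>, that is, the preimage of \<open>Y\<close> under left translation by \<open>s\<close>.\<close>

definition constructible_ideals :: "'s::monoid_mult set set" where
  "constructible_ideals =
     {foldr (\<lambda>(s, t) X. (*) s -` ((*) t ` X)) sts UNIV | sts. True}"

text \<open>The case \<open>F = {}\<close> gives the constructible ideals themselves.\<close>

definition constructible_differences :: "'s::monoid_mult set set" where
  "constructible_differences =
     {X - \<Union>F | X F. X \<in> constructible_ideals \<and> finite F \<and> F \<subseteq> constructible_ideals}"

definition Cstar_regular :: "'s::monoid_mult itself \<Rightarrow> bool" where
  "Cstar_regular _ \<longleftrightarrow>
     (\<forall>H (X :: 's set).
        finite H \<and> H \<subseteq> left_inverse_hull \<and> X \<in> constructible_differences \<and>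
        X \<noteq> {} \<and> X \<subseteq> (\<Union>h\<in>H. {s. h s = Some s}) \<longrightarrow>
        (\<exists>\<Y>. finite \<Y> \<and> \<Y> \<subseteq> constructible_differences \<and> X \<subseteq> \<Union>\<Y> \<and>
             (\<forall>Y\<in>\<Y>. \<exists>h\<in>H. \<forall>s\<in>Y. h s = Some s)))"


section \<open>The Hilbert space \<open>\<ell>\<^sup>2\<close> of a type\<close>

definition square_summable :: "('a \<Rightarrow> complex) \<Rightarrow> bool" where
  "square_summable f \<longleftrightarrow> (\<lambda>x. (cmod (f x))\<^sup>2) summable_on UNIV"

lemma square_summableI:
  assumes "\<And>F. finite F \<Longrightarrow> L2_set (\<lambda>x. cmod (f x)) F \<le> b"
  shows "square_summable f" "sqrt (\<Sum>\<^sub>\<infinity>x. (cmod (f x))\<^sup>2) \<le> b"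
proof -
  have b0: "0 \<le> b"
    using assms[of "{}"] by simp
  have le: "(\<Sum>x\<in>F. (cmod (f x))\<^sup>2) \<le> b\<^sup>2" if "finite F" for F
    using assms[OF that] b0 unfolding L2_set_def
    by (metis real_sqrt_le_iff real_sqrt_unique)
  show s: "square_summable f"
    unfolding square_summable_def
    by (rule nonneg_bdd_above_summable_on) (auto intro!: bdd_aboveI[of _ "b\<^sup>2"] le)
  have "(\<Sum>\<^sub>\<infinity>x. (cmod (f x))\<^sup>2) \<le> b\<^sup>2"
    by (rule infsum_le_finite_sums) (use s le in \<open>auto simp: square_summable_def\<close>)
  then show "sqrt (\<Sum>\<^sub>\<infinity>x. (cmod (f x))\<^sup>2) \<le> b"
    using b0 by (metis real_sqrt_le_iff real_sqrt_unique)
qed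

lemma L2_set_le_square_summable:
  assumes "square_summable f" "finite F"
  shows "L2_set (\<lambda>x. cmod (f x)) F \<le> sqrt (\<Sum>\<^sub>\<infinity>x. (cmod (f x))\<^sup>2)"
  unfolding L2_set_def
  by (rule real_sqrt_le_mono, rule finite_sum_le_infsum)
     (use assms in \<open>auto simp: square_summable_def\<close>)

lemma square_summable_add_aux:
  assumes f: "square_summable f" and g: "square_summable g" and F: "finite F"
  shows "L2_set (\<lambda>x. cmod (f x + g x)) F \<le>
           sqrt (\<Sum>\<^sub>\<infinity>x. (cmod (f x))\<^sup>2) + sqrt (\<Sum>\<^sub>\<infinity>x. (cmod (g x))\<^sup>2)"
proof -
  have "L2_set (\<lambda>x. cmod (f x + g x)) F \<le> L2_set (\<lambda>x. cmod (f x) + cmod (g x)) F"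
    by (rule L2_set_mono) (auto intro: norm_triangle_ineq)
  also have "\<dots> \<le> L2_set (\<lambda>x. cmod (f x)) F + L2_set (\<lambda>x. cmod (g x)) F"
    by (rule L2_set_triangle_ineq)
  finally show ?thesis
    using L2_set_le_square_summable[OF f F] L2_set_le_square_summable[OF g F] by linarith
qed

lemmas square_summable_add = square_summableI(1)[OF square_summable_add_aux]
lemmas square_summable_triangle = square_summableI(2)[OF square_summable_add_aux]

lemma square_summable_0: "square_summable (\<lambda>_. 0)"
  by (simp add: square_summable_def)

lemma square_summable_mult:
  assumes "square_summable f"
  shows "square_summable (\<lambda>x. c * f x)"
  using summable_on_cmult_right[OF assms[unfolded square_summable_def], of "(cmod c)\<^sup>2"]
  by (simp add: square_summable_def norm_mult power_mult_distrib)

lemma square_summable_scaleR: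
  assumes "square_summable f"
  shows "square_summable (\<lambda>x. r *\<^sub>R f x)"
  using square_summable_mult[OF assms, of "of_real r"] by (simp add: scaleR_conv_of_real)

lemma square_summable_minus:
  assumes "square_summable f"
  shows "square_summable (\<lambda>x. - f x)"
  using assms by (simp add: square_summable_def)

lemma square_summable_diff:
  assumes "square_summable f" "square_summable g"
  shows "square_summable (\<lambda>x. f x - g x)"
  using square_summable_add[OF assms(1) square_summable_minus[OF assms(2)]] by simp

typedef 'a ell2 = "{f :: 'a \<Rightarrow> complex. square_summable f}"
  using square_summable_0 by blast

setup_lifting type_definition_ell2

instantiation ell2 :: (type) real_normed_vector
begin

lift_definition zero_ell2 :: "'a ell2" is "\<lambda>_. 0"
  by (rule square_summable_0)
lift_definition plus_ell2 :: "'a ell2 \<Rightarrow> 'a ell2 \<Rightarrow> 'a ell2" is "\<lambda>f g x. f x + g x"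
  by (rule square_summable_add)
lift_definition minus_ell2 :: "'a ell2 \<Rightarrow> 'a ell2 \<Rightarrow> 'a ell2" is "\<lambda>f g x. f x - g x"
  by (rule square_summable_diff)
lift_definition uminus_ell2 :: "'a ell2 \<Rightarrow> 'a ell2" is "\<lambda>f x. - f x"
  by (rule square_summable_minus)
lift_definition scaleR_ell2 :: "real \<Rightarrow> 'a ell2 \<Rightarrow> 'a ell2" is "\<lambda>r f x. r *\<^sub>R f x"
  by (rule square_summable_scaleR)
lift_definition norm_ell2 :: "'a ell2 \<Rightarrow> real" is "\<lambda>f. sqrt (\<Sum>\<^sub>\<infinity>x. (cmod (f x))\<^sup>2)" .
definition sgn_ell2 :: "'a ell2 \<Rightarrow> 'a ell2" where
  "sgn_ell2 \<xi> = inverse (norm \<xi>) *\<^sub>R \<xi>"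
definition dist_ell2 :: "'a ell2 \<Rightarrow> 'a ell2 \<Rightarrow> real" where
  "dist_ell2 \<xi> \<eta> = norm (\<xi> - \<eta>)"
definition uniformity_ell2 :: "('a ell2 \<times> 'a ell2) filter" where
  "uniformity_ell2 = (INF e\<in>{0<..}. principal {(\<xi>, \<eta>). dist \<xi> \<eta> < e})"
definition open_ell2 :: "'a ell2 set \<Rightarrow> bool" where
  "open_ell2 U \<longleftrightarrow> (\<forall>\<xi>\<in>U. eventually (\<lambda>(\<xi>', \<eta>). \<xi>' = \<xi> \<longrightarrow> \<eta> \<in> U) uniformity)"

instance
proof
  fix \<xi> \<eta> \<zeta> :: "'a ell2" and r q :: real and U :: "'a ell2 set"
  show "\<xi> + \<eta> + \<zeta> = \<xi> + (\<eta> + \<zeta>)" by transfer (simp add: add.assoc)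
  show "\<xi> + \<eta> = \<eta> + \<xi>" by transfer (simp add: add.commute)
  show "0 + \<xi> = \<xi>" by transfer simp
  show "- \<xi> + \<xi> = 0" by transfer simp
  show "\<xi> - \<eta> = \<xi> + - \<eta>" by transfer simp
  show "r *\<^sub>R (\<xi> + \<eta>) = r *\<^sub>R \<xi> + r *\<^sub>R \<eta>" by transfer (simp add: scaleR_add_right)
  show "(r + q) *\<^sub>R \<xi> = r *\<^sub>R \<xi> + q *\<^sub>R \<xi>" by transfer (simp add: scaleR_add_left)
  show "r *\<^sub>R q *\<^sub>R \<xi> = (r * q) *\<^sub>R \<xi>" by transfer simp
  show "1 *\<^sub>R \<xi> = \<xi>" by transfer simp
  show "dist \<xi> \<eta> = norm (\<xi> - \<eta>)" by (rule dist_ell2_def)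
  show "sgn \<xi> = inverse (norm \<xi>) *\<^sub>R \<xi>" by (rule sgn_ell2_def)
  show "(uniformity :: ('a ell2 \<times> 'a ell2) filter)
          = (INF e\<in>{0<..}. principal {(\<xi>, \<eta>). dist \<xi> \<eta> < e})"
    by (rule uniformity_ell2_def)
  show "open U \<longleftrightarrow> (\<forall>\<xi>\<in>U. \<forall>\<^sub>F (\<xi>', \<eta>) in uniformity. \<xi>' = \<xi> \<longrightarrow> \<eta> \<in> U)"
    by (rule open_ell2_def)
  show "norm \<xi> = 0 \<longleftrightarrow> \<xi> = 0"
  proof
    assume "norm \<xi> = 0"
    then show "\<xi> = 0"
    proof transfer
      fix f :: "'a \<Rightarrow> complex"
      assume f: "square_summable f" and 0: "sqrt (\<Sum>\<^sub>\<infinity>x. (cmod (f x))\<^sup>2) = 0"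
      have "(cmod (f x))\<^sup>2 = 0" for x
        by (rule nonneg_infsum_le_0D[where A = UNIV])
           (use f 0 in \<open>auto simp: square_summable_def\<close>)
      then show "f = (\<lambda>_. 0)" by auto
    qed
  next
    assume "\<xi> = 0"
    then show "norm \<xi> = 0" by transfer simp
  qed
  show "norm (\<xi> + \<eta>) \<le> norm \<xi> + norm \<eta>"
    by transfer (rule square_summable_triangle)
  show "norm (r *\<^sub>R \<xi>) = \<bar>r\<bar> * norm \<xi>"
    by transfer (simp add: power_mult_distrib infsum_cmult_right' real_sqrt_mult)
qed

end

lift_definition scaleC_ell2 :: "complex \<Rightarrow> 'a ell2 \<Rightarrow> 'a ell2" is "\<lambda>c f x. c * f x"
  by (rule square_summable_mult)

lift_definition cinner_ell2 :: "'a ell2 \<Rightarrow> 'a ell2 \<Rightarrow> complex"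
  is "\<lambda>f g. \<Sum>\<^sub>\<infinity>x. cnj (f x) * g x" .

text \<open>For injective \<open>j\<close>: the isometry with \<open>\<delta>\<^sub>a \<mapsto> \<delta>\<^bsub>j a\<^esub>\<close>, and its adjoint.\<close>

definition push_ell2 :: "('a \<Rightarrow> 'b) \<Rightarrow> 'a ell2 \<Rightarrow>\<^sub>L 'b ell2" where
  "push_ell2 j = Blinfun (\<lambda>\<xi>. Abs_ell2
     (\<lambda>y. if y \<in> range j then Rep_ell2 \<xi> (the_inv j y) else 0))"

definition pull_ell2 :: "('a \<Rightarrow> 'b) \<Rightarrow> 'b ell2 \<Rightarrow>\<^sub>L 'a ell2" where
  "pull_ell2 j = Blinfun (\<lambda>\<eta>. Abs_ell2 (\<lambda>x. Rep_ell2 \<eta> (j x)))"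


section \<open>The reduced C*-algebra of a monoid\<close>

text \<open>Bounded operators in the sense of \<open>\<Rightarrow>\<^sub>L\<close> are only real-linear; the operators below are
  complex-linear, and the algebra generated is taken over the complex numbers.\<close>

definition is_adjoint_ell2 :: "('a ell2 \<Rightarrow>\<^sub>L 'b ell2) \<Rightarrow> ('b ell2 \<Rightarrow>\<^sub>L 'a ell2) \<Rightarrow> bool" where
  "is_adjoint_ell2 P Q \<longleftrightarrow>
     (\<forall>\<xi> \<eta>. cinner_ell2 \<eta> (blinfun_apply P \<xi>) = cinner_ell2 (blinfun_apply Q \<eta>) \<xi>)"

definition Cstar_subalgebra :: "('a ell2 \<Rightarrow>\<^sub>L 'a ell2) set \<Rightarrow> bool" where
  "Cstar_subalgebra M \<longleftrightarrow>
     closed M \<and> 0 \<in> M \<and> (\<forall>P\<in>M. \<forall>Q\<in>M. P + Q \<in> M) \<and>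
     (\<forall>c. \<forall>P\<in>M. Blinfun (scaleC_ell2 c) o\<^sub>L P \<in> M) \<and>
     (\<forall>P\<in>M. \<forall>Q\<in>M. P o\<^sub>L Q \<in> M) \<and>
     (\<forall>P\<in>M. \<forall>Q. is_adjoint_ell2 P Q \<longrightarrow> Q \<in> M)"

definition Cstar_generated :: "('a ell2 \<Rightarrow>\<^sub>L 'a ell2) set \<Rightarrow> ('a ell2 \<Rightarrow>\<^sub>L 'a ell2) set" where
  "Cstar_generated L = \<Inter>{M. Cstar_subalgebra M \<and> L \<subseteq> M}"

definition left_regular :: "'s::monoid_mult \<Rightarrow> ('s ell2 \<Rightarrow>\<^sub>L 's ell2)" where
  "left_regular s = push_ell2 ((*) s)"

definition reduced_monoid_Cstar :: "('s::monoid_mult ell2 \<Rightarrow>\<^sub>L 's ell2) set" where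
  "reduced_monoid_Cstar = Cstar_generated (range left_regular)"


section \<open>Topological groupoids and their reduced C*-algebras\<close>

text \<open>The unit space is given by its set of points, which label the sources and ranges; the
  identification of a point with the unit arrow at it plays no role below.\<close>

record ('g, 'x) groupoid =
  arrows :: "'g set"
  units :: "'x set"
  gsource :: "'g \<Rightarrow> 'x"
  grange :: "'g \<Rightarrow> 'x"
  gmult :: "'g \<Rightarrow> 'g \<Rightarrow> 'g"
  ginv :: "'g \<Rightarrow> 'g"
  gtop :: "'g topology"

text \<open>Reduction to an invariant set \<open>Y\<close> of units.\<close>

definition reduction :: "('g, 'x) groupoid \<Rightarrow> 'x set \<Rightarrow> ('g, 'x) groupoid" where
  "reduction G Y =
     \<lparr>arrows = {g \<in> arrows G. gsource G g \<in> Y},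
      units = units G \<inter> Y,
      gsource = gsource G, grange = grange G, gmult = gmult G, ginv = ginv G,
      gtop = subtopology (gtop G) {g \<in> arrows G. gsource G g \<in> Y}\<rparr>"

definition quotient_topology :: "'g topology \<Rightarrow> ('g \<times> 'g) set \<Rightarrow> 'g set topology" where
  "quotient_topology T R =
     topology (\<lambda>W. W \<subseteq> topspace T // R \<and> openin T {g \<in> topspace T. R `` {g} \<in> W})"

lemma openin_quotient_topology:
  "openin (quotient_topology T R) W \<longleftrightarrow>
     W \<subseteq> topspace T // R \<and> openin T {g \<in> topspace T. R `` {g} \<in> W}"
proof -
  have "istopology (\<lambda>W. W \<subseteq> topspace T // R \<and> openin T {g \<in> topspace T. R `` {g} \<in> W})"
    unfolding istopology_def
  proof (intro conjI allI impI)
    fix V W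
    assume V: "V \<subseteq> topspace T // R \<and> openin T {g \<in> topspace T. R `` {g} \<in> V}"
      and W: "W \<subseteq> topspace T // R \<and> openin T {g \<in> topspace T. R `` {g} \<in> W}"
    show "V \<inter> W \<subseteq> topspace T // R" using V by blast
    have "{g \<in> topspace T. R `` {g} \<in> V \<inter> W} =
        {g \<in> topspace T. R `` {g} \<in> V} \<inter> {g \<in> topspace T. R `` {g} \<in> W}" by blast
    with V W show "openin T {g \<in> topspace T. R `` {g} \<in> V \<inter> W}" by auto
  next
    fix \<W>
    assume *: "\<forall>W\<in>\<W>. W \<subseteq> topspace T // R \<and> openin T {g \<in> topspace T. R `` {g} \<in> W}"
    show "\<Union>\<W> \<subseteq> topspace T // R" using * by blast
    have "{g \<in> topspace T. R `` {g} \<in> \<Union>\<W>} = (\<Union>W\<in>\<W>. {g \<in> topspace T. R `` {g} \<in> W})" by blast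
    with * show "openin T {g \<in> topspace T. R `` {g} \<in> \<Union>\<W>}" by auto
  qed
  then show ?thesis by (simp add: quotient_topology_def topology_inverse')
qed

text \<open>Quotient by an equivalence relation \<open>R\<close> on the arrows that preserves sources and ranges
  and is compatible with products and inverses.\<close>

definition quotient_groupoid :: "('g, 'x) groupoid \<Rightarrow> ('g \<times> 'g) set \<Rightarrow> ('g set, 'x) groupoid" where
  "quotient_groupoid G R =
     \<lparr>arrows = arrows G // R,
      units = units G,
      gsource = (\<lambda>P. the_elem (gsource G ` P)),
      grange = (\<lambda>P. the_elem (grange G ` P)),
      gmult = (\<lambda>P Q. \<Union>g\<in>P. \<Union>h\<in>Q. R `` {gmult G g h}),
      ginv = (\<lambda>P. \<Union>g\<in>P. R `` {ginv G g}),
      gtop = quotient_topology (gtop G) R\<rparr>"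

text \<open>\<open>C\<^sub>c(V)\<close> for open Hausdorff \<open>V\<close>, its elements extended by zero.\<close>

definition Cc_open :: "('g, 'x) groupoid \<Rightarrow> 'g set \<Rightarrow> ('g \<Rightarrow> complex) set" where
  "Cc_open G V =
     {f. (\<forall>g. g \<notin> V \<longrightarrow> f g = 0) \<and>
         continuous_map (subtopology (gtop G) V) euclidean f \<and>
         compactin (subtopology (gtop G) V) (subtopology (gtop G) V closure_of {g \<in> V. f g \<noteq> 0})}"

definition Cc :: "('g, 'x) groupoid \<Rightarrow> ('g \<Rightarrow> complex) set" where
  "Cc G = {\<lambda>g. \<Sum>i<n. c i * F i g | (n::nat) (c :: nat \<Rightarrow> complex) F.
             \<forall>i<n. \<exists>V. openin (gtop G) V \<and> Hausdorff_space (subtopology (gtop G) V) \<and>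
                       F i \<in> Cc_open G V}"

definition convolution :: "('g, 'x) groupoid \<Rightarrow> ('g \<Rightarrow> complex) \<Rightarrow> ('g \<Rightarrow> complex) \<Rightarrow> 'g \<Rightarrow> complex" where
  "convolution G f k g =
     (\<Sum>\<^sub>\<infinity>h\<in>{h \<in> arrows G. grange G h = grange G g}. f h * k (gmult G (ginv G h) g))"

text \<open>The operator \<open>\<rho>\<^sub>x(f)\<close>, extended by zero from \<open>\<ell>\<^sup>2(G\<^sub>x)\<close> to \<open>\<ell>\<^sup>2\<close> of the type of arrows
  (for \<open>g \<in> G\<^sub>x\<close> the formula only involves the values of \<open>\<xi>\<close> on \<open>G\<^sub>x\<close>).\<close>

definition fibre_rep ::
    "('g, 'x) groupoid \<Rightarrow> 'x \<Rightarrow> ('g \<Rightarrow> complex) \<Rightarrow> ('g ell2 \<Rightarrow>\<^sub>L 'g ell2)" where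
  "fibre_rep G x f = Blinfun (\<lambda>\<xi>. Abs_ell2 (\<lambda>g.
     if g \<in> arrows G \<and> gsource G g = x then convolution G f (Rep_ell2 \<xi>) g else 0))"

definition reduced_norm :: "('g, 'x) groupoid \<Rightarrow> ('g \<Rightarrow> complex) \<Rightarrow> real" where
  "reduced_norm G f = (SUP x\<in>units G. norm (fibre_rep G x f))"

text \<open>\<open>C*\<^sub>r(G)\<close> is the completion of \<open>C\<^sub>c(G)\<close> in the reduced norm: Cauchy sequences modulo null
  sequences.\<close>

definition reduced_cauchy :: "('g, 'x) groupoid \<Rightarrow> (nat \<Rightarrow> 'g \<Rightarrow> complex) set" where
  "reduced_cauchy G =
     {f. (\<forall>n. f n \<in> Cc G) \<and>
         (\<forall>\<epsilon>>0. \<exists>N. \<forall>m\<ge>N. \<forall>n\<ge>N. reduced_norm G (\<lambda>g. f m g - f n g) < \<epsilon>)}"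

definition reduced_null :: "('g, 'x) groupoid \<Rightarrow> ((nat \<Rightarrow> 'g \<Rightarrow> complex) \<times> (nat \<Rightarrow> 'g \<Rightarrow> complex)) set" where
  "reduced_null G =
     {(f, k). f \<in> reduced_cauchy G \<and> k \<in> reduced_cauchy G \<and>
              (\<lambda>n. reduced_norm G (\<lambda>g. f n g - k n g)) \<longlonglongrightarrow> 0}"

definition reduced_groupoid_Cstar :: "('g, 'x) groupoid \<Rightarrow> (nat \<Rightarrow> 'g \<Rightarrow> complex) set set" where
  "reduced_groupoid_Cstar G = reduced_cauchy G // reduced_null G"

definition reduced_groupoid_zero :: "('g, 'x) groupoid \<Rightarrow> (nat \<Rightarrow> 'g \<Rightarrow> complex) set" where
  "reduced_groupoid_zero G = reduced_null G `` {\<lambda>_ _. 0}"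


section \<open>The groupoids of a left cancellative monoid\<close>

text \<open>Characters take values in \<open>bool\<close> in place of \<open>{0,1}\<close> and are \<open>undefined\<close> outside the
  semigroup of idempotents, in accordance with \<^const>\<open>product_topology\<close>.\<close>

type_synonym 's hull_char = "('s \<rightharpoonup> 's) \<Rightarrow> bool"

definition hull_chars :: "'s::monoid_mult hull_char set" where
  "hull_chars =
     {\<phi> \<in> (hull_idempotents \<rightarrow>\<^sub>E UNIV).
        (\<exists>p\<in>hull_idempotents. \<phi> p) \<and>
        (\<forall>p\<in>hull_idempotents. \<forall>q\<in>hull_idempotents. \<phi> (p \<circ>\<^sub>m q) \<longleftrightarrow> \<phi> p \<and> \<phi> q)}"

definition hull_char_topology :: "'s::monoid_mult hull_char topology" where
  "hull_char_topology =
     subtopology (product_topology (\<lambda>_. discrete_topology UNIV) hull_idempotents) hull_chars"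

definition point_char :: "'s::monoid_mult \<Rightarrow> 's hull_char" where
  "point_char s = restrict (\<lambda>p. s \<in> dom p) hull_idempotents"

definition Omega :: "'s::monoid_mult hull_char set" where
  "Omega = hull_char_topology closure_of (range point_char)"

text \<open>The extension of \<open>\<phi> \<in> \<Omega>(S)\<close> to the sets in \<^const>\<open>constructible_differences\<close>.\<close>

definition char_ext :: "'s::monoid_mult hull_char \<Rightarrow> 's set \<Rightarrow> bool" where
  "char_ext \<phi> Z \<longleftrightarrow>
     (\<exists>X F. X \<in> constructible_ideals \<and> finite F \<and> F \<subseteq> constructible_ideals \<and>
            Z = X - \<Union>F \<and> \<phi> (pid X) \<and> (\<forall>Y\<in>F. \<not> \<phi> (pid Y)))"

definition char_domain :: "('s::monoid_mult \<rightharpoonup> 's) \<Rightarrow> 's hull_char set" where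
  "char_domain g = {\<phi> \<in> hull_chars. \<phi> (pinverse g \<circ>\<^sub>m g)}"

text \<open>The character \<open>\<phi>(g\<^sup>-\<^sup>1 \<cdot> g)\<close>.\<close>

definition char_act :: "('s::monoid_mult \<rightharpoonup> 's) \<Rightarrow> 's hull_char \<Rightarrow> 's hull_char" where
  "char_act g \<phi> = restrict (\<lambda>p. \<phi> (pinverse g \<circ>\<^sub>m p \<circ>\<^sub>m g)) hull_idempotents"

definition germ_rel ::
    "((('s::monoid_mult \<rightharpoonup> 's) \<times> 's hull_char) \<times> (('s \<rightharpoonup> 's) \<times> 's hull_char)) set" where
  "germ_rel =
     {((g, \<phi>), (h, \<psi>)). g \<in> left_inverse_hull \<and> \<phi> \<in> char_domain g \<and>
        h \<in> left_inverse_hull \<and> \<psi> \<in> char_domain h \<and>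
        \<phi> = \<psi> \<and> (\<exists>p\<in>hull_idempotents. \<phi> p \<and> g \<circ>\<^sub>m p = h \<circ>\<^sub>m p)}"

type_synonym 's germ = "(('s \<rightharpoonup> 's) \<times> 's hull_char) set"

definition germ :: "('s::monoid_mult \<rightharpoonup> 's) \<Rightarrow> 's hull_char \<Rightarrow> 's germ" where
  "germ g \<phi> = germ_rel `` {(g, \<phi>)}"

definition paterson_groupoid :: "('s::monoid_mult germ, 's hull_char) groupoid" where
  "paterson_groupoid =
     \<lparr>arrows = {germ g \<phi> | g \<phi>. g \<in> left_inverse_hull \<and> \<phi> \<in> char_domain g},
      units = hull_chars,
      gsource = (\<lambda>P. the_elem (snd ` P)),
      grange = (\<lambda>P. the_elem ((\<lambda>(g, \<phi>). char_act g \<phi>) ` P)),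
      gmult = (\<lambda>P Q. \<Union>(g, \<phi>)\<in>P. \<Union>(h, \<psi>)\<in>Q. germ (g \<circ>\<^sub>m h) \<psi>),
      ginv = (\<lambda>P. \<Union>(g, \<phi>)\<in>P. germ (pinverse g) (char_act g \<phi>)),
      gtop = topology_generated_by
        {germ g ` U | g U. g \<in> left_inverse_hull \<and> U \<subseteq> char_domain g \<and>
                           openin hull_char_topology U}\<rparr>"

definition monoid_paterson_groupoid :: "('s::monoid_mult germ, 's hull_char) groupoid" where
  "monoid_paterson_groupoid = reduction paterson_groupoid Omega"

definition germ_identification :: "('s::monoid_mult germ \<times> 's germ) set" where
  "germ_identification =
     {(germ g \<phi>, germ h \<phi>) | g h \<phi>.
        g \<in> left_inverse_hull \<and> h \<in> left_inverse_hull \<and>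
        \<phi> \<in> Omega \<and> \<phi> \<in> char_domain g \<and> \<phi> \<in> char_domain h \<and>
        (\<exists>X\<in>constructible_differences. char_ext \<phi> X \<and> g |` X = h |` X)}"

definition monoid_groupoid :: "('s::monoid_mult germ set, 's hull_char) groupoid" where
  "monoid_groupoid = quotient_groupoid monoid_paterson_groupoid germ_identification"

text \<open>The bijection \<open>s \<mapsto> [s, \<chi>\<^sub>e]\<close> of \<open>S\<close> onto the source fibre at \<open>\<chi>\<^sub>e\<close>, which is \<open>point_char 1\<close>.\<close>

definition unit_fibre :: "'s::monoid_mult \<Rightarrow> 's germ set" where
  "unit_fibre s = germ_identification `` {germ (left_translation s) (point_char 1)}"

definition unit_rep :: "('s::monoid_mult germ set \<Rightarrow> complex) \<Rightarrow> ('s ell2 \<Rightarrow>\<^sub>L 's ell2)" where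
  "unit_rep f =
     pull_ell2 unit_fibre o\<^sub>L fibre_rep monoid_groupoid (point_char 1) f o\<^sub>L push_ell2 unit_fibre"

text \<open>The homomorphism \<open>\<rho>\<^bsub>\<chi>\<^sub>e\<^esub> : C*\<^sub>r(G(S)) \<rightarrow> C*\<^sub>r(S)\<close>, that is, the continuous extension of
  \<^const>\<open>unit_rep\<close> to the completion.\<close>

definition reduced_hom ::
    "(nat \<Rightarrow> 's::monoid_mult germ set \<Rightarrow> complex) set \<Rightarrow> ('s ell2 \<Rightarrow>\<^sub>L 's ell2)" where
  "reduced_hom a =
     (THE P. P \<in> reduced_monoid_Cstar \<and> (\<forall>f\<in>a. (\<lambda>n. unit_rep (f n)) \<longlonglongrightarrow> P))"


section \<open>Monoid presentations and the monoid \<open>T\<close>\<close>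

inductive presentation_eq :: "('g list \<Rightarrow> 'g list \<Rightarrow> bool) \<Rightarrow> 'g list \<Rightarrow> 'g list \<Rightarrow> bool"
  for R where
  rel: "R u v \<Longrightarrow> presentation_eq R u v"
| refl: "presentation_eq R u u"
| sym: "presentation_eq R u v \<Longrightarrow> presentation_eq R v u"
| trans: "presentation_eq R u v \<Longrightarrow> presentation_eq R v w \<Longrightarrow> presentation_eq R u w"
| append: "presentation_eq R u u' \<Longrightarrow> presentation_eq R v v' \<Longrightarrow> presentation_eq R (u @ v) (u' @ v')"

lemma equivp_presentation_eq: "equivp (presentation_eq R)"
  by (rule equivpI)
     (auto intro!: reflpI sympI transpI
           intro: presentation_eq.refl presentation_eq.sym presentation_eq.trans)

datatype gen = Gen_a | Gen_b | Gen_c | Gen_x int | Gen_y int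

inductive T_rel :: "gen list \<Rightarrow> gen list \<Rightarrow> bool" where
  abx: "T_rel [Gen_a, Gen_b, Gen_x n] [Gen_b, Gen_x n]"
| aby: "T_rel [Gen_a, Gen_b, Gen_y n] [Gen_b, Gen_y (n + 1)]"
| cbx: "T_rel [Gen_c, Gen_b, Gen_x n] [Gen_b, Gen_x (n + 1)]"
| cby: "T_rel [Gen_c, Gen_b, Gen_y n] [Gen_b, Gen_y n]"

quotient_type T = "gen list" / "presentation_eq T_rel"
  by (rule equivp_presentation_eq)

instantiation T :: monoid_mult
begin

lift_definition one_T :: T is "[]" .
lift_definition times_T :: "T \<Rightarrow> T \<Rightarrow> T" is "(@)"
  by (rule presentation_eq.append)

instance
proof
  fix r s t :: T
  show "r * s * t = r * (s * t)" by transfer (simp add: presentation_eq.refl)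
  show "1 * t = t" by transfer (simp add: presentation_eq.refl)
  show "t * 1 = t" by transfer (simp add: presentation_eq.refl)
qed

end

end

theory Submission
  imports Defs
begin

text \<open>\<open>T\<close> acts on words by left multiplication of normal forms, and the generators act
  injectively; this gives left cancellation. Put \<open>X = aT \<inter> bT\<close>, which is the disjoint union of the
  \<open>bx\<^sub>nT\<close>, fixed by \<open>a\<close> and permuted by \<open>c\<close>, and of the \<open>by\<^sub>nT\<close>, fixed by \<open>c\<close> and permuted by \<open>a\<close>. The
  crucial fact is that a constructible ideal either contains \<open>X\<close> or meets only finitely many of
  these pieces, so no set of the form \<open>Z - \<Union>F\<close> can single out infinitely many \<open>bx\<^sub>n\<close> without
  containing some \<open>by\<^sub>n\<close>. Hence \<open>X\<close> cannot be covered as C*-regularity demands.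

  For the same reason the \<open>\<chi>\<^bsub>bx\<^sub>n\<^esub>\<close> and the \<open>\<chi>\<^bsub>by\<^sub>n\<^esub>\<close> have a common limit \<open>\<chi>\<close> with \<open>\<chi>(Z) = 1\<close> iff
  \<open>X \<subseteq> Z\<close>; it is the only character in \<open>\<Omega>\<close> that lives on \<open>X\<close> but on none of the pieces. Therefore
  \<open>(1\<^sub>a - 1)(1\<^sub>c - 1)\<close>, cut down to the characters living on \<open>X\<close>, vanishes except over \<open>\<chi>\<close>, where its
  value at the unit is nonzero. As \<open>\<chi>\<close> is not in the orbit of \<open>\<chi>\<^sub>e\<close>, the representation at \<open>\<chi>\<^sub>e\<close>
  annihilates this function, while the one at \<open>\<chi>\<close> does not. That every \<open>\<rho>\<^sub>x(f)\<close> is bounded,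
  uniformly in \<open>x\<close>, holds because a function in \<open>C\<^sub>c\<close> is bounded and supported on finitely many
  open bisections.\<close>

section \<open>The left inverse hull and its characters\<close>

text \<open>The dichotomy for ideals cannot be proved for the pieces of X alone: to obtain it for
  s^-1 Z and the family u l T, with l running through all x_n and y_n, it has to be known for Z and
  the family s u l T. It is therefore proved for every u. Images t Z are built up one generator g at
  a time, and here it is decisive that a and c permute the pieces of X: left division by g succeeds
  either for a whole family at once or for at most one of its members.

  The kernel element exists because \<G>(T) is not Hausdorff. The germs of a and 1 agree over all
  characters living on some b x_n T, and such characters converge to \<chi>, where the two germs
  differ; c and the b y_n T behave in the same way. So a combination of indicator functions can be
  supported over the single character \<chi>. It has to be cut down to X because a and c fix no
  element outside X.

  The theory of \<G>(S) is developed in a type class; for T it only takes the proof of left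
  cancellation.\<close>

class left_cancellative_monoid = monoid_mult +
  assumes mult_left_cancel: "s * t = s * u \<Longrightarrow> t = u"

notation constructible_ideals ("\<J>")

text \<open>\<open>pvim g X\<close> is the domain of p_X g. Conjugating an idempotent, g^-1 p_X g,
  and with it the action on characters, thus becomes a computation with sets.\<close>

definition pvim :: "('a \<rightharpoonup> 'b) \<Rightarrow> 'b set \<Rightarrow> 'a set" where
  "pvim g X = {s. \<exists>t\<in>X. g s = Some t}"

definition pimg :: "('a \<rightharpoonup> 'b) \<Rightarrow> 'a set \<Rightarrow> 'b set" where
  "pimg g X = {t. \<exists>s\<in>X. g s = Some t}"

text \<open>Injectivity is a hypothesis on g, because for elements of the hull it is itself proved
  by an induction whose inverse case needs this equivalence.\<close>

lemma pinverse_eq_Some_aux: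
  assumes "\<And>s t u. g s = Some u \<Longrightarrow> g t = Some u \<Longrightarrow> s = t"
  shows "pinverse g t = Some s \<longleftrightarrow> g s = Some t"
proof -
  have "(THE s. g s = Some t) = s" if "g s = Some t" for s
    using that assms by blast
  then show ?thesis
    by (auto simp: pinverse_def ran_def)
qed

lemma hull_inj:
  fixes g :: "'s::left_cancellative_monoid \<rightharpoonup> 's"
  assumes "g \<in> left_inverse_hull" "g s = Some u" "g t = Some u"
  shows "s = t"
  using assms
proof (induction arbitrary: s t u)
  case (left_translation r)
  then show ?case
    by (auto simp: left_translation_def dest: mult_left_cancel)
next
  case (pinverse g)
  then have "g u = Some s" "g u = Some t"
    using pinverse_eq_Some_aux[of g] by blast+
  then show ?case
    by simp
next
  case (mult g h)
  then show ?case
    by (auto simp: map_comp_Some_iff)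
qed

lemma pinverse_eq_Some:
  fixes g :: "'s::left_cancellative_monoid \<rightharpoonup> 's"
  shows "g \<in> left_inverse_hull \<Longrightarrow> pinverse g t = Some s \<longleftrightarrow> g s = Some t"
  by (rule pinverse_eq_Some_aux) (rule hull_inj)

lemma pinverse_pinverse [simp]:
  fixes g :: "'s::left_cancellative_monoid \<rightharpoonup> 's"
  assumes "g \<in> left_inverse_hull"
  shows "pinverse (pinverse g) = g"
proof
  fix t
  show "pinverse (pinverse g) t = g t"
    using pinverse_eq_Some[OF assms] pinverse_eq_Some[OF left_inverse_hull.pinverse[OF assms]]
    by (metis not_Some_eq)
qed

lemma pvim_pinverse [simp]:
  fixes g :: "'s::left_cancellative_monoid \<rightharpoonup> 's"
  shows "g \<in> left_inverse_hull \<Longrightarrow> pvim (pinverse g) X = pimg g X"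
    and "g \<in> left_inverse_hull \<Longrightarrow> pimg (pinverse g) X = pvim g X"
  by (simp_all add: pvim_def pimg_def pinverse_eq_Some)

lemma pvim_comp: "pvim (g \<circ>\<^sub>m h) X = pvim h (pvim g X)"
  and pimg_comp: "pimg (g \<circ>\<^sub>m h) X = pimg g (pimg h X)"
  by (auto simp: pvim_def pimg_def map_comp_Some_iff)

lemma pvim_UNIV [simp]: "pvim g UNIV = dom g"
  by (auto simp: pvim_def)

lemma pvim_Int: "pvim g (X \<inter> Y) = pvim g X \<inter> pvim g Y"
  by (auto simp: pvim_def)

lemma pvim_Diff_Union: "pvim g (X - \<Union>F) = pvim g X - \<Union>(pvim g ` F)"
  by (auto simp: pvim_def)

lemma pvim_pimg:
  fixes g :: "'s::left_cancellative_monoid \<rightharpoonup> 's"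
  assumes "g \<in> left_inverse_hull"
  shows "pvim g (pimg g X) = X \<inter> dom g"
  using hull_inj[OF assms] by (auto simp: pimg_def pvim_def)

lemma dom_pid [simp]: "dom (pid X) = X"
  by (simp add: pid_def)

lemma pid_eq_Some [simp]: "pid X s = Some t \<longleftrightarrow> s \<in> X \<and> t = s"
  by (auto simp: pid_def restrict_map_def)

lemma pid_inject [simp]: "pid X = pid Y \<longleftrightarrow> X = Y"
  by (metis dom_pid)

lemma pvim_pid: "pvim (pid X) Y = X \<inter> Y"
  by (auto simp: pvim_def)

lemma map_eqI: "(\<And>s t. f s = Some t \<longleftrightarrow> g s = Some t) \<Longrightarrow> f = g"
  by (metis ext not_Some_eq)

lemma pid_comp: "pid X \<circ>\<^sub>m pid Y = pid (X \<inter> Y)"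
  by (rule map_eqI) (auto simp: map_comp_Some_iff)

lemma comp_pid: "g \<circ>\<^sub>m pid X = g |` X"
  by (rule map_eqI) (auto simp: map_comp_Some_iff restrict_map_def)

lemma pinverse_pid_comp:
  fixes g :: "'s::left_cancellative_monoid \<rightharpoonup> 's"
  assumes "g \<in> left_inverse_hull"
  shows "pinverse g \<circ>\<^sub>m pid X \<circ>\<^sub>m g = pid (pvim g X)"
  using hull_inj[OF assms]
  by (intro map_eqI) (auto simp: map_comp_Some_iff pinverse_eq_Some[OF assms] pvim_def)

lemma pinverse_comp:
  fixes g :: "'s::left_cancellative_monoid \<rightharpoonup> 's"
  assumes "g \<in> left_inverse_hull"
  shows "pinverse g \<circ>\<^sub>m g = pid (dom g)"
  using hull_inj[OF assms]
  by (intro map_eqI) (auto simp: map_comp_Some_iff pinverse_eq_Some[OF assms])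


section \<open>Constructible ideals and the idempotents of the hull\<close>

lemma UNIV_constructible [simp]: "UNIV \<in> \<J>"
  unfolding constructible_ideals_def by (rule CollectI, rule exI[of _ "[]"]) simp

lemma foldr_constructible:
  assumes "X \<in> \<J>"
  shows "(*) s -` ((*) t ` X) \<in> \<J>"
proof -
  obtain sts where "X = foldr (\<lambda>(s, t) X. (*) s -` ((*) t ` X)) sts UNIV"
    using assms unfolding constructible_ideals_def by blast
  then show ?thesis
    unfolding constructible_ideals_def by (intro CollectI exI[of _ "(s, t) # sts"]) simp
qed

lemma vimage_constructible: "X \<in> \<J> \<Longrightarrow> (*) s -` X \<in> \<J>"
  using foldr_constructible[of X s 1] by simp

lemma image_constructible: "X \<in> \<J> \<Longrightarrow> (*) t ` X \<in> \<J>"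
  using foldr_constructible[of X 1 t] by (simp add: vimage_def)

lemma pvim_left_translation: "pvim (left_translation s) X = (*) s -` X"
  and pimg_left_translation: "pimg (left_translation s) X = (*) s ` X"
  by (auto simp: pvim_def pimg_def left_translation_def)

text \<open>Images and preimages are treated together because passing to the inverse exchanges
  them.\<close>

lemma pvim_pimg_constructible:
  fixes g :: "'s::left_cancellative_monoid \<rightharpoonup> 's"
  assumes "g \<in> left_inverse_hull"
  shows "\<forall>X\<in>\<J>. pvim g X \<in> \<J> \<and> pimg g X \<in> \<J>"
  using assms
proof induction
  case (left_translation s)
  then show ?case
    by (simp add: pvim_left_translation pimg_left_translation image_constructible vimage_constructible)
qed (simp_all add: pvim_comp pimg_comp)

lemmas pvim_constructible = pvim_pimg_constructible[THEN bspec, THEN conjunct1]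
lemmas pimg_constructible = pvim_pimg_constructible[THEN bspec, THEN conjunct2]

lemma dom_constructible:
  fixes g :: "'s::left_cancellative_monoid \<rightharpoonup> 's"
  shows "g \<in> left_inverse_hull \<Longrightarrow> dom g \<in> \<J>"
  using pvim_constructible[of g UNIV] by simp

lemma pid_pvim_hull:
  fixes g :: "'s::left_cancellative_monoid \<rightharpoonup> 's"
  assumes "g \<in> left_inverse_hull" "pid X \<in> left_inverse_hull"
  shows "pid (pvim g X) \<in> left_inverse_hull"
  using assms pinverse_pid_comp[of g X] by (metis left_inverse_hull.intros(2,3))

lemma pid_UNIV: "pid UNIV = left_translation 1"
  by (simp add: pid_def left_translation_def fun_eq_iff)

text \<open>A constructible ideal arises from the whole monoid by images and preimages under
  translations; on idempotents these are conjugations by elements of the hull.\<close>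

lemma pid_hull:
  fixes X :: "'s::left_cancellative_monoid set"
  assumes "X \<in> \<J>"
  shows "pid X \<in> left_inverse_hull"
proof -
  obtain sts where X: "X = foldr (\<lambda>(s, t) X. (*) s -` ((*) t ` X)) sts UNIV"
    using assms unfolding constructible_ideals_def by blast
  have "pid (foldr (\<lambda>(s, t) X. (*) s -` ((*) t ` X)) sts UNIV :: 's set) \<in> left_inverse_hull"
  proof (induction sts)
    case Nil
    then show ?case
      by (simp add: pid_UNIV left_inverse_hull.left_translation)
  next
    case (Cons st sts)
    have "pid ((*) t ` Y) \<in> left_inverse_hull" if "pid Y \<in> left_inverse_hull" for Y :: "'s set" and t
      using pid_pvim_hull[OF left_inverse_hull.pinverse[OF left_inverse_hull.left_translation[of t]] that]
      by (simp add: left_inverse_hull.left_translation pimg_left_translation)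
    moreover have "pid ((*) s -` Y) \<in> left_inverse_hull" if "pid Y \<in> left_inverse_hull" for Y :: "'s set" and s
      using pid_pvim_hull[OF left_inverse_hull.left_translation[of s] that]
      by (simp add: pvim_left_translation)
    ultimately show ?case
      using Cons by (simp add: case_prod_beta)
  qed
  then show ?thesis
    unfolding X .
qed

lemma Int_constructible:
  fixes X :: "'s::left_cancellative_monoid set"
  shows "X \<in> \<J> \<Longrightarrow> Y \<in> \<J> \<Longrightarrow> X \<inter> Y \<in> \<J>"
  using pvim_constructible[OF pid_hull, of X Y] by (simp add: pvim_pid)

lemma Inter_constructible:
  fixes F :: "'s::left_cancellative_monoid set set"
  assumes "finite F" "F \<subseteq> \<J>"
  shows "\<Inter>F \<in> \<J>"
  using assms by (induction) (auto intro: Int_constructible)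

text \<open>If p s = t, then idempotence gives p t = t and injectivity gives s = t, so p is the
  identity of its domain.\<close>

lemma hull_idempotents_eq:
  "hull_idempotents = pid ` (\<J> :: 's::left_cancellative_monoid set set)"
proof (intro set_eqI iffI)
  fix p :: "'s \<rightharpoonup> 's"
  assume "p \<in> hull_idempotents"
  then have p: "p \<in> left_inverse_hull" "p \<circ>\<^sub>m p = p"
    by (auto simp: hull_idempotents_def)
  have "p s = Some t \<longleftrightarrow> pid (dom p) s = Some t" for s t
  proof
    assume st: "p s = Some t"
    then have "p t = Some t"
      using p(2) by (metis map_comp_simps(2))
    then show "pid (dom p) s = Some t"
      using hull_inj[OF p(1) st] st by (auto simp: dom_def)
  next
    assume "pid (dom p) s = Some t"
    then obtain u where "p s = Some u" "t = s" by auto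
    moreover from this have "p u = Some u"
      using p(2) by (metis map_comp_simps(2))
    ultimately show "p s = Some t"
      using hull_inj[OF p(1), of s u u] by simp
  qed
  then have "p = pid (dom p)"
    by (rule map_eqI)
  then show "p \<in> pid ` \<J>"
    using dom_constructible[OF p(1)] by blast
qed (auto simp: hull_idempotents_def pid_comp intro: pid_hull)

lemma pid_idempotent [simp]:
  fixes X :: "'s::left_cancellative_monoid set"
  shows "pid X \<in> hull_idempotents \<longleftrightarrow> X \<in> \<J>"
  by (auto simp: hull_idempotents_eq)


section \<open>Characters as filters of constructible ideals\<close>

lemma hull_char_Int:
  fixes X :: "'s::left_cancellative_monoid set"
  assumes "\<phi> \<in> hull_chars" "X \<in> \<J>" "Y \<in> \<J>"
  shows "\<phi> (pid (X \<inter> Y)) \<longleftrightarrow> \<phi> (pid X) \<and> \<phi> (pid Y)"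
  using assms by (auto simp: hull_chars_def pid_comp[symmetric])

lemma hull_char_UNIV [simp]:
  fixes \<phi> :: "'s::left_cancellative_monoid hull_char"
  assumes "\<phi> \<in> hull_chars"
  shows "\<phi> (pid UNIV)"
proof -
  obtain X :: "'s set" where "X \<in> \<J>" "\<phi> (pid X)"
    using assms by (auto simp: hull_chars_def hull_idempotents_eq)
  then show ?thesis
    using hull_char_Int[OF assms, of X UNIV] by simp
qed

lemma hull_char_mono:
  fixes X :: "'s::left_cancellative_monoid set"
  assumes "\<phi> \<in> hull_chars" "X \<in> \<J>" "Y \<in> \<J>" "X \<subseteq> Y" "\<phi> (pid X)"
  shows "\<phi> (pid Y)"
  using hull_char_Int[OF assms(1-3)] assms(4,5) by (simp add: inf.absorb1)

lemma hull_charI: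
  fixes \<phi> :: "'s::left_cancellative_monoid hull_char"
  assumes "\<phi> \<in> extensional hull_idempotents" "\<phi> (pid UNIV)"
    "\<And>X Y. X \<in> \<J> \<Longrightarrow> Y \<in> \<J> \<Longrightarrow> \<phi> (pid (X \<inter> Y)) \<longleftrightarrow> \<phi> (pid X) \<and> \<phi> (pid Y)"
  shows "\<phi> \<in> hull_chars"
  using assms by (auto simp: hull_chars_def hull_idempotents_eq PiE_def pid_comp)

lemma hull_char_eqI:
  fixes \<phi> :: "'s::left_cancellative_monoid hull_char"
  assumes "\<phi> \<in> hull_chars" "\<psi> \<in> hull_chars" "\<And>X. X \<in> \<J> \<Longrightarrow> \<phi> (pid X) \<longleftrightarrow> \<psi> (pid X)"
  shows "\<phi> = \<psi>"
proof (rule extensionalityI[of _ hull_idempotents])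
  show "\<phi> \<in> extensional hull_idempotents" "\<psi> \<in> extensional hull_idempotents"
    using assms(1,2) by (auto simp: hull_chars_def PiE_def)
qed (use assms(3) in \<open>auto simp: hull_idempotents_eq\<close>)

lemma hull_char_Inter:
  fixes F :: "'s::left_cancellative_monoid set set"
  assumes "\<phi> \<in> hull_chars" "finite F" "F \<subseteq> \<J>"
  shows "\<phi> (pid (\<Inter>F)) \<longleftrightarrow> (\<forall>X\<in>F. \<phi> (pid X))"
  using assms(2,3)
  by (induction) (simp_all add: assms(1) hull_char_Int[OF assms(1)] Inter_constructible)

lemma point_char_pid [simp]:
  fixes X :: "'s::left_cancellative_monoid set"
  shows "X \<in> \<J> \<Longrightarrow> point_char s (pid X) \<longleftrightarrow> s \<in> X"
  by (simp add: point_char_def)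

lemma point_char_hull_char [simp]: "point_char (s :: 's::left_cancellative_monoid) \<in> hull_chars"
  by (rule hull_charI) (auto simp: Int_constructible, simp add: point_char_def)

section \<open>Topology of the space of characters\<close>

definition cylinder :: "'s::monoid_mult set \<Rightarrow> 's set set \<Rightarrow> 's hull_char set" where
  "cylinder X F = {\<phi> \<in> hull_chars. \<phi> (pid X) \<and> (\<forall>Y\<in>F. \<not> \<phi> (pid Y))}"

lemma topspace_hull_char: "topspace hull_char_topology = hull_chars"
  by (auto simp: hull_char_topology_def topspace_subtopology hull_chars_def)

lemma coordinate_clopen:
  assumes "p \<in> I"
  shows "openin (product_topology (\<lambda>_. discrete_topology UNIV) I)
           {\<phi> \<in> topspace (product_topology (\<lambda>_. discrete_topology UNIV) I). \<phi> p \<in> V}"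
    and "closedin (product_topology (\<lambda>_. discrete_topology UNIV) I)
           {\<phi> \<in> topspace (product_topology (\<lambda>_. discrete_topology UNIV) I). \<phi> p \<in> V}"
proof -
  have c: "continuous_map (product_topology (\<lambda>_. discrete_topology UNIV) I) (discrete_topology UNIV) (\<lambda>\<phi>. \<phi> p)"
    using assms by (rule continuous_map_product_projection)
  show "openin (product_topology (\<lambda>_. discrete_topology UNIV) I)
           {\<phi> \<in> topspace (product_topology (\<lambda>_. discrete_topology UNIV) I). \<phi> p \<in> V}"
    by (rule openin_continuous_map_preimage[OF c]) simp
  show "closedin (product_topology (\<lambda>_. discrete_topology UNIV) I)
           {\<phi> \<in> topspace (product_topology (\<lambda>_. discrete_topology UNIV) I). \<phi> p \<in> V}"
    by (rule closedin_continuous_map_preimage[OF c]) simp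
qed

lemma coordinate_open:
  fixes X :: "'s::left_cancellative_monoid set"
  assumes "X \<in> \<J>"
  shows "openin hull_char_topology {\<phi> \<in> hull_chars. \<phi> (pid X)}"
    and "openin hull_char_topology {\<phi> \<in> hull_chars. \<not> \<phi> (pid X)}"
proof -
  have "openin hull_char_topology {\<phi> \<in> hull_chars. \<phi> (pid X) \<in> V}" for V
  proof -
    have "{\<phi> \<in> hull_chars. \<phi> (pid X) \<in> V} = {\<phi> \<in> topspace (product_topology (\<lambda>_. discrete_topology UNIV)
        hull_idempotents). \<phi> (pid X) \<in> V} \<inter> hull_chars"
      by (auto simp: hull_chars_def)
    then show ?thesis
      unfolding hull_char_topology_def openin_subtopology
      using coordinate_clopen(1)[of "pid X" hull_idempotents V] assms by auto
  qed
  from this[of "{True}"] this[of "{False}"]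
  show "openin hull_char_topology {\<phi> \<in> hull_chars. \<phi> (pid X)}"
    and "openin hull_char_topology {\<phi> \<in> hull_chars. \<not> \<phi> (pid X)}"
    by simp_all
qed

lemma openin_cylinder:
  fixes X :: "'s::left_cancellative_monoid set"
  assumes "X \<in> \<J>" "finite F" "F \<subseteq> \<J>"
  shows "openin hull_char_topology (cylinder X F)"
proof -
  have "cylinder X F = (\<Inter>Y\<in>F. {\<phi> \<in> hull_chars. \<not> \<phi> (pid Y)}) \<inter> {\<phi> \<in> hull_chars. \<phi> (pid X)}"
    by (auto simp: cylinder_def)
  moreover have "openin hull_char_topology ((\<Inter>Y\<in>F. {\<phi> \<in> hull_chars. \<not> \<phi> (pid Y)}) \<inter> {\<phi> \<in> hull_chars. \<phi> (pid X)})"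
    using assms(2,3)
  proof (induction)
    case (insert Y F)
    then show ?case
      using openin_Int[OF coordinate_open(2)[of Y]] by (simp add: Int_assoc)
  qed (simp add: coordinate_open assms(1))
  ultimately show ?thesis
    by simp
qed

text \<open>A basic set of the product topology constrains finitely many coordinates. Since
  characters are multiplicative, those with value 1 merge into one at the intersection of the
  ideals, so a single X and a finite F suffice.\<close>

lemma openin_hull_char_topology:
  fixes U :: "'s::left_cancellative_monoid hull_char set"
  shows "openin hull_char_topology U \<longleftrightarrow> U \<subseteq> hull_chars \<and>
    (\<forall>\<phi>\<in>U. \<exists>X F. X \<in> \<J> \<and> finite F \<and> F \<subseteq> \<J> \<and> \<phi> \<in> cylinder X F \<and> cylinder X F \<subseteq> U)"
    (is "_ \<longleftrightarrow> ?R U")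
proof
  assume U: "openin hull_char_topology U"
  show "?R U"
  proof (intro conjI ballI)
    show "U \<subseteq> hull_chars"
      using openin_subset[OF U] by (simp add: topspace_hull_char)
    fix \<phi> assume \<phi>: "\<phi> \<in> U"
    obtain W where W: "openin (product_topology (\<lambda>_. discrete_topology UNIV) hull_idempotents) W"
        "U = W \<inter> hull_chars"
      using U unfolding hull_char_topology_def openin_subtopology by blast
    then obtain V where V: "finite {p \<in> hull_idempotents. V p \<noteq> UNIV}"
        "\<phi> \<in> Pi\<^sub>E hull_idempotents V" "Pi\<^sub>E hull_idempotents V \<subseteq> W"
      using \<phi> unfolding openin_product_topology_alt by auto
    define K where "K = {X \<in> \<J>. V (pid X) \<noteq> UNIV}"
    have "pid ` K \<subseteq> {p \<in> hull_idempotents. V p \<noteq> UNIV}" "inj_on pid K"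
      by (auto simp: K_def intro: inj_onI)
    then have K: "finite K"
      using finite_imageD[OF finite_subset[OF _ V(1)]] by blast
    define A where "A = {X \<in> K. \<phi> (pid X)}"
    define F where "F = {X \<in> K. \<not> \<phi> (pid X)}"
    have AF: "A \<subseteq> K" "F \<subseteq> K" "K \<subseteq> \<J>"
      by (auto simp: A_def F_def K_def)
    then have A: "finite A" "A \<subseteq> \<J>" and F: "finite F" "F \<subseteq> \<J>"
      using K finite_subset by blast+
    have \<phi>c: "\<phi> \<in> hull_chars"
      using \<phi> W by blast
    have "\<phi> \<in> cylinder (\<Inter>A) F"
      using \<phi>c hull_char_Inter[OF \<phi>c A] by (auto simp: cylinder_def A_def F_def)
    moreover have "cylinder (\<Inter>A) F \<subseteq> U"
    proof
      fix \<psi> assume "\<psi> \<in> cylinder (\<Inter>A) F"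
      then have \<psi>: "\<psi> \<in> hull_chars" "\<And>X. X \<in> A \<Longrightarrow> \<psi> (pid X)" "\<And>X. X \<in> F \<Longrightarrow> \<not> \<psi> (pid X)"
        by (auto simp: cylinder_def hull_char_Inter[OF _ A])
      have "\<psi> (pid X) \<in> V (pid X)" if "X \<in> \<J>" for X
      proof (cases "X \<in> K")
        case True
        then have "\<psi> (pid X) = \<phi> (pid X)"
          using \<psi>(2,3) by (cases "\<phi> (pid X)") (auto simp: A_def F_def)
        then show ?thesis
          using V(2) that by auto
      next
        case False
        then show ?thesis
          using that by (simp add: K_def)
      qed
      then have "\<psi> \<in> Pi\<^sub>E hull_idempotents V"
        using \<psi>(1) by (auto simp: hull_idempotents_eq hull_chars_def)
      then show "\<psi> \<in> U"
        using V(3) W(2) \<psi>(1) by blast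
    qed
    ultimately show "\<exists>X F. X \<in> \<J> \<and> finite F \<and> F \<subseteq> \<J> \<and> \<phi> \<in> cylinder X F \<and> cylinder X F \<subseteq> U"
      using Inter_constructible[OF A] F by blast
  qed
next
  assume R: "?R U"
  show "openin hull_char_topology U"
    by (subst openin_subopen) (use R openin_cylinder in meson)
qed

text \<open>Each condition on a character involves at most three coordinates, so the characters form
  a closed subset of a compact product of two-point spaces.\<close>

lemma compact_space_hull_char_topology:
  "compact_space (hull_char_topology :: 's::left_cancellative_monoid hull_char topology)"
proof -
  let ?P = "product_topology (\<lambda>_. discrete_topology (UNIV :: bool set)) (hull_idempotents :: ('s \<rightharpoonup> 's) set)"
  let ?C = "\<lambda>X v. {\<phi> \<in> topspace ?P. \<phi> (pid X) \<in> {v}}"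
  let ?M = "\<lambda>X Y. (?C (X \<inter> Y) True \<inter> ?C X True \<inter> ?C Y True) \<union>
     (?C (X \<inter> Y) False \<inter> (?C X False \<union> ?C Y False))"
  have C: "closedin ?P (?C X v)" if "X \<in> \<J>" for X v
    using coordinate_clopen(2)[of "pid X" hull_idempotents "{v}"] that by simp
  have M: "closedin ?P (?M X Y)" if "X \<in> \<J>" "Y \<in> \<J>" for X Y
    using that by (intro closedin_Un closedin_Int C Int_constructible)
  \<comment> \<open>Being nonzero is replaced by the value 1 at the largest idempotent, which is a
    condition on one coordinate and hence closed.\<close>
  have "hull_chars = \<Inter>(insert (?C UNIV True) ((\<lambda>(X, Y). ?M X Y) ` (\<J> \<times> \<J>)))" (is "_ = ?R")
  proof (intro subset_antisym subsetI)
    fix \<phi> :: "'s hull_char" assume \<phi>: "\<phi> \<in> hull_chars"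
    then have "\<phi> \<in> topspace ?P"
      by (auto simp: hull_chars_def)
    then show "\<phi> \<in> ?R"
      using \<phi> by (auto simp: hull_char_Int)
  next
    fix \<phi> assume "\<phi> \<in> ?R"
    then have "\<phi> \<in> extensional hull_idempotents" "\<phi> (pid UNIV)" "\<And>X Y. X \<in> \<J> \<Longrightarrow> Y \<in> \<J> \<Longrightarrow> \<phi> \<in> ?M X Y"
      by (auto simp: PiE_def)
    then show "\<phi> \<in> hull_chars"
      by (intro hull_charI) auto
  qed
  moreover have "closedin ?P ?R"
    by (rule closedin_Inter) (use C[of UNIV True] M in auto)
  ultimately have "closedin ?P hull_chars"
    by simp
  moreover have "compact_space ?P"
    by (simp add: compact_space_product_topology compact_space_discrete_topology)
  ultimately show ?thesis
    unfolding hull_char_topology_def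
    by (intro compact_space_subtopology closedin_compact_space)
qed

text \<open>\<open>point_char s\<close> lies in \<open>cylinder X F\<close> iff s is in
  \<open>X - \<Union>F\<close>. Approximation by point characters thus becomes non-emptiness of
  constructible differences.\<close>

lemma Omega_iff:
  fixes \<phi> :: "'s::left_cancellative_monoid hull_char"
  shows "\<phi> \<in> Omega \<longleftrightarrow> \<phi> \<in> hull_chars \<and>
    (\<forall>X F. X \<in> \<J> \<longrightarrow> finite F \<longrightarrow> F \<subseteq> \<J> \<longrightarrow> \<phi> (pid X) \<longrightarrow> (\<forall>Y\<in>F. \<not> \<phi> (pid Y)) \<longrightarrow> X - \<Union>F \<noteq> {})"
    (is "_ \<longleftrightarrow> _ \<and> ?R")
proof -
  have mem: "(\<exists>s. point_char s \<in> cylinder X F) \<longleftrightarrow> X - \<Union>F \<noteq> {}"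
    if "X \<in> \<J>" "F \<subseteq> \<J>" for X :: "'s set" and F
  proof -
    have "point_char s \<in> cylinder X F \<longleftrightarrow> s \<in> X - \<Union>F" for s
      using that by (auto simp: cylinder_def subset_iff)
    then show ?thesis by auto
  qed
  show ?thesis
  proof
    assume \<phi>: "\<phi> \<in> Omega"
    then have c: "\<phi> \<in> hull_chars" and o: "\<And>T. \<phi> \<in> T \<Longrightarrow> openin hull_char_topology T \<Longrightarrow> \<exists>s. point_char s \<in> T"
      unfolding Omega_def in_closure_of topspace_hull_char by blast+
    have ?R
    proof (intro allI impI)
      fix X :: "'s set" and F
      assume "X \<in> \<J>" "finite F" "F \<subseteq> \<J>" "\<phi> (pid X)" "\<forall>Y\<in>F. \<not> \<phi> (pid Y)"
      then show "X - \<Union>F \<noteq> {}"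
        using o[of "cylinder X F"] c mem openin_cylinder[of X F] by (auto simp: cylinder_def)
    qed
    with c show "\<phi> \<in> hull_chars \<and> ?R" by blast
  next
    assume R: "\<phi> \<in> hull_chars \<and> ?R"
    show "\<phi> \<in> Omega"
      unfolding Omega_def in_closure_of topspace_hull_char
    proof (intro conjI allI impI)
      fix T assume "\<phi> \<in> T \<and> openin hull_char_topology T"
      then obtain X F where XF: "X \<in> \<J>" "finite F" "F \<subseteq> \<J>" "\<phi> \<in> cylinder X F" "cylinder X F \<subseteq> T"
        unfolding openin_hull_char_topology by blast
      then have "X - \<Union>F \<noteq> {}"
        using R by (auto simp: cylinder_def)
      then show "\<exists>y. y \<in> range point_char \<and> y \<in> T"
        using mem[OF XF(1,3)] XF(5) by blast
    qed (use R in blast)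
  qed
qed


section \<open>The groupoid of a left cancellative monoid\<close>

text \<open>For \<open>b = True\<close> these sets define the germs of the Paterson groupoid, for \<open>b = False\<close> the
  identification of germs that leads to \<open>\<G>(S)\<close>; both cases obey the same rules.\<close>

definition nbhds :: "bool \<Rightarrow> 's::monoid_mult hull_char \<Rightarrow> 's set set" where
  "nbhds b \<phi> = {X - \<Union>F | X F. X \<in> \<J> \<and> finite F \<and> F \<subseteq> \<J> \<and> \<phi> \<in> cylinder X F \<and> (b \<longrightarrow> F = {})}"

lemma nbhdsE:
  assumes "Z \<in> nbhds b \<phi>"
  obtains X F where "Z = X - \<Union>F" "X \<in> \<J>" "finite F" "F \<subseteq> \<J>" "\<phi> \<in> cylinder X F" "b \<longrightarrow> F = {}"
  using assms unfolding nbhds_def by blast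

lemma nbhdsI:
  assumes "Z = X - \<Union>F" "X \<in> \<J>" "finite F" "F \<subseteq> \<J>" "\<phi> \<in> cylinder X F" "b \<longrightarrow> F = {}"
  shows "Z \<in> nbhds b \<phi>"
  using assms unfolding nbhds_def by blast

lemma ideal_nbhds:
  assumes "\<phi> \<in> hull_chars" "X \<in> \<J>" "\<phi> (pid X)"
  shows "X \<in> nbhds b \<phi>"
  by (rule nbhdsI[of _ X "{}"]) (use assms in \<open>auto simp: cylinder_def\<close>)

lemma nbhds_mono: "Z \<in> nbhds b \<phi> \<Longrightarrow> Z \<in> nbhds False \<phi>"
  unfolding nbhds_def by blast

lemma nbhds_Int:
  fixes \<phi> :: "'s::left_cancellative_monoid hull_char"
  assumes "X \<in> nbhds b \<phi>" "Y \<in> nbhds b \<phi>"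
  shows "X \<inter> Y \<in> nbhds b \<phi>"
proof -
  obtain X' F where X: "X = X' - \<Union>F" "X' \<in> \<J>" "finite F" "F \<subseteq> \<J>" "\<phi> \<in> cylinder X' F" "b \<longrightarrow> F = {}"
    using assms(1) by (rule nbhdsE)
  obtain Y' G where Y: "Y = Y' - \<Union>G" "Y' \<in> \<J>" "finite G" "G \<subseteq> \<J>" "\<phi> \<in> cylinder Y' G" "b \<longrightarrow> G = {}"
    using assms(2) by (rule nbhdsE)
  show ?thesis
  proof (rule nbhdsI)
    show "X \<inter> Y = X' \<inter> Y' - \<Union>(F \<union> G)"
      using X(1) Y(1) by blast
    show "\<phi> \<in> cylinder (X' \<inter> Y') (F \<union> G)"
      using X Y by (auto simp: cylinder_def hull_char_Int)
  qed (use X Y in \<open>auto intro: Int_constructible\<close>)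
qed

lemma nbhds_nonempty:
  fixes \<phi> :: "'s::left_cancellative_monoid hull_char"
  assumes "\<phi> \<in> Omega" "X \<in> nbhds b \<phi>"
  shows "X \<noteq> {}"
  using assms(2) by (rule nbhdsE) (use assms(1) in \<open>auto simp: Omega_iff cylinder_def\<close>)

lemma char_ext_iff_nbhds:
  fixes \<phi> :: "'s::left_cancellative_monoid hull_char"
  assumes "\<phi> \<in> hull_chars"
  shows "X \<in> constructible_differences \<and> char_ext \<phi> X \<longleftrightarrow> X \<in> nbhds False \<phi>"
  using assms by (auto simp: constructible_differences_def char_ext_def nbhds_def cylinder_def)

section \<open>The action of the hull on characters\<close>

lemma mem_char_domain:
  fixes g :: "'s::left_cancellative_monoid \<rightharpoonup> 's"
  assumes "g \<in> left_inverse_hull"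
  shows "\<phi> \<in> char_domain g \<longleftrightarrow> \<phi> \<in> hull_chars \<and> \<phi> (pid (dom g))"
  by (simp add: char_domain_def pinverse_comp[OF assms])

lemma char_domain_hull_char: "\<phi> \<in> char_domain g \<Longrightarrow> \<phi> \<in> hull_chars"
  by (simp add: char_domain_def)

lemma char_act_pid:
  fixes g :: "'s::left_cancellative_monoid \<rightharpoonup> 's"
  assumes "g \<in> left_inverse_hull" "X \<in> \<J>"
  shows "char_act g \<phi> (pid X) \<longleftrightarrow> \<phi> (pid (pvim g X))"
  using assms by (simp add: char_act_def pinverse_pid_comp)

lemma char_act_hull_char:
  fixes g :: "'s::left_cancellative_monoid \<rightharpoonup> 's"
  assumes "g \<in> left_inverse_hull" "\<phi> \<in> char_domain g"
  shows "char_act g \<phi> \<in> hull_chars"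
  using assms
  by (intro hull_charI)
     (auto simp: char_act_pid pvim_Int pvim_constructible mem_char_domain Int_constructible hull_char_Int,
      simp add: char_act_def)

lemma cylinder_char_act:
  fixes g :: "'s::left_cancellative_monoid \<rightharpoonup> 's"
  assumes "g \<in> left_inverse_hull" "\<phi> \<in> char_domain g" "X \<in> \<J>" "F \<subseteq> \<J>"
  shows "char_act g \<phi> \<in> cylinder X F \<longleftrightarrow> \<phi> \<in> cylinder (pvim g X) (pvim g ` F)"
  using assms char_act_hull_char[OF assms(1,2)]
  by (auto simp: cylinder_def char_act_pid char_domain_hull_char subset_iff)

lemma nbhds_pvim:
  fixes g :: "'s::left_cancellative_monoid \<rightharpoonup> 's"
  assumes "g \<in> left_inverse_hull" "\<phi> \<in> char_domain g" "X \<in> nbhds b (char_act g \<phi>)"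
  shows "pvim g X \<in> nbhds b \<phi>"
proof -
  obtain X' F where X: "X = X' - \<Union>F" "X' \<in> \<J>" "finite F" "F \<subseteq> \<J>"
      "char_act g \<phi> \<in> cylinder X' F" "b \<longrightarrow> F = {}"
    using assms(3) by (rule nbhdsE)
  show ?thesis
  proof (rule nbhdsI)
    show "pvim g X = pvim g X' - \<Union>(pvim g ` F)"
      unfolding X(1) by (rule pvim_Diff_Union)
  qed (use X assms in \<open>auto simp: cylinder_char_act pvim_constructible subset_iff\<close>)
qed

lemma char_act_pinverse_domain:
  fixes g :: "'s::left_cancellative_monoid \<rightharpoonup> 's"
  assumes "g \<in> left_inverse_hull" "\<phi> \<in> char_domain g"
  shows "char_act g \<phi> \<in> char_domain (pinverse g)"
proof -
  have "pvim g (dom (pinverse g)) = dom g"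
    using assms(1) by (auto simp: pvim_def pinverse_eq_Some dom_def)
  then show ?thesis
    using assms char_act_hull_char[OF assms]
    by (simp add: mem_char_domain left_inverse_hull.pinverse char_act_pid dom_constructible)
qed

lemma char_act_pinverse:
  fixes g :: "'s::left_cancellative_monoid \<rightharpoonup> 's"
  assumes "g \<in> left_inverse_hull" "\<phi> \<in> char_domain g"
  shows "char_act (pinverse g) (char_act g \<phi>) = \<phi>"
proof (rule hull_char_eqI)
  show "char_act (pinverse g) (char_act g \<phi>) \<in> hull_chars"
    by (intro char_act_hull_char left_inverse_hull.pinverse char_act_pinverse_domain assms)
  show "\<phi> \<in> hull_chars"
    using assms(2) by (rule char_domain_hull_char)
  fix X :: "'s set" assume "X \<in> \<J>"
  then show "char_act (pinverse g) (char_act g \<phi>) (pid X) \<longleftrightarrow> \<phi> (pid X)"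
    using assms \<open>\<phi> \<in> hull_chars\<close>
    by (simp add: char_act_pid left_inverse_hull.pinverse pimg_constructible pvim_pimg
        hull_char_Int dom_constructible mem_char_domain)
qed

lemma nbhds_pimg:
  fixes g :: "'s::left_cancellative_monoid \<rightharpoonup> 's"
  assumes "g \<in> left_inverse_hull" "\<phi> \<in> char_domain g" "X \<in> nbhds b \<phi>"
  shows "pimg g X \<in> nbhds b (char_act g \<phi>)"
  using nbhds_pvim[of "pinverse g" "char_act g \<phi>" X b] assms
  by (simp add: char_act_pinverse char_act_pinverse_domain left_inverse_hull.pinverse)

lemma char_act_Omega:
  fixes g :: "'s::left_cancellative_monoid \<rightharpoonup> 's"
  assumes "g \<in> left_inverse_hull" "\<phi> \<in> char_domain g" "\<phi> \<in> Omega"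
  shows "char_act g \<phi> \<in> Omega"
  unfolding Omega_iff
proof (intro conjI allI impI)
  show c: "char_act g \<phi> \<in> hull_chars"
    using assms(1,2) by (rule char_act_hull_char)
  fix X :: "'s set" and F
  assume "X \<in> \<J>" "finite F" "F \<subseteq> \<J>" "char_act g \<phi> (pid X)" "\<forall>Y\<in>F. \<not> char_act g \<phi> (pid Y)"
  then have "X - \<Union>F \<in> nbhds False (char_act g \<phi>)"
    using c by (intro nbhdsI) (auto simp: cylinder_def)
  then have "pvim g (X - \<Union>F) \<noteq> {}"
    using nbhds_pvim nbhds_nonempty assms by blast
  then show "X - \<Union>F \<noteq> {}"
    by (auto simp: pvim_def)
qed

lemma comp_char_domain:
  fixes g :: "'s::left_cancellative_monoid \<rightharpoonup> 's"
  assumes "g \<in> left_inverse_hull" "h \<in> left_inverse_hull"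
    "\<phi> \<in> char_domain h" "char_act h \<phi> \<in> char_domain g"
  shows "\<phi> \<in> char_domain (g \<circ>\<^sub>m h)"
proof -
  have "dom (g \<circ>\<^sub>m h) = pvim h (dom g)"
    using pvim_comp[of g h UNIV] by simp
  then show ?thesis
    using assms by (simp add: mem_char_domain left_inverse_hull.mult char_act_pid dom_constructible)
qed

lemma char_act_comp:
  fixes g :: "'s::left_cancellative_monoid \<rightharpoonup> 's"
  assumes "g \<in> left_inverse_hull" "h \<in> left_inverse_hull"
  shows "char_act (g \<circ>\<^sub>m h) \<phi> = char_act g (char_act h \<phi>)"
proof (rule extensionalityI[of _ hull_idempotents])
  fix p :: "'s \<rightharpoonup> 's" assume "p \<in> hull_idempotents"
  then show "char_act (g \<circ>\<^sub>m h) \<phi> p = char_act g (char_act h \<phi>) p"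
    using assms by (auto simp: hull_idempotents_eq char_act_pid left_inverse_hull.mult pvim_comp
        pvim_constructible)
qed (simp_all add: char_act_def)

section \<open>Agreement of partial bijections near a character\<close>

definition germ_eqv :: "bool \<Rightarrow> ('s::monoid_mult \<rightharpoonup> 's) \<Rightarrow> ('s \<rightharpoonup> 's) \<Rightarrow> 's hull_char \<Rightarrow> bool" where
  "germ_eqv b g h \<phi> \<longleftrightarrow> (\<exists>X\<in>nbhds b \<phi>. \<forall>s\<in>X. g s = h s)"

lemma restrict_map_eq_iff: "g |` X = h |` X \<longleftrightarrow> (\<forall>s\<in>X. g s = h s)"
  by (auto simp: restrict_map_def fun_eq_iff)

lemma germ_eqv_refl:
  fixes \<phi> :: "'s::left_cancellative_monoid hull_char"
  shows "\<phi> \<in> hull_chars \<Longrightarrow> germ_eqv b g g \<phi>"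
  unfolding germ_eqv_def using ideal_nbhds[of \<phi> UNIV b] by auto

lemma germ_eqv_sym: "germ_eqv b g h \<phi> \<longleftrightarrow> germ_eqv b h g \<phi>"
  unfolding germ_eqv_def by metis

lemma germ_eqv_trans:
  fixes \<phi> :: "'s::left_cancellative_monoid hull_char"
  assumes "germ_eqv b f g \<phi>" "germ_eqv b g h \<phi>"
  shows "germ_eqv b f h \<phi>"
proof -
  obtain X Y where "X \<in> nbhds b \<phi>" "\<forall>s\<in>X. f s = g s" "Y \<in> nbhds b \<phi>" "\<forall>s\<in>Y. g s = h s"
    using assms unfolding germ_eqv_def by blast
  then show ?thesis
    unfolding germ_eqv_def using nbhds_Int by (intro bexI[of _ "X \<inter> Y"]) auto
qed

lemma germ_eqv_mono: "germ_eqv b g h \<phi> \<Longrightarrow> germ_eqv False g h \<phi>"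
  unfolding germ_eqv_def using nbhds_mono by blast

lemma germ_eqv_comp:
  fixes \<phi> :: "'s::left_cancellative_monoid hull_char"
  assumes "h \<in> left_inverse_hull" "\<phi> \<in> char_domain h"
    "germ_eqv b g g' (char_act h \<phi>)" "germ_eqv b h h' \<phi>"
  shows "germ_eqv b (g \<circ>\<^sub>m h) (g' \<circ>\<^sub>m h') \<phi>"
proof -
  obtain X Y where X: "X \<in> nbhds b (char_act h \<phi>)" "\<forall>s\<in>X. g s = g' s"
    and Y: "Y \<in> nbhds b \<phi>" "\<forall>s\<in>Y. h s = h' s"
    using assms unfolding germ_eqv_def by blast
  have "pvim h X \<inter> Y \<in> nbhds b \<phi>"
    using assms X Y by (intro nbhds_Int nbhds_pvim)
  moreover have "\<forall>s\<in>pvim h X \<inter> Y. (g \<circ>\<^sub>m h) s = (g' \<circ>\<^sub>m h') s"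
  proof
    fix s assume "s \<in> pvim h X \<inter> Y"
    then obtain t where "h s = Some t" "t \<in> X" "h' s = Some t"
      using Y(2) by (auto simp: pvim_def)
    then show "(g \<circ>\<^sub>m h) s = (g' \<circ>\<^sub>m h') s"
      using X(2) by simp
  qed
  ultimately show ?thesis
    unfolding germ_eqv_def by blast
qed

lemma germ_eqv_pinverse:
  fixes \<phi> :: "'s::left_cancellative_monoid hull_char"
  assumes "g \<in> left_inverse_hull" "h \<in> left_inverse_hull" "\<phi> \<in> char_domain g" "germ_eqv b g h \<phi>"
  shows "germ_eqv b (pinverse g) (pinverse h) (char_act g \<phi>)"
proof -
  obtain X where X: "X \<in> nbhds b \<phi>" "\<forall>s\<in>X. g s = h s"
    using assms unfolding germ_eqv_def by blast
  have "\<forall>t\<in>pimg g X. pinverse g t = pinverse h t"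
  proof
    fix t assume "t \<in> pimg g X"
    then obtain s where "g s = Some t" "h s = Some t"
      using X(2) by (auto simp: pimg_def)
    then show "pinverse g t = pinverse h t"
      using pinverse_eq_Some assms(1,2) by metis
  qed
  then show ?thesis
    unfolding germ_eqv_def using nbhds_pimg[OF assms(1,3) X(1)] by blast
qed

lemma germ_eqv_comp_pinverse:
  fixes \<phi> :: "'s::left_cancellative_monoid hull_char"
  assumes "g \<in> left_inverse_hull" "h \<in> left_inverse_hull" "\<phi> \<in> char_domain g"
    "char_act g \<phi> \<in> char_domain (pinverse h)"
  shows "germ_eqv b (h \<circ>\<^sub>m (pinverse h \<circ>\<^sub>m g)) g \<phi>"
proof -
  have "pvim g (dom (pinverse h)) \<in> nbhds b \<phi>"
    using assms
    by (intro ideal_nbhds)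
       (auto simp: mem_char_domain left_inverse_hull.pinverse char_act_pid dom_constructible pvim_constructible)
  moreover have "\<forall>s\<in>pvim g (dom (pinverse h)). (h \<circ>\<^sub>m (pinverse h \<circ>\<^sub>m g)) s = g s"
    using pinverse_eq_Some[OF assms(2)] by (auto simp: pvim_def)
  ultimately show ?thesis
    unfolding germ_eqv_def by blast
qed

text \<open>Over \<open>\<Omega>\<close> the sets in \<^const>\<open>nbhds\<close> are nonempty, so two partial bijections agreeing on one of
  them cannot move the character to different places.\<close>

lemma char_act_cong:
  fixes \<phi> :: "'s::left_cancellative_monoid hull_char"
  assumes "g \<in> left_inverse_hull" "h \<in> left_inverse_hull" "\<phi> \<in> char_domain g" "\<phi> \<in> char_domain h"
    "\<phi> \<in> Omega" "germ_eqv b g h \<phi>"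
  shows "char_act g \<phi> = char_act h \<phi>"
proof -
  have le: "\<phi> (pid (pvim k X))"
    if h: "g \<in> left_inverse_hull" "k \<in> left_inverse_hull" "germ_eqv b g k \<phi>"
      and X: "X \<in> \<J>" "\<phi> (pid (pvim g X))" for g k X
  proof (rule ccontr)
    assume "\<not> \<phi> (pid (pvim k X))"
    then have "pvim g X - \<Union>{pvim k X} \<in> nbhds False \<phi>"
      using X h assms(5) by (intro nbhdsI[of _ "pvim g X" "{pvim k X}"]) (auto simp: cylinder_def Omega_iff pvim_constructible)
    moreover obtain Y where "Y \<in> nbhds False \<phi>" "\<forall>s\<in>Y. g s = k s"
      using germ_eqv_mono[OF h(3)] unfolding germ_eqv_def by blast
    ultimately obtain s where "s \<in> (pvim g X - \<Union>{pvim k X}) \<inter> Y"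
      using nbhds_nonempty[OF assms(5) nbhds_Int] by blast
    then show False
      using \<open>\<forall>s\<in>Y. g s = k s\<close> by (auto simp: pvim_def)
  qed
  show ?thesis
  proof (rule hull_char_eqI)
    fix X :: "'s set" assume "X \<in> \<J>"
    then show "char_act g \<phi> (pid X) \<longleftrightarrow> char_act h \<phi> (pid X)"
      using le[OF assms(1,2,6)] le[OF assms(2,1)] assms(6)
      by (auto simp: char_act_pid assms(1,2) germ_eqv_sym[of b h])
  qed (simp_all add: char_act_hull_char assms)
qed


section \<open>Structure maps of the Paterson groupoid over \<Omega>\<close>

lemma germ_rel_iff:
  fixes \<phi> :: "'s::left_cancellative_monoid hull_char"
  shows "((g, \<phi>), (h, \<psi>)) \<in> germ_rel \<longleftrightarrow> g \<in> left_inverse_hull \<and> \<phi> \<in> char_domain g \<and>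
     h \<in> left_inverse_hull \<and> \<psi> \<in> char_domain h \<and> \<phi> = \<psi> \<and> germ_eqv True g h \<phi>"
  by (auto simp: germ_rel_def hull_idempotents_eq comp_pid restrict_map_eq_iff germ_eqv_def nbhds_def
      cylinder_def char_domain_hull_char)

lemma image_singletonI: "x \<in> A \<Longrightarrow> (\<And>y. y \<in> A \<Longrightarrow> f y = c) \<Longrightarrow> f ` A = {c}"
  by force

lemma UN_constantI: "x \<in> A \<Longrightarrow> (\<And>y. y \<in> A \<Longrightarrow> B y = C) \<Longrightarrow> (\<Union>y\<in>A. B y) = C"
  by blast

lemma mem_germ:
  fixes \<phi> :: "'s::left_cancellative_monoid hull_char"
  assumes "g \<in> left_inverse_hull" "\<phi> \<in> char_domain g"
  shows "germ g \<phi> = (\<lambda>h. (h, \<phi>)) ` {h \<in> left_inverse_hull. \<phi> \<in> char_domain h \<and> germ_eqv True g h \<phi>}"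
  using assms by (auto simp: germ_def germ_rel_iff)

lemma germ_eq_iff:
  fixes \<phi> :: "'s::left_cancellative_monoid hull_char"
  assumes "g \<in> left_inverse_hull" "\<phi> \<in> char_domain g" "h \<in> left_inverse_hull" "\<psi> \<in> char_domain h"
  shows "germ g \<phi> = germ h \<psi> \<longleftrightarrow> \<phi> = \<psi> \<and> germ_eqv True g h \<phi>"
proof
  assume "germ g \<phi> = germ h \<psi>"
  moreover have "(h, \<psi>) \<in> germ h \<psi>"
    using assms by (simp add: mem_germ germ_eqv_refl char_domain_hull_char)
  ultimately show "\<phi> = \<psi> \<and> germ_eqv True g h \<phi>"
    using assms(1,2) by (auto simp: mem_germ)
next
  assume "\<phi> = \<psi> \<and> germ_eqv True g h \<phi>"
  then show "germ g \<phi> = germ h \<psi>"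
    using assms germ_eqv_trans[of True g h \<phi>] germ_eqv_trans[of True h g \<phi>]
    by (auto simp: mem_germ germ_eqv_sym[of True h g])
qed

lemma gsource_germ:
  fixes \<phi> :: "'s::left_cancellative_monoid hull_char"
  assumes "g \<in> left_inverse_hull" "\<phi> \<in> char_domain g"
  shows "gsource paterson_groupoid (germ g \<phi>) = \<phi>"
proof -
  have "snd ` germ g \<phi> = {\<phi>}"
    using assms germ_eqv_refl[of \<phi> True g] by (auto simp: mem_germ image_iff char_domain_hull_char)
  then show ?thesis
    by (simp add: paterson_groupoid_def)
qed

text \<open>The structure maps are defined by \<open>the_elem\<close> or by unions over all
  representatives, so here and below independence of the representative has to be shown. It comes
  from \<open>char_act_cong\<close>, whence the restriction to \<Omega>.\<close>

lemma grange_germ: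
  fixes \<phi> :: "'s::left_cancellative_monoid hull_char"
  assumes "g \<in> left_inverse_hull" "\<phi> \<in> char_domain g" "\<phi> \<in> Omega"
  shows "grange paterson_groupoid (germ g \<phi>) = char_act g \<phi>"
proof -
  have "(\<lambda>(g, \<phi>). char_act g \<phi>) ` germ g \<phi> = {char_act g \<phi>}"
  proof (rule image_singletonI)
    show "(g, \<phi>) \<in> germ g \<phi>"
      using assms by (simp add: mem_germ germ_eqv_refl char_domain_hull_char)
    fix x assume "x \<in> germ g \<phi>"
    then obtain h where "x = (h, \<phi>)" "h \<in> left_inverse_hull" "\<phi> \<in> char_domain h" "germ_eqv True g h \<phi>"
      using assms by (auto simp: mem_germ)
    then show "(case x of (g, \<phi>) \<Rightarrow> char_act g \<phi>) = char_act g \<phi>"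
      using assms char_act_cong[of g h \<phi> True] by simp
  qed
  then show ?thesis
    by (simp add: paterson_groupoid_def)
qed

lemma ginv_germ:
  fixes \<phi> :: "'s::left_cancellative_monoid hull_char"
  assumes "g \<in> left_inverse_hull" "\<phi> \<in> char_domain g" "\<phi> \<in> Omega"
  shows "ginv paterson_groupoid (germ g \<phi>) = germ (pinverse g) (char_act g \<phi>)"
proof -
  have "(\<Union>(g, \<phi>)\<in>germ g \<phi>. germ (pinverse g) (char_act g \<phi>)) = germ (pinverse g) (char_act g \<phi>)"
  proof (rule UN_constantI)
    show "(g, \<phi>) \<in> germ g \<phi>"
      using assms by (simp add: mem_germ germ_eqv_refl char_domain_hull_char)
    fix x assume "x \<in> germ g \<phi>"
    then obtain k where k: "x = (k, \<phi>)" "k \<in> left_inverse_hull" "\<phi> \<in> char_domain k" "germ_eqv True g k \<phi>"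
      using assms by (auto simp: mem_germ)
    have eq: "char_act k \<phi> = char_act g \<phi>"
      using char_act_cong[of g k \<phi> True] k assms by simp
    have "germ_eqv True (pinverse k) (pinverse g) (char_act g \<phi>)"
      using germ_eqv_pinverse[of g k \<phi> True] k assms germ_eqv_sym by blast
    then have "germ (pinverse k) (char_act g \<phi>) = germ (pinverse g) (char_act g \<phi>)"
      using char_act_pinverse_domain[OF assms(1,2)] char_act_pinverse_domain[OF k(2,3)] k assms eq
      by (simp add: germ_eq_iff left_inverse_hull.pinverse)
    then show "(case x of (g, \<phi>) \<Rightarrow> germ (pinverse g) (char_act g \<phi>)) = germ (pinverse g) (char_act g \<phi>)"
      by (simp add: k(1) eq)
  qed
  then show ?thesis
    by (simp add: paterson_groupoid_def)
qed

lemma gmult_germ: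
  fixes \<phi> :: "'s::left_cancellative_monoid hull_char"
  assumes "g \<in> left_inverse_hull" "h \<in> left_inverse_hull" "\<phi> \<in> char_domain h"
    "char_act h \<phi> \<in> char_domain g" "\<phi> \<in> Omega"
  shows "gmult paterson_groupoid (germ g (char_act h \<phi>)) (germ h \<phi>) = germ (g \<circ>\<^sub>m h) \<phi>"
proof -
  have 1: "(g, char_act h \<phi>) \<in> germ g (char_act h \<phi>)" "(h, \<phi>) \<in> germ h \<phi>"
    using assms by (simp_all add: mem_germ germ_eqv_refl char_domain_hull_char)
  have "germ (g' \<circ>\<^sub>m h') \<psi> = germ (g \<circ>\<^sub>m h) \<phi>"
    if "(g', \<psi>') \<in> germ g (char_act h \<phi>)" "(h', \<psi>) \<in> germ h \<phi>" for g' h' \<psi> \<psi>'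
  proof -
    have h: "\<psi> = \<phi>" "h' \<in> left_inverse_hull" "\<phi> \<in> char_domain h'" "germ_eqv True h h' \<phi>"
      using that assms by (auto simp: mem_germ)
    have g: "g' \<in> left_inverse_hull" "char_act h \<phi> \<in> char_domain g'" "germ_eqv True g g' (char_act h \<phi>)"
      using that assms by (auto simp: mem_germ)
    have "char_act h \<phi> = char_act h' \<phi>"
      using h assms by (intro char_act_cong)
    then show ?thesis
      using assms g h germ_eqv_comp[of h \<phi> True g g' h'] comp_char_domain[of g h \<phi>] comp_char_domain[of g' h' \<phi>]
      by (subst germ_eq_iff) (auto simp: left_inverse_hull.mult germ_eqv_sym[of True "g' \<circ>\<^sub>m h'"])
  qed
  then have inner: "(\<Union>(h, \<psi>)\<in>germ h \<phi>. germ (g' \<circ>\<^sub>m h) \<psi>) = germ (g \<circ>\<^sub>m h) \<phi>"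
    if "(g', \<psi>') \<in> germ g (char_act h \<phi>)" for g' \<psi>'
    using that 1(2) by (intro UN_constantI[of "(h, \<phi>)"]) auto
  have "(\<Union>(g, \<psi>')\<in>germ g (char_act h \<phi>). \<Union>(h, \<psi>)\<in>germ h \<phi>. germ (g \<circ>\<^sub>m h) \<psi>) = germ (g \<circ>\<^sub>m h) \<phi>"
  proof (rule UN_constantI)
    fix x assume "x \<in> germ g (char_act h \<phi>)"
    then show "(case x of (g, \<psi>') \<Rightarrow> \<Union>(h, \<psi>)\<in>germ h \<phi>. germ (g \<circ>\<^sub>m h) \<psi>) = germ (g \<circ>\<^sub>m h) \<phi>"
      using inner[of "fst x" "snd x"] by (simp only: prod.collapse case_prod_unfold)
  qed (rule 1)
  then show ?thesis
    by (simp add: paterson_groupoid_def)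
qed


section \<open>Structure maps of the quotient groupoid\<close>

definition valid :: "('s::monoid_mult \<rightharpoonup> 's) \<Rightarrow> 's hull_char \<Rightarrow> bool" where
  "valid g \<phi> \<longleftrightarrow> g \<in> left_inverse_hull \<and> \<phi> \<in> char_domain g \<and> \<phi> \<in> Omega"

definition germ_class :: "('s::monoid_mult \<rightharpoonup> 's) \<Rightarrow> 's hull_char \<Rightarrow> 's germ set" where
  "germ_class g \<phi> = germ_identification `` {germ g \<phi>}"

lemma germ_identification_iff:
  fixes \<phi> :: "'s::left_cancellative_monoid hull_char"
  shows "(P, Q) \<in> germ_identification \<longleftrightarrow>
    (\<exists>g h \<phi>. P = germ g \<phi> \<and> Q = germ h \<phi> \<and> valid g \<phi> \<and> valid h \<phi> \<and> germ_eqv False g h (\<phi> :: 's hull_char))"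
proof -
  have "(\<exists>X\<in>constructible_differences. char_ext \<phi> X \<and> g |` X = h |` X) \<longleftrightarrow> germ_eqv False g h \<phi>"
    if "\<phi> \<in> hull_chars" for g h and \<phi> :: "'s hull_char"
    unfolding germ_eqv_def restrict_map_eq_iff using char_ext_iff_nbhds[OF that] by blast
  then show ?thesis
    unfolding germ_identification_def valid_def
    by (auto simp: char_domain_hull_char) (metis char_domain_hull_char)+
qed

text \<open>The identification relates germs, so another representative of the same germ may occur
  first. It agrees with g in the sense \<open>b = True\<close>, which is finer than the sense
  \<open>b = False\<close>, and transitivity applies.\<close>

lemma mem_germ_class:
  fixes \<phi> :: "'s::left_cancellative_monoid hull_char"
  assumes "valid g \<phi>"
  shows "germ_class g \<phi> = (\<lambda>h. germ h \<phi>) ` {h. valid h \<phi> \<and> germ_eqv False g h \<phi>}"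
proof (intro set_eqI iffI)
  fix P assume "P \<in> germ_class g \<phi>"
  then obtain k h \<psi> where k: "germ g \<phi> = germ k \<psi>" "P = germ h \<psi>" "valid k \<psi>" "valid h \<psi>" "germ_eqv False k h \<psi>"
    unfolding germ_class_def by (auto simp: germ_identification_iff)
  then have "\<phi> = \<psi> \<and> germ_eqv True g k \<phi>"
    using assms germ_eq_iff[of g \<phi> k \<psi>] by (auto simp: valid_def)
  then have "germ_eqv False g h \<phi>" "\<psi> = \<phi>"
    using k(5) germ_eqv_mono germ_eqv_trans by blast+
  then show "P \<in> (\<lambda>h. germ h \<phi>) ` {h. valid h \<phi> \<and> germ_eqv False g h \<phi>}"
    using k by blast
next
  fix P assume "P \<in> (\<lambda>h. germ h \<phi>) ` {h. valid h \<phi> \<and> germ_eqv False g h \<phi>}"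
  then show "P \<in> germ_class g \<phi>"
    using assms unfolding germ_class_def by (auto simp: germ_identification_iff)
qed

lemma valid_hull_char: "valid g \<phi> \<Longrightarrow> \<phi> \<in> hull_chars"
  unfolding valid_def using char_domain_hull_char by blast

lemma germ_in_germ_class:
  fixes \<phi> :: "'s::left_cancellative_monoid hull_char"
  shows "valid g \<phi> \<Longrightarrow> germ g \<phi> \<in> germ_class g \<phi>"
  by (simp add: mem_germ_class germ_eqv_refl valid_hull_char)

lemma germ_class_eq_iff:
  fixes \<phi> :: "'s::left_cancellative_monoid hull_char"
  assumes "valid g \<phi>" "valid h \<psi>"
  shows "germ_class g \<phi> = germ_class h \<psi> \<longleftrightarrow> \<phi> = \<psi> \<and> germ_eqv False g h \<phi>"
proof
  assume eq: "germ_class g \<phi> = germ_class h \<psi>"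
  then have "germ h \<psi> \<in> germ_class g \<phi>"
    using germ_in_germ_class[OF assms(2)] by simp
  then obtain k where k: "germ h \<psi> = germ k \<phi>" "valid k \<phi>" "germ_eqv False g k \<phi>"
    by (auto simp: mem_germ_class[OF assms(1)])
  then have "\<psi> = \<phi>" "germ_eqv True h k \<psi>"
    using assms(2) germ_eq_iff[of h \<psi> k \<phi>] by (auto simp: valid_def)
  then show "\<phi> = \<psi> \<and> germ_eqv False g h \<phi>"
    using k(3) germ_eqv_mono germ_eqv_sym germ_eqv_trans by metis
next
  assume "\<phi> = \<psi> \<and> germ_eqv False g h \<phi>"
  then show "germ_class g \<phi> = germ_class h \<psi>"
    using assms germ_eqv_trans[of False g h \<phi>] germ_eqv_trans[of False h g \<phi>]
    by (auto simp: mem_germ_class germ_eqv_sym[of False h g])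
qed

abbreviation (input) MG :: "('s::left_cancellative_monoid germ set, 's hull_char) groupoid" where
  "MG \<equiv> monoid_groupoid"

lemma arrows_paterson:
  "arrows (paterson_groupoid :: ('s::monoid_mult germ, 's hull_char) groupoid) =
     {germ g \<phi> | g \<phi>. g \<in> left_inverse_hull \<and> \<phi> \<in> char_domain g}"
  by (simp add: paterson_groupoid_def)

lemma arrows_monoid_paterson:
  "arrows (monoid_paterson_groupoid :: ('s::left_cancellative_monoid germ, 's hull_char) groupoid) =
     {germ g \<phi> | g \<phi>. valid g \<phi>}"
  unfolding monoid_paterson_groupoid_def reduction_def
  by (auto simp: valid_def gsource_germ arrows_paterson) (metis gsource_germ)

lemma monoid_paterson_simps:
  "gsource monoid_paterson_groupoid = gsource paterson_groupoid"
  "grange monoid_paterson_groupoid = grange paterson_groupoid"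
  "ginv monoid_paterson_groupoid = ginv paterson_groupoid"
  "gmult monoid_paterson_groupoid = gmult paterson_groupoid"
  by (simp_all add: monoid_paterson_groupoid_def reduction_def)

lemma arrows_MG: "arrows MG = {germ_class g \<phi> | g \<phi>. valid g \<phi>}"
  unfolding monoid_groupoid_def quotient_groupoid_def
  by (auto simp: arrows_monoid_paterson quotient_def germ_class_def)

lemma arrowsE:
  assumes "P \<in> arrows MG"
  obtains g \<phi> where "P = germ_class g \<phi>" "valid g \<phi>"
  using assms by (auto simp: arrows_MG)

lemma units_MG: "units MG = Omega"
  unfolding monoid_groupoid_def quotient_groupoid_def monoid_paterson_groupoid_def reduction_def
    paterson_groupoid_def
  by (auto simp: Omega_iff)

lemma gsource_MG [simp]:
  assumes "valid g \<phi>"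
  shows "gsource MG (germ_class g \<phi>) = \<phi>"
proof -
  have "gsource paterson_groupoid P = \<phi>" if "P \<in> germ_class g \<phi>" for P
    using that by (auto simp: mem_germ_class[OF assms] valid_def gsource_germ)
  then have "gsource paterson_groupoid ` germ_class g \<phi> = {\<phi>}"
    by (rule image_singletonI[OF germ_in_germ_class[OF assms]])
  then show ?thesis
    by (simp add: monoid_groupoid_def quotient_groupoid_def monoid_paterson_simps)
qed

lemma grange_MG [simp]:
  assumes "valid g \<phi>"
  shows "grange MG (germ_class g \<phi>) = char_act g \<phi>"
proof -
  have "grange paterson_groupoid P = char_act g \<phi>" if P: "P \<in> germ_class g \<phi>" for P
  proof -
    obtain h where h: "P = germ h \<phi>" "valid h \<phi>" "germ_eqv False g h \<phi>"
      using P by (auto simp: mem_germ_class[OF assms])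
    then have "char_act g \<phi> = char_act h \<phi>"
      using assms by (intro char_act_cong[where b = False]) (simp_all add: valid_def)
    then show ?thesis
      using h by (simp add: valid_def grange_germ)
  qed
  then have "grange paterson_groupoid ` germ_class g \<phi> = {char_act g \<phi>}"
    by (rule image_singletonI[OF germ_in_germ_class[OF assms]])
  then show ?thesis
    by (simp add: monoid_groupoid_def quotient_groupoid_def monoid_paterson_simps)
qed

lemma valid_pinverse:
  fixes \<phi> :: "'s::left_cancellative_monoid hull_char"
  shows "valid g \<phi> \<Longrightarrow> valid (pinverse g) (char_act g \<phi>)"
  by (simp add: valid_def left_inverse_hull.pinverse char_act_pinverse_domain char_act_Omega)

lemma valid_comp:
  fixes \<phi> :: "'s::left_cancellative_monoid hull_char"
  shows "valid h \<phi> \<Longrightarrow> valid g (char_act h \<phi>) \<Longrightarrow> valid (g \<circ>\<^sub>m h) \<phi>"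
  by (simp add: valid_def left_inverse_hull.mult comp_char_domain)

lemma ginv_MG [simp]:
  assumes "valid g \<phi>"
  shows "ginv MG (germ_class g \<phi>) = germ_class (pinverse g) (char_act g \<phi>)"
proof -
  have "germ_identification `` {ginv paterson_groupoid P} = germ_class (pinverse g) (char_act g \<phi>)"
    if P: "P \<in> germ_class g \<phi>" for P
  proof -
    obtain h where h: "P = germ h \<phi>" "valid h \<phi>" "germ_eqv False g h \<phi>"
      using P by (auto simp: mem_germ_class[OF assms])
    then have eq: "char_act g \<phi> = char_act h \<phi>"
      using assms by (intro char_act_cong[where b = False]) (simp_all add: valid_def)
    have "germ_class (pinverse g) (char_act g \<phi>) = germ_class (pinverse h) (char_act h \<phi>)"
      using h assms germ_eqv_pinverse[of g h \<phi> False] eq valid_pinverse[OF assms] valid_pinverse[OF h(2)]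
      by (subst germ_class_eq_iff) (simp_all add: valid_def)
    moreover have "germ_identification `` {ginv paterson_groupoid P} = germ_class (pinverse h) (char_act h \<phi>)"
      using h(2) unfolding h(1) germ_class_def by (simp add: ginv_germ valid_def)
    ultimately show ?thesis by simp
  qed
  then have "(\<Union>P\<in>germ_class g \<phi>. germ_identification `` {ginv paterson_groupoid P}) = germ_class (pinverse g) (char_act g \<phi>)"
    by (rule UN_constantI[OF germ_in_germ_class[OF assms]])
  then show ?thesis
    by (simp add: monoid_groupoid_def quotient_groupoid_def monoid_paterson_simps)
qed

lemma gmult_MG [simp]:
  assumes "valid h \<phi>" "valid g (char_act h \<phi>)"
  shows "gmult MG (germ_class g (char_act h \<phi>)) (germ_class h \<phi>) = germ_class (g \<circ>\<^sub>m h) \<phi>"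
proof -
  have "germ_identification `` {gmult paterson_groupoid P Q} = germ_class (g \<circ>\<^sub>m h) \<phi>"
    if P: "P \<in> germ_class g (char_act h \<phi>)" and Q: "Q \<in> germ_class h \<phi>" for P Q
  proof -
    obtain g' where g: "P = germ g' (char_act h \<phi>)" "valid g' (char_act h \<phi>)" "germ_eqv False g g' (char_act h \<phi>)"
      using P by (auto simp: mem_germ_class[OF assms(2)])
    obtain h' where h: "Q = germ h' \<phi>" "valid h' \<phi>" "germ_eqv False h h' \<phi>"
      using Q by (auto simp: mem_germ_class[OF assms(1)])
    then have eq: "char_act h \<phi> = char_act h' \<phi>"
      using assms by (intro char_act_cong[where b = False]) (simp_all add: valid_def)
    have "gmult paterson_groupoid P Q = germ (g' \<circ>\<^sub>m h') \<phi>"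
      using g h eq gmult_germ[of g' h' \<phi>] by (simp add: valid_def)
    then have "germ_identification `` {gmult paterson_groupoid P Q} = germ_class (g' \<circ>\<^sub>m h') \<phi>"
      by (simp add: germ_class_def)
    also have "\<dots> = germ_class (g \<circ>\<^sub>m h) \<phi>"
    proof -
      have "valid (g' \<circ>\<^sub>m h') \<phi>" "valid (g \<circ>\<^sub>m h) \<phi>"
        using g h eq assms by (simp_all add: valid_comp)
      moreover have "germ_eqv False (g \<circ>\<^sub>m h) (g' \<circ>\<^sub>m h') \<phi>"
        using g h assms by (intro germ_eqv_comp) (simp_all add: valid_def)
      ultimately show ?thesis
        by (simp add: germ_class_eq_iff germ_eqv_sym[of False "g' \<circ>\<^sub>m h'"])
    qed
    finally show ?thesis .
  qed
  then have "(\<Union>P\<in>germ_class g (char_act h \<phi>). \<Union>Q\<in>germ_class h \<phi>. germ_identification `` {gmult paterson_groupoid P Q}) = germ_class (g \<circ>\<^sub>m h) \<phi>"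
    by (intro UN_constantI[OF germ_in_germ_class[OF assms(2)]] UN_constantI[OF germ_in_germ_class[OF assms(1)]])
  then show ?thesis
    by (simp add: monoid_groupoid_def quotient_groupoid_def monoid_paterson_simps)
qed

text \<open>The product H^-1 P of the convolution formula in terms of representatives; the last
  claim identifies its range as the source of H.\<close>

lemma inv_mult_MG:
  assumes "valid h \<psi>" "valid g \<phi>" "char_act h \<psi> = char_act g \<phi>"
  shows "gmult MG (ginv MG (germ_class h \<psi>)) (germ_class g \<phi>) = germ_class (pinverse h \<circ>\<^sub>m g) \<phi>"
    and "valid (pinverse h \<circ>\<^sub>m g) \<phi>" and "char_act (pinverse h \<circ>\<^sub>m g) \<phi> = \<psi>"
proof -
  have v: "valid (pinverse h) (char_act g \<phi>)"
    using valid_pinverse[OF assms(1)] assms(3) by simp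
  show "gmult MG (ginv MG (germ_class h \<psi>)) (germ_class g \<phi>) = germ_class (pinverse h \<circ>\<^sub>m g) \<phi>"
    using assms v by simp
  show "valid (pinverse h \<circ>\<^sub>m g) \<phi>"
    using assms(2) v by (rule valid_comp)
  show "char_act (pinverse h \<circ>\<^sub>m g) \<phi> = \<psi>"
    using assms by (simp add: char_act_comp left_inverse_hull.pinverse valid_def flip: assms(3))
      (simp add: char_act_pinverse)
qed

text \<open>Multiply back by h: near the sources of P and Q, h h^-1 acts as the identity after g and
  g'. This makes translation along a bisection injective in the norm estimates.\<close>

lemma inv_mult_inject:
  assumes "H \<in> arrows MG" "P \<in> arrows MG" "Q \<in> arrows MG"
    "grange MG P = grange MG H" "grange MG Q = grange MG H"
    "gmult MG (ginv MG H) P = gmult MG (ginv MG H) Q"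
  shows "P = Q"
proof -
  obtain h \<psi> where h: "H = germ_class h \<psi>" "valid h \<psi>" using assms(1) by (rule arrowsE)
  obtain g \<phi> where g: "P = germ_class g \<phi>" "valid g \<phi>" using assms(2) by (rule arrowsE)
  obtain g' \<phi>' where g': "Q = germ_class g' \<phi>'" "valid g' \<phi>'" using assms(3) by (rule arrowsE)
  have r: "char_act h \<psi> = char_act g \<phi>" "char_act h \<psi> = char_act g' \<phi>'"
    using assms h g g' by simp_all
  have "germ_class (pinverse h \<circ>\<^sub>m g) \<phi> = germ_class (pinverse h \<circ>\<^sub>m g') \<phi>'"
    using assms(6) inv_mult_MG[OF h(2) g(2) r(1)] inv_mult_MG[OF h(2) g'(2) r(2)] h g g' by simp
  then have "\<phi> = \<phi>' \<and> germ_eqv False (pinverse h \<circ>\<^sub>m g) (pinverse h \<circ>\<^sub>m g') \<phi>"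
    unfolding germ_class_eq_iff[OF inv_mult_MG(2)[OF h(2) g(2) r(1)] inv_mult_MG(2)[OF h(2) g'(2) r(2)]] .
  then have eq: "\<phi>' = \<phi>" "germ_eqv False (pinverse h \<circ>\<^sub>m g) (pinverse h \<circ>\<^sub>m g') \<phi>"
    by (blast+)
  have \<psi>: "char_act (pinverse h \<circ>\<^sub>m g) \<phi> = \<psi>"
    by (rule inv_mult_MG(3)[OF h(2) g(2) r(1)])
  have "germ_eqv False (h \<circ>\<^sub>m (pinverse h \<circ>\<^sub>m g)) (h \<circ>\<^sub>m (pinverse h \<circ>\<^sub>m g')) \<phi>"
    using inv_mult_MG(2)[OF h(2) g(2) r(1)] eq(2) valid_hull_char[OF h(2)]
    by (intro germ_eqv_comp[where h = "pinverse h \<circ>\<^sub>m g"]) (simp_all add: valid_def \<psi> germ_eqv_refl)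
  moreover have "char_act g \<phi> \<in> char_domain (pinverse h)"
    using valid_pinverse[OF h(2)] r by (simp add: valid_def)
  then have "germ_eqv False (h \<circ>\<^sub>m (pinverse h \<circ>\<^sub>m g)) g \<phi>" "germ_eqv False (h \<circ>\<^sub>m (pinverse h \<circ>\<^sub>m g')) g' \<phi>"
    using g g' h eq r by (auto intro!: germ_eqv_comp_pinverse simp: valid_def)
  ultimately have "germ_eqv False g g' \<phi>"
    using germ_eqv_trans germ_eqv_sym by metis
  then show ?thesis
    using g g' eq(1) by (simp add: germ_class_eq_iff)
qed

lemma char_act_inject:
  fixes \<phi> :: "'s::left_cancellative_monoid hull_char"
  assumes "valid g \<phi>" "valid g \<psi>" "char_act g \<phi> = char_act g \<psi>"
  shows "\<phi> = \<psi>"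
  using assms char_act_pinverse unfolding valid_def by metis

text \<open>The image of D(g,U) in the quotient. The restriction to pairs that represent arrows over
  \<Omega> allows U to be any set of characters.\<close>

definition bisection :: "('s::monoid_mult \<rightharpoonup> 's) \<Rightarrow> 's hull_char set \<Rightarrow> 's germ set set" where
  "bisection g U = germ_class g ` {\<phi> \<in> U. valid g \<phi>}"


section \<open>Topology and boundedness of the regular representations\<close>

lemma openin_char_domain:
  fixes g :: "'s::left_cancellative_monoid \<rightharpoonup> 's"
  assumes "g \<in> left_inverse_hull"
  shows "openin hull_char_topology (char_domain g)"
proof -
  have "char_domain g = cylinder (dom g) {}"
    by (auto simp: cylinder_def mem_char_domain[OF assms])
  then show ?thesis
    using assms by (simp add: openin_cylinder dom_constructible)
qed

text \<open>A set \<open>X - \<Union>F\<close> on which g and h agree serves all characters in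
  \<open>cylinder X F\<close> at once.\<close>

lemma openin_germ_eqv:
  "openin hull_char_topology {\<phi> \<in> hull_chars. germ_eqv b g h (\<phi> :: 's::left_cancellative_monoid hull_char)}"
  unfolding openin_hull_char_topology
proof (intro conjI ballI)
  fix \<phi> :: "'s hull_char" assume "\<phi> \<in> {\<phi> \<in> hull_chars. germ_eqv b g h \<phi>}"
  then obtain Z where Z: "Z \<in> nbhds b \<phi>" "\<forall>s\<in>Z. g s = h s"
    unfolding germ_eqv_def by blast
  obtain X F where X: "Z = X - \<Union>F" "X \<in> \<J>" "finite F" "F \<subseteq> \<J>" "\<phi> \<in> cylinder X F" "b \<longrightarrow> F = {}"
    using Z(1) by (rule nbhdsE)
  have "cylinder X F \<subseteq> {\<phi> \<in> hull_chars. germ_eqv b g h \<phi>}"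
  proof
    fix \<psi> assume \<psi>: "\<psi> \<in> cylinder X F"
    then have "Z \<in> nbhds b \<psi>"
      using X by (intro nbhdsI)
    then show "\<psi> \<in> {\<phi> \<in> hull_chars. germ_eqv b g h \<phi>}"
      using Z(2) \<psi> unfolding germ_eqv_def cylinder_def by blast
  qed
  then show "\<exists>X F. X \<in> \<J> \<and> finite F \<and> F \<subseteq> \<J> \<and> \<phi> \<in> cylinder X F \<and> cylinder X F \<subseteq> {\<phi> \<in> hull_chars. germ_eqv b g h \<phi>}"
    using X by blast
qed blast

lemma openin_paterson:
  fixes g :: "'s::left_cancellative_monoid \<rightharpoonup> 's"
  assumes "g \<in> left_inverse_hull" "U \<subseteq> char_domain g" "openin hull_char_topology U"
  shows "openin (gtop paterson_groupoid) (germ g ` U)"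
proof -
  have "openin (topology_generated_by {germ g ` U | (g :: 's \<rightharpoonup> 's) U. g \<in> left_inverse_hull \<and>
      U \<subseteq> char_domain g \<and> openin hull_char_topology U}) (germ g ` U)"
    by (rule topology_generated_by_Basis) (use assms in blast)
  then show ?thesis
    by (simp add: paterson_groupoid_def)
qed

lemma topspace_paterson:
  "topspace (gtop (paterson_groupoid :: ('s::left_cancellative_monoid germ, 's hull_char) groupoid)) =
     arrows paterson_groupoid" (is "topspace (gtop ?G) = _")
proof
  have "topspace (gtop ?G) = \<Union>{germ g ` U | (g :: 's \<rightharpoonup> 's) U. g \<in> left_inverse_hull \<and>
      U \<subseteq> char_domain g \<and> openin hull_char_topology U}"
    by (simp add: paterson_groupoid_def)
  then show "topspace (gtop ?G) \<subseteq> arrows ?G"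
    unfolding arrows_paterson by blast
  show "arrows ?G \<subseteq> topspace (gtop ?G)"
  proof
    fix P assume "P \<in> arrows ?G"
    then obtain g \<phi> where g: "P = germ g \<phi>" "g \<in> left_inverse_hull" "\<phi> \<in> char_domain g"
      by (auto simp: arrows_paterson)
    have "germ g ` char_domain g \<subseteq> topspace (gtop ?G)"
      using g by (intro openin_subset openin_paterson openin_char_domain) auto
    with g show "P \<in> topspace (gtop ?G)" by blast
  qed
qed

lemma gtop_monoid_paterson:
  "gtop (monoid_paterson_groupoid :: ('s::left_cancellative_monoid germ, 's hull_char) groupoid) =
     subtopology (gtop paterson_groupoid) (arrows monoid_paterson_groupoid)"
  by (simp add: monoid_paterson_groupoid_def reduction_def)

lemma topspace_monoid_paterson:
  "topspace (gtop (monoid_paterson_groupoid :: ('s::left_cancellative_monoid germ, 's hull_char) groupoid)) =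
     arrows monoid_paterson_groupoid"
  unfolding gtop_monoid_paterson topspace_subtopology topspace_paterson
  by (auto simp: monoid_paterson_groupoid_def reduction_def)

lemma openin_MG:
  "openin (gtop MG) W \<longleftrightarrow>
     W \<subseteq> arrows (MG :: ('s::left_cancellative_monoid germ set, 's hull_char) groupoid) \<and>
     (\<exists>V. openin (gtop paterson_groupoid) V \<and>
        (\<forall>g \<phi>. valid g \<phi> \<longrightarrow> (germ_class g \<phi> \<in> W \<longleftrightarrow> germ g (\<phi> :: 's hull_char) \<in> V)))"
proof -
  let ?A = "arrows (monoid_paterson_groupoid :: ('s germ, 's hull_char) groupoid)"
  have "{P \<in> ?A. germ_identification `` {P} \<in> W} = V \<inter> ?A \<longleftrightarrow>
      (\<forall>g \<phi>. valid g \<phi> \<longrightarrow> (germ_class g \<phi> \<in> W \<longleftrightarrow> germ g \<phi> \<in> V))" for V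
    unfolding arrows_monoid_paterson germ_class_def by blast
  moreover have "arrows MG = ?A // germ_identification"
    by (simp add: monoid_groupoid_def quotient_groupoid_def)
  ultimately show ?thesis
    by (simp add: monoid_groupoid_def quotient_groupoid_def openin_quotient_topology
        topspace_monoid_paterson) (simp add: gtop_monoid_paterson openin_subtopology)
qed

text \<open>The preimage under the quotient map contains, besides germs of g, those of every h
  identified with them. It is therefore a union over all h, the part for h lying over the open set
  \<open>V h\<close> where h and g are identified.\<close>

lemma openin_bisection:
  fixes g :: "'s::left_cancellative_monoid \<rightharpoonup> 's"
  assumes g: "g \<in> left_inverse_hull" and U: "openin hull_char_topology U"
  shows "openin (gtop MG) (bisection g U)"
  unfolding openin_MG
proof (intro conjI exI)
  show "bisection g U \<subseteq> arrows MG"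
    by (auto simp: bisection_def arrows_MG)
  define V where "V h = {\<phi> \<in> hull_chars. germ_eqv False g h \<phi>} \<inter> (U \<inter> (char_domain g \<inter> char_domain h))" for h
  have V: "openin hull_char_topology (V h)" if "h \<in> left_inverse_hull" for h
    unfolding V_def using that g U by (intro openin_Int openin_germ_eqv openin_char_domain)
  show "openin (gtop paterson_groupoid) (\<Union>h\<in>left_inverse_hull. germ h ` V h)"
    by (intro openin_Union ballI) (auto intro!: openin_paterson V, auto simp: V_def)
  show "\<forall>h \<phi>. valid h \<phi> \<longrightarrow>
      (germ_class h \<phi> \<in> bisection g U \<longleftrightarrow> germ h \<phi> \<in> (\<Union>h\<in>left_inverse_hull. germ h ` V h))"
  proof (intro allI impI)
    fix h :: "'s \<rightharpoonup> 's" and \<phi>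
    assume h: "valid h \<phi>"
    show "germ_class h \<phi> \<in> bisection g U \<longleftrightarrow> germ h \<phi> \<in> (\<Union>h\<in>left_inverse_hull. germ h ` V h)"
    proof
      assume "germ_class h \<phi> \<in> bisection g U"
      then obtain \<psi> where "\<psi> \<in> U" "valid g \<psi>" "germ_class g \<psi> = germ_class h \<phi>"
        by (auto simp: bisection_def)
      then have "\<phi> \<in> V h"
        using h germ_class_eq_iff[of g \<psi> h \<phi>] by (auto simp: V_def valid_def char_domain_hull_char)
      then show "germ h \<phi> \<in> (\<Union>h\<in>left_inverse_hull. germ h ` V h)"
        using h by (auto simp: valid_def)
    next
      assume "germ h \<phi> \<in> (\<Union>h\<in>left_inverse_hull. germ h ` V h)"
      then obtain k \<psi> where k: "k \<in> left_inverse_hull" "\<psi> \<in> V k" "germ h \<phi> = germ k \<psi>"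
        by blast
      then have eq: "\<phi> = \<psi>" "germ_eqv True h k \<phi>"
        using h germ_eq_iff[of h \<phi> k \<psi>] by (auto simp: V_def valid_def)
      then have "germ_eqv False g h \<phi>" "valid g \<phi>" "\<phi> \<in> U"
        using k(2) h g germ_eqv_mono[of True h k \<phi>] germ_eqv_trans[of False g k \<phi> h] germ_eqv_sym[of False h k]
        by (auto simp: V_def valid_def)
      then show "germ_class h \<phi> \<in> bisection g U"
        using h germ_class_eq_iff[of h \<phi> g \<phi>] germ_eqv_sym[of False g h] by (auto simp: bisection_def)
    qed
  qed
qed

section \<open>Functions carried by finitely many bisections\<close>

abbreviation full_bisection :: "('s::monoid_mult \<rightharpoonup> 's) \<Rightarrow> 's germ set set" where
  "full_bisection g \<equiv> bisection g hull_chars"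

lemma openin_full_bisection:
  fixes g :: "'s::left_cancellative_monoid \<rightharpoonup> 's"
  shows "g \<in> left_inverse_hull \<Longrightarrow> openin (gtop MG) (full_bisection g)"
  using openin_bisection[of g hull_chars] openin_topspace[of hull_char_topology]
  by (simp add: topspace_hull_char)

lemma topspace_MG: "topspace (gtop MG) \<subseteq> arrows MG"
  using openin_topspace[of "gtop MG"] unfolding openin_MG by blast

lemma arrows_full_bisection: "arrows MG \<subseteq> (\<Union>g\<in>left_inverse_hull. full_bisection g)"
proof
  fix P :: "'a germ set" assume "P \<in> arrows MG"
  then obtain g \<phi> where "P = germ_class g \<phi>" "valid g \<phi>" by (rule arrowsE)
  then show "P \<in> (\<Union>g\<in>left_inverse_hull. full_bisection g)"
    using valid_hull_char unfolding bisection_def valid_def by blast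
qed

lemma full_bisection_arrows: "full_bisection g \<subseteq> arrows MG"
  by (auto simp: arrows_MG bisection_def)

lemma full_bisection_source_inject:
  fixes g :: "'s::left_cancellative_monoid \<rightharpoonup> 's"
  assumes "H \<in> full_bisection g" "H' \<in> full_bisection g" "gsource MG H = gsource MG H'"
  shows "H = H'"
  using assms by (auto simp: bisection_def)

lemma full_bisection_range_inject:
  fixes g :: "'s::left_cancellative_monoid \<rightharpoonup> 's"
  assumes "H \<in> full_bisection g" "H' \<in> full_bisection g" "grange MG H = grange MG H'"
  shows "H = H'"
  using assms by (auto simp: bisection_def dest: char_act_inject)

text \<open>What boundedness of the regular representations needs from a function in
  \<open>Cc\<close>. Working with this property makes differences of such functions directly
  available to the estimates.\<close>

definition tame :: "('s::left_cancellative_monoid germ set \<Rightarrow> complex) \<Rightarrow> bool" where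
  "tame f \<longleftrightarrow> (\<exists>G. finite G \<and> G \<subseteq> left_inverse_hull \<and>
     (\<forall>P. f P \<noteq> 0 \<longrightarrow> P \<in> (\<Union>g\<in>G. full_bisection g))) \<and> (\<exists>M. \<forall>P. cmod (f P) \<le> M)"

lemma tame_add:
  assumes "tame f" "tame k"
  shows "tame (\<lambda>P. f P + k P)"
proof -
  obtain G M where f: "finite G" "G \<subseteq> left_inverse_hull" "\<And>P. f P \<noteq> 0 \<Longrightarrow> P \<in> (\<Union>g\<in>G. full_bisection g)"
      "\<And>P. cmod (f P) \<le> M"
    using assms(1) unfolding tame_def by blast
  obtain H N where k: "finite H" "H \<subseteq> left_inverse_hull" "\<And>P. k P \<noteq> 0 \<Longrightarrow> P \<in> (\<Union>g\<in>H. full_bisection g)"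
      "\<And>P. cmod (k P) \<le> N"
    using assms(2) unfolding tame_def by blast
  have "cmod (f P + k P) \<le> M + N" for P
    using f(4)[of P] k(4)[of P] norm_triangle_ineq[of "f P" "k P"] by linarith
  moreover have "P \<in> (\<Union>g\<in>G \<union> H. full_bisection g)" if "f P + k P \<noteq> 0" for P
    using that f(3)[of P] k(3)[of P] by (cases "f P = 0") auto
  ultimately show ?thesis
    unfolding tame_def using f(1,2) k(1,2) by (metis finite_UnI Un_least)
qed

lemma tame_cmult:
  assumes "tame f"
  shows "tame (\<lambda>P. c * f P)"
proof -
  obtain G M where f: "finite G" "G \<subseteq> left_inverse_hull" "\<And>P. f P \<noteq> 0 \<Longrightarrow> P \<in> (\<Union>g\<in>G. full_bisection g)"
      "\<And>P. cmod (f P) \<le> M"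
    using assms(1) unfolding tame_def by blast
  have "cmod (c * f P) \<le> cmod c * M" for P
    unfolding norm_mult by (intro mult_left_mono f(4)) simp
  moreover have "P \<in> (\<Union>g\<in>G. full_bisection g)" if "c * f P \<noteq> 0" for P
    using that f(3)[of P] by simp
  ultimately show ?thesis
    unfolding tame_def using f(1,2) by blast
qed

lemma tame_0: "tame (\<lambda>_. 0)"
  unfolding tame_def by (intro conjI exI[of _ "{}"] exI[of _ 0]) auto

lemma tame_diff: "tame f \<Longrightarrow> tame k \<Longrightarrow> tame (\<lambda>P. f P - k P)"
  using tame_add[of f "\<lambda>P. -1 * k P"] tame_cmult[of k "-1"] by simp

lemma tame_sum:
  fixes n :: nat
  assumes "\<And>i. i < n \<Longrightarrow> tame (F i)"
  shows "tame (\<lambda>P. \<Sum>i<n. c i * F i P)"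
  using assms by (induction n) (auto intro!: tame_add tame_cmult tame_0)

text \<open>The closed support K is compact, so finitely many of the open full bisections cover it,
  and f is bounded on it by continuity.\<close>

lemma tame_Cc_open:
  assumes V: "openin (gtop MG) V" and f: "f \<in> Cc_open MG V"
  shows "tame f"
proof -
  define K where "K = subtopology (gtop MG) V closure_of {P \<in> V. f P \<noteq> 0}"
  have f0: "\<And>P. P \<notin> V \<Longrightarrow> f P = 0"
    and cont: "continuous_map (subtopology (gtop MG) V) euclidean f"
    and K: "compactin (subtopology (gtop MG) V) K"
    using f by (auto simp: Cc_open_def K_def)
  have "{P \<in> V. f P \<noteq> 0} \<subseteq> topspace (subtopology (gtop MG) V)"
    using openin_subset[OF V] by auto
  then have sub: "{P \<in> V. f P \<noteq> 0} \<subseteq> K"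
    unfolding K_def by (rule closure_of_subset)
  have "compactin (gtop MG) K"
    using K by (simp add: compactin_subtopology)
  moreover have "K \<subseteq> \<Union>(full_bisection ` left_inverse_hull)"
    using compactin_subset_topspace[OF \<open>compactin (gtop MG) K\<close>] topspace_MG arrows_full_bisection by blast
  ultimately obtain \<F> where "finite \<F>" "\<F> \<subseteq> full_bisection ` left_inverse_hull" "K \<subseteq> \<Union>\<F>"
    using compactinD[of "gtop MG" K "full_bisection ` left_inverse_hull"] openin_full_bisection by blast
  then obtain G where G: "finite G" "G \<subseteq> left_inverse_hull" "K \<subseteq> \<Union>(full_bisection ` G)"
    by (metis finite_subset_image)
  have "compact (f ` K)"
    using image_compactin[OF K cont] by simp
  then have "bounded (f ` K)"
    by (rule compact_imp_bounded)
  then obtain M where "\<forall>z\<in>f ` K. cmod z \<le> M"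
    unfolding bounded_iff ..
  then have M: "cmod (f P) \<le> M" if "P \<in> K" for P
    using that by blast
  have "cmod (f P) \<le> max M 0" for P
  proof (cases "f P = 0")
    case False
    then have "P \<in> K"
      using f0[of P] sub by blast
    then show ?thesis
      using M[of P] by simp
  qed simp
  moreover have "P \<in> (\<Union>g\<in>G. full_bisection g)" if "f P \<noteq> 0" for P
    using that f0[of P] sub G(3) by blast
  ultimately show ?thesis
    unfolding tame_def using G(1,2) by blast
qed

lemma tame_Cc: "f \<in> Cc MG \<Longrightarrow> tame f"
  unfolding Cc_def by (auto intro!: tame_sum dest: tame_Cc_open)

section \<open>Uniform bounds for the regular representations\<close>

lemma sum_UNION_le:
  fixes w :: "'b \<Rightarrow> real"
  assumes "finite G" "\<And>g. g \<in> G \<Longrightarrow> finite (S g)" "\<And>x. 0 \<le> w x"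
  shows "sum w (\<Union>g\<in>G. S g) \<le> (\<Sum>g\<in>G. sum w (S g))"
  using assms(1,2)
proof (induction)
  case (insert g G)
  have "sum w (S g \<union> (\<Union>g\<in>G. S g)) \<le> sum w (S g) + sum w (\<Union>g\<in>G. S g)"
    using insert sum.union_inter[of "S g" "\<Union>g\<in>G. S g" w] sum_nonneg[of "S g \<inter> (\<Union>g\<in>G. S g)" w] assms(3)
    by simp
  with insert show ?case by simp
qed simp

lemma L2_set_sum_le:
  assumes "finite G"
  shows "L2_set (\<lambda>x. \<Sum>g\<in>G. w g x) A \<le> (\<Sum>g\<in>G. L2_set (w g) A)"
  using assms
proof (induction)
  case empty
  then show ?case by (simp add: L2_set_0')
next
  case (insert g G)
  then show ?case
    using L2_set_triangle_ineq[of "w g" "\<lambda>x. \<Sum>g\<in>G. w g x" A] by simp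
qed

definition fibre_slice :: "('s::left_cancellative_monoid \<rightharpoonup> 's) \<Rightarrow> 's germ set \<Rightarrow> 's germ set set" where
  "fibre_slice g P = {H \<in> full_bisection g. grange MG H = grange MG P}"

lemma fibre_slice_cases: "fibre_slice g P = {} \<or> (\<exists>H. fibre_slice g P = {H})"
proof (cases "fibre_slice g P = {}")
  case False
  then obtain H where "H \<in> fibre_slice g P" by blast
  moreover from this have "H' = H" if "H' \<in> fibre_slice g P" for H'
    using that full_bisection_range_inject[of H' g H] by (simp add: fibre_slice_def)
  ultimately show ?thesis by blast
qed simp

lemma finite_fibre_slice: "finite (fibre_slice g P)"
  using fibre_slice_cases[of g P] by auto

text \<open>Each bisection contributes at most one arrow with the range of P. The sum runs over a
  union because bisections may overlap, and an arrow lying in several of them counts once.\<close>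

lemma convolution_finite:
  assumes "finite G" "G \<subseteq> left_inverse_hull" "\<And>P. f P \<noteq> 0 \<Longrightarrow> P \<in> (\<Union>g\<in>G. full_bisection g)"
  shows "convolution MG f k P = (\<Sum>H\<in>(\<Union>g\<in>G. fibre_slice g P). f H * k (gmult MG (ginv MG H) P))"
proof -
  have "convolution MG f k P = infsum (\<lambda>H. f H * k (gmult MG (ginv MG H) P)) (\<Union>g\<in>G. fibre_slice g P)"
    unfolding convolution_def
  proof (rule infsum_cong_neutral)
    fix H assume "H \<in> {H \<in> arrows MG. grange MG H = grange MG P} - (\<Union>g\<in>G. fibre_slice g P)"
    then show "f H * k (gmult MG (ginv MG H) P) = 0"
      using assms(3)[of H] by (auto simp: fibre_slice_def)
  qed (use full_bisection_arrows in \<open>auto simp: fibre_slice_def\<close>)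
  then show ?thesis
    using assms(1) by (simp add: finite_fibre_slice)
qed

text \<open>A single bisection moves the values of \<xi> along the injective partial map P \<mapsto>
  H^-1 P, where H is its arrow with the range of P, so it acts as a partial isometry.\<close>

lemma L2_set_slice:
  assumes \<xi>: "square_summable \<xi>" and A: "finite A" "A \<subseteq> arrows MG"
  shows "L2_set (\<lambda>P. \<Sum>H\<in>fibre_slice g P. cmod (\<xi> (gmult MG (ginv MG H) P))) A
           \<le> sqrt (\<Sum>\<^sub>\<infinity>P. (cmod (\<xi> P))\<^sup>2)" (is "L2_set ?w A \<le> _")
proof -
  define B where "B = {P \<in> A. fibre_slice g P \<noteq> {}}"
  define \<tau> where "\<tau> P = gmult MG (ginv MG (the_elem (fibre_slice g P))) P" for P
  have el: "fibre_slice g P = {the_elem (fibre_slice g P)}" if "P \<in> B" for P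
    using that fibre_slice_cases[of g P] by (auto simp: B_def)
  have w: "?w P = cmod (\<xi> (\<tau> P))" if "P \<in> B" for P
    by (subst el[OF that]) (simp add: \<tau>_def)
  have "inj_on \<tau> B"
  proof (rule inj_onI)
    fix P Q assume PQ: "P \<in> B" "Q \<in> B" "\<tau> P = \<tau> Q"
    define H where "H = the_elem (fibre_slice g P)"
    define K where "K = the_elem (fibre_slice g Q)"
    have H: "H \<in> full_bisection g" "grange MG H = grange MG P"
      using el[OF PQ(1)] unfolding H_def fibre_slice_def by blast+
    have K: "K \<in> full_bisection g" "grange MG K = grange MG Q"
      using el[OF PQ(2)] unfolding K_def fibre_slice_def by blast+
    \<comment> \<open>The range of H^-1 P is the source of H. Equal values of \<tau> thus give equal
      sources, hence H = K, and then P = Q by cancelling H^-1.\<close>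
    have range: "grange MG (gmult MG (ginv MG H) P) = gsource MG H"
      if "H \<in> arrows MG" "P \<in> arrows MG" "grange MG H = grange MG P" for H P
    proof -
      obtain h \<psi> where h: "H = germ_class h \<psi>" "valid h \<psi>" using \<open>H \<in> arrows MG\<close> by (rule arrowsE)
      obtain k \<phi> where k: "P = germ_class k \<phi>" "valid k \<phi>" using \<open>P \<in> arrows MG\<close> by (rule arrowsE)
      have "char_act h \<psi> = char_act k \<phi>"
        using that h k by simp
      then show ?thesis
        using inv_mult_MG[OF h(2) k(2)] h k by simp
    qed
    have arr: "H \<in> arrows MG" "K \<in> arrows MG" "P \<in> arrows MG" "Q \<in> arrows MG"
      using H K PQ A(2) full_bisection_arrows by (auto simp: B_def)
    have "gsource MG H = gsource MG K"
      using range[OF arr(1,3) H(2)] range[OF arr(2,4) K(2)] PQ(3) by (simp add: \<tau>_def H_def K_def)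
    then have "H = K"
      using H(1) K(1) full_bisection_source_inject by blast
    have "gmult MG (ginv MG H) P = gmult MG (ginv MG K) Q"
      using PQ(3) unfolding \<tau>_def H_def K_def .
    then show "P = Q"
      using H(2) K(2) \<open>H = K\<close> by (intro inv_mult_inject[OF arr(1,3,4)]) simp_all
  qed
  have "(\<Sum>P\<in>A. (?w P)\<^sup>2) = (\<Sum>P\<in>B. (?w P)\<^sup>2)"
    using A(1) by (intro sum.mono_neutral_right) (auto simp: B_def)
  also have "\<dots> = (\<Sum>P\<in>B. (cmod (\<xi> (\<tau> P)))\<^sup>2)"
    by (intro sum.cong) (simp_all add: w)
  also have "\<dots> = (\<Sum>P\<in>\<tau> ` B. (cmod (\<xi> P))\<^sup>2)"
    using \<open>inj_on \<tau> B\<close> by (simp add: sum.reindex)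
  finally have "L2_set ?w A = L2_set (\<lambda>P. cmod (\<xi> P)) (\<tau> ` B)"
    by (simp add: L2_set_def)
  also have "\<dots> \<le> sqrt (\<Sum>\<^sub>\<infinity>P. (cmod (\<xi> P))\<^sup>2)"
    using A(1) by (intro L2_set_le_square_summable \<xi>) (simp add: B_def)
  finally show ?thesis .
qed

text \<open>The regular representation on plain functions, before \<open>Abs_ell2\<close> and
  \<open>Blinfun\<close> are applied.\<close>

definition fibre_fun :: "'s::left_cancellative_monoid hull_char \<Rightarrow> ('s germ set \<Rightarrow> complex) \<Rightarrow>
    ('s germ set \<Rightarrow> complex) \<Rightarrow> 's germ set \<Rightarrow> complex" where
  "fibre_fun x f \<xi> P = (if P \<in> arrows MG \<and> gsource MG P = x then convolution MG f \<xi> P else 0)"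

text \<open>One partial isometry per bisection, each weighted by at most M. The bound is free of x,
  as the supremum in \<open>reduced_norm\<close> demands.\<close>

lemma L2_set_fibre_fun:
  assumes G: "finite G" "G \<subseteq> left_inverse_hull" "\<And>P. f P \<noteq> 0 \<Longrightarrow> P \<in> (\<Union>g\<in>G. full_bisection g)"
    and M: "\<And>P. cmod (f P) \<le> M" and \<xi>: "square_summable \<xi>" and A: "finite A"
  shows "L2_set (\<lambda>P. cmod (fibre_fun x f \<xi> P)) A \<le> M * card G * sqrt (\<Sum>\<^sub>\<infinity>P. (cmod (\<xi> P))\<^sup>2)"
proof -
  define A' where "A' = {P \<in> A. P \<in> arrows MG \<and> gsource MG P = x}"
  have A': "finite A'" "A' \<subseteq> arrows MG"
    using A by (auto simp: A'_def)
  have M0: "0 \<le> M"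
    using M[of undefined] norm_ge_zero order_trans by blast
  let ?w = "\<lambda>g P. \<Sum>H\<in>fibre_slice g P. cmod (\<xi> (gmult MG (ginv MG H) P))"
  have le: "cmod (fibre_fun x f \<xi> P) \<le> M * (\<Sum>g\<in>G. ?w g P)" if "P \<in> A'" for P
  proof -
    have "cmod (fibre_fun x f \<xi> P) =
        cmod (\<Sum>H\<in>(\<Union>g\<in>G. fibre_slice g P). f H * \<xi> (gmult MG (ginv MG H) P))"
      using that by (simp add: fibre_fun_def A'_def convolution_finite[OF G])
    also have "\<dots> \<le> (\<Sum>H\<in>(\<Union>g\<in>G. fibre_slice g P). M * cmod (\<xi> (gmult MG (ginv MG H) P)))"
      by (intro sum_norm_le) (auto simp: norm_mult intro!: mult_right_mono M)
    also have "\<dots> \<le> (\<Sum>g\<in>G. \<Sum>H\<in>fibre_slice g P. M * cmod (\<xi> (gmult MG (ginv MG H) P)))"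
      using G(1) M0 by (intro sum_UNION_le finite_fibre_slice) auto
    also have "\<dots> = M * (\<Sum>g\<in>G. ?w g P)"
      by (simp add: sum_distrib_left)
    finally show ?thesis .
  qed
  have "(\<Sum>P\<in>A. (cmod (fibre_fun x f \<xi> P))\<^sup>2) = (\<Sum>P\<in>A'. (cmod (fibre_fun x f \<xi> P))\<^sup>2)"
    using A by (intro sum.mono_neutral_right) (auto simp: A'_def fibre_fun_def)
  then have "L2_set (\<lambda>P. cmod (fibre_fun x f \<xi> P)) A = L2_set (\<lambda>P. cmod (fibre_fun x f \<xi> P)) A'"
    by (simp add: L2_set_def)
  also have "\<dots> \<le> L2_set (\<lambda>P. M * (\<Sum>g\<in>G. ?w g P)) A'"
    by (intro L2_set_mono le) auto
  also have "\<dots> = M * L2_set (\<lambda>P. \<Sum>g\<in>G. ?w g P) A'"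
    using M0 by (simp add: L2_set_right_distrib)
  also have "\<dots> \<le> M * (\<Sum>g\<in>G. L2_set (?w g) A')"
    using G(1) M0 by (intro mult_left_mono L2_set_sum_le)
  also have "\<dots> \<le> M * (\<Sum>g\<in>G. sqrt (\<Sum>\<^sub>\<infinity>P. (cmod (\<xi> P))\<^sup>2))"
    using M0 A' \<xi> by (intro mult_left_mono sum_mono L2_set_slice)
  finally show ?thesis
    by simp
qed

lemma norm_ell2_eq: "norm \<xi> = sqrt (\<Sum>\<^sub>\<infinity>x. (cmod (Rep_ell2 \<xi> x))\<^sup>2)"
  by (rule norm_ell2.rep_eq)

text \<open>\<open>Abs_ell2\<close> and \<open>Blinfun\<close> carry meaning only for square
  summable functions and bounded linear maps; both conditions are supplied here, with B chosen
  before x.\<close>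

lemma fibre_rep_aux:
  assumes "tame f"
  obtains B where "\<And>x. bounded_linear (\<lambda>\<xi>. Abs_ell2 (fibre_fun x f (Rep_ell2 \<xi>)))"
    "\<And>x \<xi>. Rep_ell2 (Abs_ell2 (fibre_fun x f (Rep_ell2 \<xi>))) = fibre_fun x f (Rep_ell2 \<xi>)"
    "\<And>x \<xi>. norm (Abs_ell2 (fibre_fun x f (Rep_ell2 \<xi>))) \<le> B * norm \<xi>" "0 \<le> B"
proof -
  obtain G M where G: "finite G" "G \<subseteq> left_inverse_hull" "\<And>P. f P \<noteq> 0 \<Longrightarrow> P \<in> (\<Union>g\<in>G. full_bisection g)"
    and M: "\<And>P. cmod (f P) \<le> M"
    using assms unfolding tame_def by blast
  have M0: "0 \<le> M"
    using M[of undefined] norm_ge_zero order_trans by blast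
  note L2 = L2_set_fibre_fun[OF G M Rep_ell2[THEN CollectD]]
  have rep: "Rep_ell2 (Abs_ell2 (fibre_fun x f (Rep_ell2 \<xi>))) = fibre_fun x f (Rep_ell2 \<xi>)" for x \<xi>
    by (rule Abs_ell2_inverse, rule CollectI, rule square_summableI(1), rule L2)
  have norm: "norm (Abs_ell2 (fibre_fun x f (Rep_ell2 \<xi>))) \<le> M * card G * norm \<xi>" for x \<xi>
    unfolding norm_ell2_eq rep by (rule square_summableI(2), rule L2)
  have lin: "bounded_linear (\<lambda>\<xi>. Abs_ell2 (fibre_fun x f (Rep_ell2 \<xi>)))" for x
  proof (rule bounded_linear_intro)
    fix \<xi> \<eta> :: "'a germ set ell2"
    show "Abs_ell2 (fibre_fun x f (Rep_ell2 (\<xi> + \<eta>))) =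
        Abs_ell2 (fibre_fun x f (Rep_ell2 \<xi>)) + Abs_ell2 (fibre_fun x f (Rep_ell2 \<eta>))"
      unfolding Rep_ell2_inject[symmetric] rep unfolding plus_ell2.rep_eq rep
      by (auto simp: fibre_fun_def convolution_finite[OF G] distrib_left sum.distrib)
  next
    fix r :: real and \<xi> :: "'a germ set ell2"
    show "Abs_ell2 (fibre_fun x f (Rep_ell2 (r *\<^sub>R \<xi>))) = r *\<^sub>R Abs_ell2 (fibre_fun x f (Rep_ell2 \<xi>))"
      unfolding Rep_ell2_inject[symmetric] rep unfolding scaleR_ell2.rep_eq rep
      by (auto simp: fibre_fun_def convolution_finite[OF G] scaleR_sum_right)
  next
    fix \<xi> :: "'a germ set ell2"
    show "norm (Abs_ell2 (fibre_fun x f (Rep_ell2 \<xi>))) \<le> norm \<xi> * (M * card G)"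
      using norm[of x \<xi>] by (simp add: mult.commute)
  qed
  show thesis
    by (rule that[OF lin rep norm]) (simp add: M0)
qed

lemma fibre_rep_eq: "fibre_rep MG x f = Blinfun (\<lambda>\<xi>. Abs_ell2 (fibre_fun x f (Rep_ell2 \<xi>)))"
  unfolding fibre_rep_def fibre_fun_def ..

lemma fibre_rep_apply:
  assumes "tame f"
  shows "Rep_ell2 (blinfun_apply (fibre_rep MG x f) \<xi>) = fibre_fun x f (Rep_ell2 \<xi>)"
  using assms by (rule fibre_rep_aux) (simp add: fibre_rep_eq bounded_linear_Blinfun_apply)

lemma fibre_rep_bounded:
  assumes "tame f"
  obtains B where "\<And>x. norm (fibre_rep MG x f) \<le> B"
  using assms
proof (rule fibre_rep_aux)
  fix B
  assume *: "\<And>x. bounded_linear (\<lambda>\<xi>. Abs_ell2 (fibre_fun x f (Rep_ell2 \<xi>)))"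
    "\<And>x \<xi>. norm (Abs_ell2 (fibre_fun x f (Rep_ell2 \<xi>))) \<le> B * norm \<xi>" "0 \<le> B"
  show thesis
    by (rule that[of B], rule norm_blinfun_bound)
       (use * in \<open>simp_all add: fibre_rep_eq bounded_linear_Blinfun_apply\<close>)
qed

text \<open>A real supremum bounds its terms only if the set is bounded above, which is where
  uniformity of the bound in x enters.\<close>

lemma fibre_rep_le_reduced_norm:
  assumes "tame f" "x \<in> Omega"
  shows "norm (fibre_rep MG x f) \<le> reduced_norm MG f"
proof -
  obtain B where "\<And>x. norm (fibre_rep MG x f) \<le> B"
    using assms(1) by (rule fibre_rep_bounded) blast
  then have "bdd_above ((\<lambda>x. norm (fibre_rep MG x f)) ` Omega)"
    by (intro bdd_aboveI2)
  then show ?thesis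
    unfolding reduced_norm_def units_MG using assms(2) by (intro cSUP_upper)
qed

section \<open>Compact open Hausdorff bisections\<close>

lemma closedin_Omega: "closedin hull_char_topology Omega"
  unfolding Omega_def by (rule closedin_closure_of)

lemma continuous_map_germ:
  fixes g :: "'s::left_cancellative_monoid \<rightharpoonup> 's"
  assumes "g \<in> left_inverse_hull"
  shows "continuous_map (subtopology hull_char_topology (char_domain g)) (gtop paterson_groupoid) (germ g)"
proof -
  have top: "topspace (subtopology hull_char_topology (char_domain g)) = char_domain g"
    by (auto simp: topspace_hull_char char_domain_hull_char)
  have "continuous_map (subtopology hull_char_topology (char_domain g))
     (topology_generated_by {germ g ` U | (g :: 's \<rightharpoonup> 's) U. g \<in> left_inverse_hull \<and>
        U \<subseteq> char_domain g \<and> openin hull_char_topology U}) (germ g)"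
  proof (rule continuous_on_generated_topo)
    fix W assume "W \<in> {germ g ` U | (g :: 's \<rightharpoonup> 's) U. g \<in> left_inverse_hull \<and>
        U \<subseteq> char_domain g \<and> openin hull_char_topology U}"
    then obtain h :: "'s \<rightharpoonup> 's" and U where h: "W = germ h ` U" "h \<in> left_inverse_hull" "U \<subseteq> char_domain h"
        "openin hull_char_topology U" by blast
    have "germ g \<phi> \<in> germ h ` U \<longleftrightarrow> \<phi> \<in> U \<and> germ_eqv True g h \<phi>" if "\<phi> \<in> char_domain g" for \<phi>
      using h(2,3) that assms by (auto simp: germ_eq_iff subset_iff image_iff)
    then have "germ g -` W \<inter> char_domain g = (U \<inter> {\<phi> \<in> hull_chars. germ_eqv True g h \<phi>}) \<inter> char_domain g"
      unfolding h(1) by (auto simp: char_domain_hull_char)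
    moreover have "openin hull_char_topology (U \<inter> {\<phi> \<in> hull_chars. germ_eqv True g h \<phi>})"
      by (intro openin_Int h(4) openin_germ_eqv)
    ultimately show "openin (subtopology hull_char_topology (char_domain g))
        (germ g -` W \<inter> topspace (subtopology hull_char_topology (char_domain g)))"
      unfolding top openin_subtopology by blast
  next
    show "germ g ` topspace (subtopology hull_char_topology (char_domain g)) \<subseteq>
      \<Union>{germ g ` U | (g :: 's \<rightharpoonup> 's) U. g \<in> left_inverse_hull \<and>
        U \<subseteq> char_domain g \<and> openin hull_char_topology U}"
      unfolding top by (rule Union_upper) (use assms openin_char_domain[OF assms] in blast)
  qed
  then show ?thesis
    by (simp add: paterson_groupoid_def)
qed

text \<open>Because \<open>X \<subseteq> dom g\<close>, the bisection is the continuous image of the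
  whole of \<Omega> \<inter> \<open>cylinder X {}\<close>, a closed set in the compact space of
  characters.\<close>

lemma compactin_bisection:
  fixes g :: "'s::left_cancellative_monoid \<rightharpoonup> 's"
  assumes g: "g \<in> left_inverse_hull" and X: "X \<in> \<J>" "X \<subseteq> dom g"
  shows "compactin (gtop MG) (bisection g (cylinder X {}))"
proof -
  define K where "K = Omega \<inter> cylinder X {}"
  have KD: "K \<subseteq> char_domain g"
    using hull_char_mono[OF _ X(1) dom_constructible[OF g] X(2)]
    by (auto simp: K_def cylinder_def mem_char_domain[OF g])
  then have KV: "\<phi> \<in> K \<longleftrightarrow> \<phi> \<in> cylinder X {} \<and> valid g \<phi>" for \<phi>
    using g by (auto simp: K_def valid_def)
  have "closedin hull_char_topology (cylinder X {})"
  proof -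
    have "topspace hull_char_topology - cylinder X {} = {\<phi> \<in> hull_chars. \<not> \<phi> (pid X)}"
      by (auto simp: cylinder_def topspace_hull_char)
    then show ?thesis
      using coordinate_open(2)[OF X(1)] by (simp add: closedin_def topspace_hull_char cylinder_def)
  qed
  then have "compactin hull_char_topology K"
    unfolding K_def
    by (intro closedin_compact_space compact_space_hull_char_topology closedin_Int closedin_Omega)
  then have K: "compactin (subtopology hull_char_topology K) K"
    by (simp add: compactin_subtopology)
  have "continuous_map (subtopology hull_char_topology K) (gtop MG) (germ_class g)"
    unfolding continuous_map
  proof (intro conjI allI impI)
    have top: "topspace (subtopology hull_char_topology K) = K"
      using KD by (auto simp: topspace_hull_char char_domain_hull_char)
    have "openin (gtop MG) (bisection g hull_chars)"
      using g by (rule openin_full_bisection)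
    then show "germ_class g ` topspace (subtopology hull_char_topology K) \<subseteq> topspace (gtop MG)"
      unfolding top using openin_subset KV valid_hull_char by (fastforce simp: bisection_def)
    fix W :: "'s germ set set" assume "openin (gtop MG) W"
    then obtain V where V: "openin (gtop paterson_groupoid) V"
        "\<And>h \<phi>. valid h \<phi> \<Longrightarrow> germ_class h \<phi> \<in> W \<longleftrightarrow> germ h \<phi> \<in> V"
      unfolding openin_MG by blast
    have "openin (subtopology hull_char_topology (char_domain g))
        {\<phi> \<in> topspace (subtopology hull_char_topology (char_domain g)). germ g \<phi> \<in> V}"
      by (rule openin_continuous_map_preimage[OF continuous_map_germ[OF g] V(1)])
    then obtain U where U: "openin hull_char_topology U"
        "{\<phi> \<in> topspace (subtopology hull_char_topology (char_domain g)). germ g \<phi> \<in> V} = U \<inter> char_domain g"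
      unfolding openin_subtopology by blast
    have "germ g \<phi> \<in> V \<longleftrightarrow> \<phi> \<in> U" if "\<phi> \<in> char_domain g" for \<phi>
      using eqset_imp_iff[OF U(2), of \<phi>] that by (simp add: topspace_hull_char char_domain_hull_char)
    then have "germ_class g \<phi> \<in> W \<longleftrightarrow> \<phi> \<in> U" if "\<phi> \<in> K" for \<phi>
      using that KD KV V(2) by blast
    then have "{\<phi> \<in> K. germ_class g \<phi> \<in> W} = U \<inter> K"
      by blast
    then show "openin (subtopology hull_char_topology K)
        {\<phi> \<in> topspace (subtopology hull_char_topology K). germ_class g \<phi> \<in> W}"
      unfolding top openin_subtopology using U(1) by blast
  qed
  from image_compactin[OF K this] have "compactin (gtop MG) (germ_class g ` K)" .
  moreover have "bisection g (cylinder X {}) = germ_class g ` K"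
    unfolding bisection_def using KV by blast
  ultimately show ?thesis by simp
qed

text \<open>Arrows of one bisection are determined by their sources, and two characters are
  separated by the two open conditions on a coordinate where they differ.\<close>

lemma Hausdorff_bisection:
  fixes g :: "'s::left_cancellative_monoid \<rightharpoonup> 's"
  assumes g: "g \<in> left_inverse_hull"
  shows "Hausdorff_space (subtopology (gtop MG) (bisection g U))"
  unfolding Hausdorff_space_def
proof (intro allI impI)
  fix P Q
  assume PQ: "P \<in> topspace (subtopology (gtop MG) (bisection g U)) \<and>
    Q \<in> topspace (subtopology (gtop MG) (bisection g U)) \<and> P \<noteq> Q"
  then obtain \<phi> \<psi> where \<phi>: "P = germ_class g \<phi>" "valid g \<phi>" and \<psi>: "Q = germ_class g \<psi>" "valid g \<psi>" and "\<phi> \<noteq> \<psi>"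
    by (auto simp: bisection_def)
  then obtain X where X: "X \<in> \<J>" "\<phi> (pid X) \<noteq> \<psi> (pid X)"
    using hull_char_eqI valid_hull_char by metis
  define V where "V v = {\<phi> \<in> hull_chars. \<phi> (pid X) = v}" for v
  have V: "openin (gtop MG) (bisection g (V v))" for v
    using coordinate_open[OF X(1)] by (intro openin_bisection g) (cases v; simp add: V_def)
  have "P \<in> bisection g (V (\<phi> (pid X)))" "Q \<in> bisection g (V (\<psi> (pid X)))"
    using \<phi> \<psi> by (auto simp: bisection_def V_def valid_hull_char)
  moreover have "disjnt (bisection g (V (\<phi> (pid X)))) (bisection g (V (\<psi> (pid X))))"
    using X(2) by (auto simp: disjnt_def bisection_def V_def germ_class_eq_iff)
  ultimately show "\<exists>A B. openin (subtopology (gtop MG) (bisection g U)) A \<and>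
      openin (subtopology (gtop MG) (bisection g U)) B \<and> P \<in> A \<and> Q \<in> B \<and> disjnt A B"
    using V PQ by (intro exI[of _ "bisection g (V (\<phi> (pid X))) \<inter> bisection g U"]
      exI[of _ "bisection g (V (\<psi> (pid X))) \<inter> bisection g U"])
      (auto simp: openin_subtopology disjnt_def)
qed

lemma indicator_bisection_Cc_open:
  fixes g :: "'s::left_cancellative_monoid \<rightharpoonup> 's"
  assumes g: "g \<in> left_inverse_hull" and X: "X \<in> \<J>" "X \<subseteq> dom g"
  shows "indicator (bisection g (cylinder X {})) \<in> Cc_open MG (bisection g (cylinder X {}))"
proof -
  let ?V = "bisection g (cylinder X {})"
  have top: "topspace (subtopology (gtop MG) ?V) = ?V"
    using openin_subset[OF openin_bisection[OF g openin_cylinder[OF X(1)], of "{}"]] by auto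
  have "continuous_map (subtopology (gtop MG) ?V) euclidean (indicator ?V :: _ \<Rightarrow> complex)"
    by (rule continuous_map_eq[of _ _ "\<lambda>_. 1"]) (simp_all add: top)
  moreover have "subtopology (gtop MG) ?V closure_of {P \<in> ?V. indicator ?V P \<noteq> (0::complex)} = ?V"
    using closure_of_topspace[of "subtopology (gtop MG) ?V"] unfolding top by (simp add: indicator_def)
  ultimately show ?thesis
    using compactin_bisection[OF g X] by (simp add: Cc_open_def compactin_subtopology)
qed


section \<open>Normal forms and constructible ideals in T\<close>

fun is_leg :: "gen \<Rightarrow> bool" where
  "is_leg (Gen_x n) \<longleftrightarrow> True"
| "is_leg (Gen_y n) \<longleftrightarrow> True"
| "is_leg _ \<longleftrightarrow> False"

text \<open>The four families of relations in one formula: g b l = b (\<open>leg_act g l\<close>)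
  for g in {a, c} and l a leg. The last equation covers the fixed legs as well as all remaining
  arguments.\<close>

fun leg_act :: "gen \<Rightarrow> gen \<Rightarrow> gen" where
  "leg_act Gen_a (Gen_y n) = Gen_y (n + 1)"
| "leg_act Gen_c (Gen_x n) = Gen_x (n + 1)"
| "leg_act _ l = l"

text \<open>Left multiplication by a generator. One rewriting step suffices to keep a reduced word
  reduced: the result begins with b and a leg, and neither letter begins the left side of a
  relation.\<close>

fun gen_act :: "gen \<Rightarrow> gen list \<Rightarrow> gen list" where
  "gen_act g (h # l # v) =
     (if g \<in> {Gen_a, Gen_c} \<and> h = Gen_b \<and> is_leg l then Gen_b # leg_act g l # v
      else g # h # l # v)"
| "gen_act g v = g # v"

lemma is_leg_leg_act [simp]: "is_leg (leg_act g l) \<longleftrightarrow> is_leg l"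
  by (cases "(g, l)" rule: leg_act.cases) auto

lemma leg_act_inject: "g \<in> {Gen_a, Gen_c} \<Longrightarrow> leg_act g l = leg_act g l' \<longleftrightarrow> l = l'"
  by (cases l; cases l') auto

lemma leg_act_image:
  assumes "g \<in> {Gen_a, Gen_c}"
  shows "leg_act g ` Collect is_leg = Collect is_leg"
proof -
  have "\<exists>l'. is_leg l' \<and> leg_act g l' = l" if "is_leg l" for l
  proof (cases l)
    case (Gen_x n)
    then show ?thesis
      using assms by (intro exI[of _ "Gen_x (if g = Gen_a then n else n - 1)"]) auto
  next
    case (Gen_y n)
    then show ?thesis
      using assms by (intro exI[of _ "Gen_y (if g = Gen_a then n - 1 else n)"]) auto
  qed (use that in auto)
  then show ?thesis
    by (force simp: image_iff)
qed

text \<open>A rewritten result begins with b, an unrewritten one with a or c; two rewritten ones are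
  compared by injectivity of \<open>leg_act g\<close>.\<close>

lemma gen_act_inject: "gen_act g v = gen_act g w \<longleftrightarrow> v = w"
  by (cases "(g, v)" rule: gen_act.cases; cases "(g, w)" rule: gen_act.cases)
     (auto simp: leg_act_inject)

lemma gen_act_non_ac [simp]: "g \<notin> {Gen_a, Gen_c} \<Longrightarrow> gen_act g w = g # w"
  by (cases "(g, w)" rule: gen_act.cases) auto

lemma T_rel_leg_act:
  assumes "g \<in> {Gen_a, Gen_c}" "is_leg l"
  shows "T_rel [g, Gen_b, l] [Gen_b, leg_act g l]"
  using assms by (cases l) (auto intro: T_rel.intros)

lemma foldr_gen_act_cong:
  "presentation_eq T_rel u v \<Longrightarrow> foldr gen_act u = foldr gen_act v"
proof (induction rule: presentation_eq.induct)
  case (rel u v)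
  then show ?case by cases (auto simp: fun_eq_iff)
qed (auto simp: fun_eq_iff)

lemma presentation_eq_gen_act: "presentation_eq T_rel (g # w) (gen_act g w)"
proof (cases "(g, w)" rule: gen_act.cases)
  case (1 g' h l v)
  show ?thesis
  proof (cases "g \<in> {Gen_a, Gen_c} \<and> h = Gen_b \<and> is_leg l")
    case True
    then have "presentation_eq T_rel ([g, Gen_b, l] @ v) ([Gen_b, leg_act g l] @ v)"
      by (intro presentation_eq.append presentation_eq.rel presentation_eq.refl T_rel_leg_act) auto
    with True 1 show ?thesis
      by simp
  qed (use 1 in \<open>auto intro: presentation_eq.refl\<close>)
qed (auto intro: presentation_eq.refl)

lemma presentation_eq_foldr_gen_act: "presentation_eq T_rel w (foldr gen_act w [])"
proof (induction w)
  case (Cons g w)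
  have "presentation_eq T_rel ([g] @ w) ([g] @ foldr gen_act w [])"
    by (intro presentation_eq.append Cons.IH presentation_eq.refl)
  then show ?case
    using presentation_eq.trans presentation_eq_gen_act by fastforce
qed (simp add: presentation_eq.refl)

lift_definition T_act :: "T \<Rightarrow> gen list \<Rightarrow> gen list" is "foldr gen_act"
  by (rule foldr_gen_act_cong)

lift_definition T_word :: "gen list \<Rightarrow> T" is "\<lambda>w. w" .

abbreviation T_gen :: "gen \<Rightarrow> T" where "T_gen g \<equiv> T_word [g]"

text \<open>The orbit map of the empty word. Each step of the action is an instance of a relation,
  so \<open>nf t\<close> represents t and determines it.\<close>

definition nf :: "T \<Rightarrow> gen list" where "nf t = T_act t []"

lemma T_word_Nil [simp]: "T_word [] = 1"
  by transfer (rule presentation_eq.refl)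

lemma T_word_append: "T_word (v @ w) = T_word v * T_word w"
  by transfer (rule presentation_eq.refl)

lemma T_word_Cons: "T_word (g # w) = T_gen g * T_word w"
  using T_word_append[of "[g]" w] by simp

lemma T_act_mult: "T_act (s * t) w = T_act s (T_act t w)"
  by transfer simp

lemma T_act_inject: "T_act s v = T_act s w \<longleftrightarrow> v = w"
proof transfer
  fix s v w
  show "foldr gen_act s v = foldr gen_act s w \<longleftrightarrow> v = w"
    by (induction s) (auto simp: gen_act_inject)
qed

lemma T_word_nf [simp]: "T_word (nf t) = t"
  unfolding nf_def by transfer (blast intro: presentation_eq.sym presentation_eq_foldr_gen_act)

lemma nf_inject: "nf s = nf t \<longleftrightarrow> s = t"
  by (metis T_word_nf)

lemma nf_mult: "nf (s * t) = T_act s (nf t)"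
  by (simp add: nf_def T_act_mult)

lemma nf_gen_mult: "nf (T_gen g * t) = gen_act g (nf t)"
  unfolding nf_mult by (transfer fixing: g) simp

lemma nf_1 [simp]: "nf 1 = []"
  unfolding nf_def by transfer simp

instance T :: left_cancellative_monoid
proof
  fix s t u :: T
  assume "s * t = s * u"
  then show "t = u"
    by (metis nf_mult T_act_inject nf_inject)
qed

section \<open>The families u l T and their left divisors\<close>

lemma T_gen_relation:
  assumes "g \<in> {Gen_a, Gen_c}" "is_leg l"
  shows "T_gen g * (T_gen Gen_b * (T_gen l * t)) = T_gen Gen_b * (T_gen (leg_act g l) * t)"
proof -
  have "gen_act l w = l # w" "gen_act (leg_act g l) w = leg_act g l # w" for w
    using assms by (cases l; auto)+
  then show ?thesis
    using assms unfolding nf_inject[symmetric] nf_gen_mult by simp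
qed

text \<open>For u = b these are the pieces of X. The family is a set of sets, not indexed by legs,
  so that permuting the legs leaves it unchanged.\<close>

definition branches :: "T \<Rightarrow> T set set" where
  "branches u = (\<lambda>l. range ((*) (u * T_gen l))) ` Collect is_leg"

lemma Union_branches: "\<Union>(branches u) = {u * (T_gen l * t) | l t. is_leg l}"
  by (auto simp: branches_def mult.assoc)

lemma branches_mult: "branches (s * u) = (`) ((*) s) ` branches u"
  by (simp add: branches_def image_image mult.assoc)

lemma branches_mult_b:
  assumes "g \<in> {Gen_a, Gen_c}"
  shows "branches (T_gen g * T_gen Gen_b) = branches (T_gen Gen_b)"
proof -
  have "range ((*) (T_gen g * T_gen Gen_b * T_gen l)) = range ((*) (T_gen Gen_b * T_gen (leg_act g l)))"
    if "is_leg l" for l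
    by (simp add: mult.assoc T_gen_relation[OF assms that])
  then have "branches (T_gen g * T_gen Gen_b) =
      (\<lambda>l. range ((*) (T_gen Gen_b * T_gen l))) ` leg_act g ` Collect is_leg"
    unfolding branches_def image_comp comp_def by (rule image_cong[OF HOL.refl]) blast
  then show ?thesis
    by (simp add: branches_def leg_act_image[OF assms])
qed

text \<open>Words in which appending \<open>x\<^sub>n\<close> or \<open>y\<^sub>n\<close> creates no redex.\<close>

definition rigid :: "gen list \<Rightarrow> bool" where
  "rigid w \<longleftrightarrow> (\<forall>l v. is_leg l \<longrightarrow> foldr gen_act w (l # v) = w @ l # v)"

lemma rigid_Nil [simp]: "rigid []"
  by (simp add: rigid_def)

lemma rigid_Cons: "rigid w \<Longrightarrow> (\<And>l v. is_leg l \<Longrightarrow> gen_act g (w @ l # v) = g # w @ l # v) \<Longrightarrow> rigid (g # w)"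
  by (auto simp: rigid_def)

lemma gen_act_leg: "is_leg l \<Longrightarrow> gen_act l w = l # w"
  by (cases l) auto

lemma rigid_b_leg: "is_leg l \<Longrightarrow> rigid (Gen_b # l # w) \<longleftrightarrow> rigid w"
  by (auto simp: rigid_def gen_act_leg)

lemma T_word_gen_act: "T_word (gen_act g w) = T_gen g * T_word w"
proof -
  have "T_word (gen_act g w) = T_word (g # w)"
    unfolding T_word_def map_fun_def comp_def id_apply
    by (metis T.abs_eq_iff presentation_eq_gen_act)
  then show ?thesis
    by (simp add: T_word_Cons[of g w])
qed

text \<open>Build up a word for u from the right. A letter a or c directly before a final b merely
  permutes the branches and is dropped; any other redex is removed by rewriting.\<close>

lemma branches_rigid_word: "\<exists>w. rigid w \<and> branches u = branches (T_word w)"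
proof -
  have "\<exists>w'. rigid w' \<and> branches (T_word w) = branches (T_word w')" for w
  proof (induction w)
    case (Cons g w)
    then obtain v where v: "rigid v" "branches (T_word w) = branches (T_word v)"
      by blast
    have eq: "branches (T_word (g # w)) = branches (T_gen g * T_word v)"
      unfolding T_word_Cons[of g w] branches_mult v(2) ..
    consider "v = [Gen_b]" "g \<in> {Gen_a, Gen_c}"
      | l v' where "v = Gen_b # l # v'" "is_leg l" "g \<in> {Gen_a, Gen_c}"
      | "g \<notin> {Gen_a, Gen_c}"
      | "v \<noteq> [Gen_b]" "\<nexists>l v'. v = Gen_b # l # v' \<and> is_leg l"
      by metis
    then show ?case
    proof cases
      case 1
      then show ?thesis
        using v(1) eq branches_mult_b[OF 1(2)] by metis
    next
      case 2
      then have "rigid (gen_act g v)"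
        using v(1) by (simp add: rigid_b_leg)
      then show ?thesis
        using eq unfolding T_word_gen_act[of g v, symmetric] by blast
    next
      case 3
      then have "rigid (g # v)"
        using v(1) by (intro rigid_Cons) auto
      then show ?thesis
        using eq unfolding T_word_Cons[of g v, symmetric] by blast
    next
      case 4
      have "gen_act g (v @ l # r) = g # v @ l # r" if "is_leg l" for l r
      proof (cases v)
        case Nil
        then show ?thesis
          using that by (cases r; cases l) simp_all
      next
        case v: (Cons h v')
        show ?thesis
        proof (cases v')
          case Nil
          with 4(1) v show ?thesis
            by simp
        next
          case (Cons l' v'')
          with 4(2) v show ?thesis
            by simp
        qed
      qed
      then have "rigid (g # v)"
        using v(1) by (intro rigid_Cons)
      then show ?thesis
        using eq unfolding T_word_Cons[of g v, symmetric] by blast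
    qed
  qed (metis rigid_Nil)
  from this[of "nf u"] show ?thesis
    by simp
qed

lemma nf_rigid:
  assumes "rigid w" "is_leg l"
  shows "nf (T_word w * (T_gen l * t)) = w @ l # nf t"
proof -
  have "nf (T_gen l * t) = l # nf t"
    using assms(2) by (simp add: nf_gen_mult gen_act_leg)
  moreover have "T_act (T_word w) v = foldr gen_act w v" for v
    by transfer simp
  ultimately show ?thesis
    using assms by (simp add: nf_mult rigid_def)
qed

text \<open>A first letter other than g can only stem from rewriting, which leaves b followed by a
  leg.\<close>

lemma gen_act_eq_Cons:
  "gen_act g v = h # w \<Longrightarrow>
    g = h \<or> g \<in> {Gen_a, Gen_c} \<and> h = Gen_b \<and> (\<exists>l w'. is_leg l \<and> w = l # w')"
  by (cases "(g, v)" rule: gen_act.cases) (auto split: if_splits)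

text \<open>With w rigid, the elements of the branches have normal forms
  \<open>w @ l # nf t\<close>, so divisibility by g shows in the first letters. A nonempty w settles
  it for all l alike; for w empty, only the branch of the leg l = g can be divisible.\<close>

lemma branches_division:
  "(\<exists>u'. branches u = branches (T_gen g * u')) \<or>
   (\<exists>\<G>. finite \<G> \<and> \<G> \<subseteq> branches u \<and> range ((*) (T_gen g)) \<inter> \<Union>(branches u) \<subseteq> \<Union>\<G>)"
proof -
  obtain w where w: "rigid w" "branches u = branches (T_word w)"
    using branches_rigid_word by blast
  have key: "gen_act g (nf s) = w @ l # nf t"
    if "T_gen g * s = T_word w * (T_gen l * t)" "is_leg l" for s l t
    using arg_cong[OF that(1), of nf] that(2) by (simp add: nf_gen_mult nf_rigid[OF w(1)])
  have emptyI: ?thesis if "\<And>s l t. is_leg l \<Longrightarrow> gen_act g s \<noteq> w @ l # t"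
  proof -
    have "range ((*) (T_gen g)) \<inter> \<Union>(branches (T_word w)) = {}"
      using key that unfolding Union_branches by blast
    then show ?thesis
      using w(2) by (intro disjI2 exI[of _ "{}"]) auto
  qed
  have divI: ?thesis if "gen_act g v = w" for v
    using w(2) unfolding that[symmetric] T_word_gen_act by (rule disjI1[OF exI])
  consider "w = []" | w' where "w = g # w'"
    | "w = [Gen_b]" "g \<in> {Gen_a, Gen_c}"
    | l w' where "w = Gen_b # l # w'" "is_leg l" "g \<in> {Gen_a, Gen_c}"
    | h w' where "w = h # w'" "h \<noteq> g" "\<And>l v. h = Gen_b \<Longrightarrow> g \<in> {Gen_a, Gen_c} \<Longrightarrow> w' = l # v \<Longrightarrow> \<not> is_leg l"
      "h = Gen_b \<Longrightarrow> g \<in> {Gen_a, Gen_c} \<Longrightarrow> w' \<noteq> []"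
  proof (cases w)
    case (Cons h w')
    consider "h = g" | "h \<noteq> g" "h = Gen_b" "g \<in> {Gen_a, Gen_c}"
      | "h \<noteq> g" "\<not> (h = Gen_b \<and> g \<in> {Gen_a, Gen_c})"
      by blast
    then show thesis
    proof cases
      case 2
      show thesis
      proof (cases w')
        case Nil
        with 2 Cons show thesis by (intro that(3)) simp_all
      next
        case w': (Cons l v)
        show thesis
        proof (cases "is_leg l")
          case True
          with 2 Cons w' show thesis by (intro that(4)) simp_all
        next
          case False
          with 2 w' show thesis by (intro that(5)[OF Cons]) auto
        qed
      qed
    next
      case 3
      then show thesis by (intro that(5)[OF Cons]) auto
    qed (use Cons that(2) in simp)
  qed (rule that(1))
  then show ?thesis
  proof cases
    case 1
    show ?thesis
    proof (cases "is_leg g")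
      case True
      have "range ((*) (T_gen g)) \<inter> \<Union>(branches (T_word w)) \<subseteq> range ((*) (T_word w * T_gen g))"
        by (simp add: 1)
      moreover have "range ((*) (T_word w * T_gen g)) \<in> branches u"
        unfolding w(2) using True by (auto simp: branches_def)
      ultimately show ?thesis
        unfolding w(2) by (intro disjI2 exI[of _ "{range ((*) (T_word w * T_gen g))}"]) auto
    next
      case False
      have "gen_act g s \<noteq> w @ l # t" if "is_leg l" for s l t
        using False that gen_act_eq_Cons[of g s l t] by (auto simp: 1)
      then show ?thesis
        by (rule emptyI)
    qed
  next
    case 2
    then show ?thesis
      using w(2) T_word_Cons[of g w'] by (intro disjI1 exI[of _ "T_word w'"]) (simp only:)
  next
    \<comment> \<open>The word b is not left divisible by a or c, yet the branches of b are those of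
      g b.\<close>
    case 3
    then show ?thesis
      using w(2) branches_mult_b[of g] by auto
  next
    case 4
    then obtain l' where "is_leg l'" "leg_act g l' = l"
      using leg_act_image[OF 4(3)] by (metis imageE mem_Collect_eq)
    with 4 have "gen_act g (Gen_b # l' # w') = w"
      by auto
    then show ?thesis
      using divI by blast
  next
    case 5
    show ?thesis
    proof (rule emptyI)
      fix s l t
      assume "is_leg l"
      show "gen_act g s \<noteq> w @ l # t"
        using 5 gen_act_eq_Cons[of g s h "w' @ l # t"] by (cases w') auto
    qed
  qed
qed

section \<open>The dichotomy for constructible ideals\<close>

definition branch_dichotomy :: "T set \<Rightarrow> T \<Rightarrow> bool" where
  "branch_dichotomy Z u \<longleftrightarrow>
     \<Union>(branches u) \<subseteq> Z \<or> (\<exists>\<G>. finite \<G> \<and> \<G> \<subseteq> branches u \<and> Z \<inter> \<Union>(branches u) \<subseteq> \<Union>\<G>)"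

lemma branch_dichotomy_translate:
  "branch_dichotomy ((*) s ` Z) (s * u) \<longleftrightarrow> branch_dichotomy Z u"
proof -
  have inj: "inj ((*) s)"
    by (auto intro: injI mult_left_cancel)
  have U: "\<Union>(branches (s * u)) = (*) s ` \<Union>(branches u)"
    by (simp only: branches_mult image_Union)
  have "(\<exists>\<G>. finite \<G> \<and> \<G> \<subseteq> branches (s * u) \<and> (*) s ` Z \<inter> \<Union>(branches (s * u)) \<subseteq> \<Union>\<G>) \<longleftrightarrow>
      (\<exists>\<H>. finite \<H> \<and> \<H> \<subseteq> branches u \<and> Z \<inter> \<Union>(branches u) \<subseteq> \<Union>\<H>)"
    unfolding branches_mult ex_finite_subset_image image_Union[symmetric] image_Int[OF inj, symmetric]
      inj_image_subset_iff[OF inj] ..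
  then show ?thesis
    unfolding branch_dichotomy_def U inj_image_subset_iff[OF inj] by simp
qed

lemma branch_dichotomy_cong:
  assumes "\<And>t. t \<in> \<Union>(branches u) \<Longrightarrow> t \<in> Z \<longleftrightarrow> t \<in> Z'"
  shows "branch_dichotomy Z u \<longleftrightarrow> branch_dichotomy Z' u"
proof -
  have "Z \<inter> \<Union>(branches u) = Z' \<inter> \<Union>(branches u)"
    using assms by blast
  moreover have "\<Union>(branches u) \<subseteq> Z \<longleftrightarrow> \<Union>(branches u) \<subseteq> Z'"
    using assms by blast
  ultimately show ?thesis
    unfolding branch_dichotomy_def by simp
qed

text \<open>The branches of s u lie in s T, where Z and the image under s of its preimage coincide;
  then cancel s.\<close>

lemma branch_dichotomy_vimage:
  assumes "branch_dichotomy Z (s * u)"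
  shows "branch_dichotomy ((*) s -` Z) u"
proof -
  have "t \<in> (*) s ` (*) s -` Z \<longleftrightarrow> t \<in> Z" if "t \<in> \<Union>(branches (s * u))" for t
    using that unfolding branches_mult by blast
  then show ?thesis
    using assms branch_dichotomy_cong branch_dichotomy_translate by metis
qed

text \<open>Multiply by one generator g at a time. Either the branches of u are those of some g u',
  and g cancels, or g T already meets them inside finitely many. The hypothesis for all u is what
  lets u' replace u.\<close>

lemma branch_dichotomy_image:
  assumes "\<And>u. branch_dichotomy Z u"
  shows "branch_dichotomy ((*) t ` Z) u"
proof -
  have "branch_dichotomy ((*) (T_word w) ` Z) u" for w
  proof (induction w arbitrary: u)
    case Nil
    then show ?case using assms by simp
  next
    case (Cons g w)
    have eq: "(*) (T_word (g # w)) ` Z = (*) (T_gen g) ` (*) (T_word w) ` Z"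
      unfolding T_word_Cons[of g w] image_image mult.assoc ..
    show ?case
      using branches_division[of u g]
    proof
      assume "\<exists>u'. branches u = branches (T_gen g * u')"
      then obtain u' where u': "branches u = branches (T_gen g * u')" ..
      have "branch_dichotomy S u \<longleftrightarrow> branch_dichotomy S (T_gen g * u')" for S
        unfolding branch_dichotomy_def u' ..
      then show ?thesis
        using Cons.IH[of u'] by (simp only: eq branch_dichotomy_translate)
    next
      assume "\<exists>\<G>. finite \<G> \<and> \<G> \<subseteq> branches u \<and> range ((*) (T_gen g)) \<inter> \<Union>(branches u) \<subseteq> \<Union>\<G>"
      then obtain \<G> where G: "finite \<G>" "\<G> \<subseteq> branches u"
          "range ((*) (T_gen g)) \<inter> \<Union>(branches u) \<subseteq> \<Union>\<G>"
        by (elim exE conjE) (rule that)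
      have "(*) (T_gen g) ` (*) (T_word w) ` Z \<inter> \<Union>(branches u) \<subseteq> \<Union>\<G>"
        by (rule subset_trans[OF Int_mono G(3)]) auto
      then show ?thesis
        unfolding eq branch_dichotomy_def by (intro disjI2 exI[of _ \<G>] conjI G(1,2))
    qed
  qed
  from this[of "nf t"] show ?thesis
    by simp
qed

lemma constructible_ideals_branches:
  assumes "Z \<in> constructible_ideals"
  shows "branch_dichotomy Z u"
proof -
  obtain sts where Z: "Z = foldr (\<lambda>(s, t) X. (*) s -` ((*) t ` X)) sts UNIV"
    using assms unfolding constructible_ideals_def by blast
  have "branch_dichotomy (foldr (\<lambda>(s, t) X. (*) s -` ((*) t ` X)) sts UNIV) u" for u
  proof (induction sts arbitrary: u)
    case (Cons st sts)
    then show ?case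
      by (auto simp: case_prod_beta intro!: branch_dichotomy_vimage branch_dichotomy_image)
  qed (simp add: branch_dichotomy_def)
  then show ?thesis
    unfolding Z .
qed


section \<open>The element in the kernel\<close>

text \<open>The value at the unit P over \<phi> of \<rho>_\<phi>(f) applied to the point mass at P
  is f P.\<close>

lemma fibre_rep_unit:
  fixes \<phi> :: "'s::left_cancellative_monoid hull_char"
  assumes "tame f" and \<phi>: "\<phi> \<in> Omega" and nz: "f (germ_class (pid UNIV) \<phi>) \<noteq> 0"
  shows "fibre_rep MG \<phi> f \<noteq> 0"
proof
  define P where "P = germ_class (pid UNIV) \<phi>"
  have c: "\<phi> \<in> hull_chars"
    using \<phi> by (simp add: Omega_iff)
  have pid: "pid (UNIV :: 's set) \<in> left_inverse_hull"
    by (rule pid_hull) simp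
  have v: "valid (pid UNIV) \<phi>"
    using \<phi> c pid by (simp add: valid_def mem_char_domain)
  have act: "char_act (pid UNIV) \<phi> = \<phi>"
    using v c by (intro hull_char_eqI) (simp_all add: char_act_hull_char char_act_pid pvim_pid pid valid_def)
  have P: "P \<in> arrows MG" "gsource MG P = \<phi>" "grange MG P = \<phi>"
    using v by (auto simp: P_def arrows_MG act)
  \<comment> \<open>Only H = P contributes to the convolution of f with the point mass, evaluated at
    P.\<close>
  have inv: "H = P"
    if H: "H \<in> arrows MG" "grange MG H = grange MG P" "gmult MG (ginv MG H) P = P" for H
  proof -
    obtain h \<psi> where h: "H = germ_class h \<psi>" "valid h \<psi>"
      using H(1) by (rule arrowsE)
    have r: "char_act h \<psi> = char_act (pid UNIV) \<phi>"
      using H(2) h v by (simp add: P_def)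
    note im = inv_mult_MG[OF h(2) v r]
    have "germ_class (pinverse h \<circ>\<^sub>m pid UNIV) \<phi> = germ_class (pid UNIV) \<phi>"
      using H(3) h im by (simp add: P_def)
    then have e: "germ_eqv False (pinverse h \<circ>\<^sub>m pid UNIV) (pid UNIV) \<phi>"
      using germ_class_eq_iff[OF im(2) v] by simp
    moreover have "\<psi> = \<phi>"
    proof -
      have "grange MG (germ_class (pinverse h \<circ>\<^sub>m pid UNIV) \<phi>) = grange MG P"
        using H(3) h im by (simp add: P_def)
      then show ?thesis
        using im P(3) by simp
    qed
    then have h\<phi>: "valid h \<phi>" "char_act h \<phi> = \<phi>"
      using h r act by simp_all
    have "germ_eqv False (h \<circ>\<^sub>m (pinverse h \<circ>\<^sub>m pid UNIV)) (h \<circ>\<^sub>m pid UNIV) \<phi>"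
    proof (rule germ_eqv_comp[OF _ _ _ e])
      show "pinverse h \<circ>\<^sub>m pid UNIV \<in> left_inverse_hull" "\<phi> \<in> char_domain (pinverse h \<circ>\<^sub>m pid UNIV)"
        using im(2) by (simp_all add: valid_def)
    qed (use im(3) \<open>\<psi> = \<phi>\<close> c in \<open>simp add: germ_eqv_refl\<close>)
    moreover have "germ_eqv False (h \<circ>\<^sub>m (pinverse h \<circ>\<^sub>m pid UNIV)) (pid UNIV) \<phi>"
      using v h\<phi> valid_pinverse[OF h\<phi>(1)] by (intro germ_eqv_comp_pinverse) (simp_all add: act valid_def)
    moreover have "h \<circ>\<^sub>m pid UNIV = h"
      by (rule map_eqI) (auto simp: map_comp_Some_iff)
    ultimately have "germ_eqv False h (pid UNIV) \<phi>"
      using germ_eqv_trans germ_eqv_sym by metis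
    then show "H = P"
      using h \<open>\<psi> = \<phi>\<close> v by (simp add: P_def germ_class_eq_iff)
  qed
  have self: "gmult MG (ginv MG P) P = P"
  proof -
    note im = inv_mult_MG[OF v v HOL.refl]
    have "pinverse (pid UNIV) \<circ>\<^sub>m pid UNIV = (pid UNIV :: 's \<rightharpoonup> 's)"
      by (simp add: pinverse_comp pid)
    then show ?thesis
      using im(1) by (simp add: P_def)
  qed
  define \<xi> where "\<xi> Q = (if Q = P then 1 else 0 :: complex)" for Q
  have "square_summable \<xi>"
  proof (rule square_summableI(1)[of _ 1])
    fix F :: "'s germ set set" assume "finite F"
    then have "(\<Sum>Q\<in>F. (cmod (\<xi> Q))\<^sup>2) = (\<Sum>Q\<in>F. if Q = P then 1 else 0)"
      by (intro sum.cong) (auto simp: \<xi>_def)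
    also have "\<dots> \<le> 1"
      using \<open>finite F\<close> by simp
    finally show "L2_set (\<lambda>Q. cmod (\<xi> Q)) F \<le> 1"
      by (simp add: L2_set_def)
  qed
  then have \<xi>: "Rep_ell2 (Abs_ell2 \<xi>) = \<xi>"
    by (simp add: Abs_ell2_inverse)
  have "convolution MG f \<xi> P = infsum (\<lambda>H. f H * \<xi> (gmult MG (ginv MG H) P)) {P}"
    unfolding convolution_def
    by (rule infsum_cong_neutral) (use inv P in \<open>auto simp: \<xi>_def\<close>)
  also have "\<dots> = f P"
    by (simp add: self \<xi>_def)
  finally have "fibre_fun \<phi> f \<xi> P \<noteq> 0"
    using P nz by (simp add: fibre_fun_def P_def[symmetric])
  moreover assume "fibre_rep MG \<phi> f = 0"
  then have "Rep_ell2 0 P = fibre_fun \<phi> f \<xi> P"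
    using fibre_rep_apply[OF assms(1), of \<phi> "Abs_ell2 \<xi>"] by (simp add: \<xi>)
  ultimately show False
    by (simp add: zero_ell2.rep_eq)
qed

lemma reduced_norm_0: "reduced_norm (MG :: ('s::left_cancellative_monoid germ set, 's hull_char) groupoid) (\<lambda>_. 0) = 0"
proof -
  have "fibre_rep (MG :: ('s germ set, 's hull_char) groupoid) x (\<lambda>_. 0) = 0" for x
  proof (rule blinfun_eqI)
    fix \<xi> :: "'s germ set ell2"
    show "blinfun_apply (fibre_rep MG x (\<lambda>_. 0)) \<xi> = blinfun_apply 0 \<xi>"
      unfolding Rep_ell2_inject[symmetric] fibre_rep_apply[OF tame_0]
      by (auto simp: fibre_fun_def convolution_def zero_ell2.rep_eq)
  qed
  \<comment> \<open>The supremum of the constant 0 is 0 because \<Omega> is nonempty.\<close>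
  moreover have "point_char 1 \<in> (Omega :: 's hull_char set)"
    unfolding Omega_iff by (auto simp: subset_iff)
  ultimately show ?thesis
    unfolding reduced_norm_def units_MG by (auto intro!: cSUP_const)
qed

lemma char_act_point_char:
  fixes g :: "'s::left_cancellative_monoid \<rightharpoonup> 's"
  assumes "valid g (point_char s)"
  shows "char_act g (point_char s) = point_char (the (g s))"
proof (rule hull_char_eqI)
  have g: "g \<in> left_inverse_hull" "s \<in> dom g"
    using assms by (auto simp: valid_def mem_char_domain dom_constructible)
  fix X :: "'s set" assume "X \<in> \<J>"
  then show "char_act g (point_char s) (pid X) \<longleftrightarrow> point_char (the (g s)) (pid X)"
    using g pvim_constructible[OF g(1), of X] by (simp add: char_act_pid) (auto simp: pvim_def)
qed (use assms in \<open>simp_all add: valid_def char_act_hull_char\<close>)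

text \<open>\<open>reduced_hom\<close> refers to all representatives k of the class. By the
  vanishing hypothesis every convolution with f is 0 on the fibre at \<chi>_e, so the operator of k
  n there has the norm of that of f - k n, which is at most the reduced norm and tends to 0.\<close>

lemma reduced_hom_eq_0:
  fixes f :: "'s::left_cancellative_monoid germ set \<Rightarrow> complex"
  assumes f: "f \<in> Cc MG"
    and vanish: "\<And>H P. H \<in> arrows MG \<Longrightarrow> P \<in> arrows MG \<Longrightarrow> gsource MG P = point_char 1 \<Longrightarrow>
      grange MG H = grange MG P \<Longrightarrow> f H = 0"
  shows "reduced_hom (reduced_null MG `` {\<lambda>_. f}) = 0"
proof -
  have e: "point_char 1 \<in> (Omega :: 's hull_char set)"
    unfolding Omega_iff by (auto simp: subset_iff)
  have lim: "(\<lambda>n. unit_rep (k n)) \<longlonglongrightarrow> 0" if "k \<in> reduced_null MG `` {\<lambda>_. f}" for k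
  proof -
    have k: "k n \<in> Cc MG" "(\<lambda>n. reduced_norm MG (\<lambda>P. f P - k n P)) \<longlonglongrightarrow> 0" for n
      using that by (auto simp: reduced_null_def reduced_cauchy_def)
    have tk: "tame (k n)" and td: "tame (\<lambda>P. f P - k n P)" for n
      using k(1)[of n] f tame_Cc tame_diff by blast+
    have eq: "fibre_rep MG (point_char 1) (\<lambda>P. f P - k n P) = - fibre_rep MG (point_char 1) (k n)" for n
    proof (rule blinfun_eqI)
      fix \<xi> :: "'s germ set ell2"
      have "convolution MG (\<lambda>P. f P - k n P) \<zeta> P = - convolution MG (k n) \<zeta> P"
        if "P \<in> arrows MG" "gsource MG P = point_char 1" for P \<zeta>
        unfolding convolution_def infsum_uminus[symmetric]
        by (rule infsum_cong) (use vanish that in auto)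
      then show "blinfun_apply (fibre_rep MG (point_char 1) (\<lambda>P. f P - k n P)) \<xi> =
          blinfun_apply (- fibre_rep MG (point_char 1) (k n)) \<xi>"
        unfolding Rep_ell2_inject[symmetric] uminus_blinfun.rep_eq uminus_ell2.rep_eq
          fibre_rep_apply[OF tk] fibre_rep_apply[OF td]
        by (auto simp: fibre_fun_def)
    qed
    have "(\<lambda>n. fibre_rep MG (point_char 1) (k n)) \<longlonglongrightarrow> 0"
    proof (rule tendsto_norm_zero_cancel, rule tendsto_sandwich[OF _ _ tendsto_const k(2)])
      have "norm (fibre_rep MG (point_char 1) (k n)) \<le> reduced_norm MG (\<lambda>P. f P - k n P)" for n
        using fibre_rep_le_reduced_norm[OF td e, of n] by (simp add: eq)
      then show "\<forall>\<^sub>F n in sequentially. norm (fibre_rep MG (point_char 1) (k n)) \<le> reduced_norm MG (\<lambda>P. f P - k n P)"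
        by simp
    qed simp
    from bounded_bilinear.tendsto[OF bounded_bilinear_blinfun_compose
        bounded_bilinear.tendsto[OF bounded_bilinear_blinfun_compose tendsto_const this] tendsto_const]
    show ?thesis
      unfolding unit_rep_def by (simp add: bounded_bilinear.zero_left[OF bounded_bilinear_blinfun_compose]
        bounded_bilinear.zero_right[OF bounded_bilinear_blinfun_compose])
  qed
  \<comment> \<open>The class has a member, so the limit is unique and the definite description
    equals 0.\<close>
  have "(\<lambda>_. f) \<in> reduced_null MG `` {\<lambda>_. f}"
    using f by (auto simp: reduced_null_def reduced_cauchy_def reduced_norm_0)
  moreover have "0 \<in> (reduced_monoid_Cstar :: ('s ell2 \<Rightarrow>\<^sub>L 's ell2) set)"
    unfolding reduced_monoid_Cstar_def Cstar_generated_def Cstar_subalgebra_def by blast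
  ultimately show ?thesis
    unfolding reduced_hom_def using lim LIMSEQ_unique by (intro the_equality) blast+
qed

section \<open>The set X (here \<open>fork\<close>), its pieces and the points \<open>tip l\<close>
  = b l in them\<close>

definition fork :: "T set" where
  "fork = \<Union>(branches (T_gen Gen_b))"

text \<open>The factor \<open>1\<close> makes the rewriting rule \<open>T_gen_relation\<close> applicable.\<close>

abbreviation tip :: "gen \<Rightarrow> T" where
  "tip l \<equiv> T_gen Gen_b * (T_gen l * 1)"

text \<open>The branches of b are also those of a b, hence lie in a T. Conversely, a product by a
  whose normal form begins with b was rewritten, so the next letter is a leg.\<close>

lemma fork_eq: "fork = range ((*) (T_gen Gen_a)) \<inter> range ((*) (T_gen Gen_b))"
proof (intro subset_antisym subsetI)
  fix t assume "t \<in> fork"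
  then have "t \<in> \<Union>(branches (T_gen Gen_a * T_gen Gen_b))"
    unfolding fork_def by (simp add: branches_mult_b)
  then have "t \<in> range ((*) (T_gen Gen_a))"
    unfolding Union_branches by (auto simp: mult.assoc)
  moreover have "t \<in> range ((*) (T_gen Gen_b))"
    using \<open>t \<in> fork\<close> unfolding fork_def Union_branches by auto
  ultimately show "t \<in> range ((*) (T_gen Gen_a)) \<inter> range ((*) (T_gen Gen_b))" ..
next
  fix r assume "r \<in> range ((*) (T_gen Gen_a)) \<inter> range ((*) (T_gen Gen_b))"
  then obtain s t where st: "r = T_gen Gen_a * s" "r = T_gen Gen_b * t" by blast
  then have "gen_act Gen_a (nf s) = Gen_b # nf t"
    by (metis nf_gen_mult gen_act_non_ac gen.distinct(1) gen.distinct(9) empty_iff insert_iff)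
  then obtain l w where l: "is_leg l" "nf t = l # w"
    using gen_act_eq_Cons by blast
  then have "t = T_gen l * T_word w"
    by (metis T_word_nf T_word_Cons)
  then show "r \<in> fork"
    using st(2) l(1) unfolding fork_def Union_branches by blast
qed

lemma fork_constructible: "fork \<in> \<J>"
  unfolding fork_eq by (intro Int_constructible image_constructible UNIV_constructible)

lemma branches_constructible: "branches u \<subseteq> \<J>"
  unfolding branches_def using image_constructible[OF UNIV_constructible] by blast

lemma tip_in_branch:
  assumes "is_leg l" "is_leg m" "tip l \<in> range ((*) (T_gen Gen_b * T_gen m))"
  shows "l = m"
proof -
  obtain t where "tip l = T_gen Gen_b * (T_gen m * t)"
    using assms(3) by (auto simp: mult.assoc)
  then have "nf (tip l) = nf (T_gen Gen_b * (T_gen m * t))"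
    by simp
  then show ?thesis
    using assms(1,2) unfolding nf_gen_mult by (simp add: gen_act_leg)
qed

lemma tip_inject: "is_leg l \<Longrightarrow> is_leg m \<Longrightarrow> tip l = tip m \<longleftrightarrow> l = m"
proof
  assume "is_leg l" "is_leg m" "tip l = tip m"
  moreover have "tip m \<in> range ((*) (T_gen Gen_b * T_gen m))"
    by (rule range_eqI[of _ _ 1]) (simp add: mult.assoc)
  ultimately show "l = m"
    by (intro tip_in_branch) simp_all
qed simp

lemma tip_fork: "is_leg l \<Longrightarrow> tip l \<in> fork"
  unfolding fork_def Union_branches by blast

text \<open>A branch of b contains only one tip, so finitely many branches rule out finitely many
  indices. The index is common to both tips, since one set will have to be tested against
  both.\<close>

lemma tip_avoids:
  assumes "finite \<G>" "\<G> \<subseteq> branches (T_gen Gen_b)"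
  shows "\<exists>n. tip (Gen_x n) \<notin> \<Union>\<G> \<and> tip (Gen_y n) \<notin> \<Union>\<G>"
proof -
  obtain L where L: "finite L" "L \<subseteq> Collect is_leg" "\<G> = (\<lambda>l. range ((*) (T_gen Gen_b * T_gen l))) ` L"
    using assms unfolding branches_def by (metis finite_subset_image)
  have "finite (Gen_x -` L \<union> Gen_y -` L)"
    using L(1) by (auto intro!: finite_vimageI injI)
  then obtain n where n: "n \<notin> Gen_x -` L \<union> Gen_y -` L"
    using ex_new_if_finite[of "Gen_x -` L \<union> Gen_y -` L"] infinite_UNIV_int by blast
  have "tip l \<notin> \<Union>\<G>" if "is_leg l" "l \<notin> L" for l
    using that L(2,3) tip_in_branch[OF that(1)] by blast
  then show ?thesis
    using n by (intro exI[of _ n]) auto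
qed

lemma fork_dichotomy:
  assumes "Z \<in> \<J>" "\<not> fork \<subseteq> Z"
  obtains \<G> where "finite \<G>" "\<G> \<subseteq> branches (T_gen Gen_b)" "Z \<inter> fork \<subseteq> \<Union>\<G>"
  using constructible_ideals_branches[OF assms(1), of "T_gen Gen_b"] assms(2)
  unfolding branch_dichotomy_def fork_def[symmetric] by blast

lemma tip_avoids_ideals:
  assumes "finite F" "F \<subseteq> \<J>" "\<And>Y. Y \<in> F \<Longrightarrow> \<not> fork \<subseteq> Y"
  shows "\<exists>n. tip (Gen_x n) \<notin> \<Union>F \<and> tip (Gen_y n) \<notin> \<Union>F"
proof -
  have "\<exists>\<G>. finite \<G> \<and> \<G> \<subseteq> branches (T_gen Gen_b) \<and> \<Union>F \<inter> fork \<subseteq> \<Union>\<G>"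
    using assms
  proof (induction)
    case (insert Y F)
    obtain \<G> where G: "finite \<G>" "\<G> \<subseteq> branches (T_gen Gen_b)" "\<Union>F \<inter> fork \<subseteq> \<Union>\<G>"
      using insert.IH insert.prems by auto
    obtain \<H> where H: "finite \<H>" "\<H> \<subseteq> branches (T_gen Gen_b)" "Y \<inter> fork \<subseteq> \<Union>\<H>"
      using insert.prems fork_dichotomy[of Y] by auto
    have "\<Union>(insert Y F) \<inter> fork \<subseteq> \<Union>(\<G> \<union> \<H>)"
      using G(3) H(3) by blast
    then show ?case
      using G(1,2) H(1,2) by (metis finite_UnI Un_least)
  qed auto
  then obtain \<G> where G: "finite \<G>" "\<G> \<subseteq> branches (T_gen Gen_b)" "\<Union>F \<inter> fork \<subseteq> \<Union>\<G>"
    by (elim exE conjE)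
  obtain n where "tip (Gen_x n) \<notin> \<Union>\<G>" "tip (Gen_y n) \<notin> \<Union>\<G>"
    using tip_avoids[OF G(1,2)] by (elim exE conjE)
  moreover have "tip (Gen_x n) \<in> fork" "tip (Gen_y n) \<in> fork"
    by (simp_all only: tip_fork is_leg.simps)
  ultimately show ?thesis
    using G(3) by (intro exI[of _ n]) blast
qed

text \<open>If Z contains the fork and no member of F does, then F removes only parts of finitely
  many branches, and both tips of some index survive. Otherwise Z, or the removal of a member of F,
  leaves at most finitely many branches.\<close>

lemma difference_dichotomy:
  assumes "Y \<in> constructible_differences"
  shows "(\<exists>n. tip (Gen_x n) \<in> Y \<and> tip (Gen_y n) \<in> Y) \<or>
    (\<exists>\<G>. finite \<G> \<and> \<G> \<subseteq> branches (T_gen Gen_b) \<and> Y \<inter> fork \<subseteq> \<Union>\<G>)"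
proof -
  obtain Z F where Y: "Y = Z - \<Union>F" "Z \<in> \<J>" "finite F" "F \<subseteq> \<J>"
    using assms by (auto simp: constructible_differences_def)
  consider "\<not> fork \<subseteq> Z" | "\<exists>Y\<in>F. fork \<subseteq> Y" | "fork \<subseteq> Z" "\<And>Y. Y \<in> F \<Longrightarrow> \<not> fork \<subseteq> Y"
    by blast
  then show ?thesis
  proof cases
    case 1
    obtain \<G> where "finite \<G>" "\<G> \<subseteq> branches (T_gen Gen_b)" "Z \<inter> fork \<subseteq> \<Union>\<G>"
      using Y(2) 1 by (rule fork_dichotomy)
    then show ?thesis
      unfolding Y(1) by (intro disjI2 exI[of _ \<G>]) blast
  next
    case 2
    then show ?thesis
      unfolding Y(1) by (intro disjI2 exI[of _ "{}"]) blast
  next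
    case 3
    have "\<exists>n. tip (Gen_x n) \<notin> \<Union>F \<and> tip (Gen_y n) \<notin> \<Union>F"
      using Y(3,4) by (rule tip_avoids_ideals) (rule 3(2))
    then obtain n where "tip (Gen_x n) \<notin> \<Union>F" "tip (Gen_y n) \<notin> \<Union>F"
      by (elim exE conjE)
    moreover have "tip (Gen_x n) \<in> fork" "tip (Gen_y n) \<in> fork"
      by (simp_all only: tip_fork is_leg.simps)
    ultimately show ?thesis
      unfolding Y(1) using 3(1) by (intro disjI1 exI[of _ n]) blast
  qed
qed

section \<open>Failure of C*-regularity\<close>

lemma tip_moved: "T_gen Gen_a * tip (Gen_y n) \<noteq> tip (Gen_y n)" "T_gen Gen_c * tip (Gen_x n) \<noteq> tip (Gen_x n)"
  unfolding T_gen_relation[of Gen_a "Gen_y n", simplified] T_gen_relation[of Gen_c "Gen_x n", simplified]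
  by (simp_all only: tip_inject is_leg.simps) simp_all

lemma not_Cstar_regular_T: "\<not> Cstar_regular TYPE(T)"
proof
  assume reg: "Cstar_regular TYPE(T)"
  let ?H = "{left_translation (T_gen Gen_a), left_translation (T_gen Gen_c)}"
  have "fork \<subseteq> (\<Union>h\<in>?H. {s. h s = Some s})"
  proof
    fix s assume "s \<in> fork"
    then obtain l t where s: "s = T_gen Gen_b * (T_gen l * t)" "is_leg l"
      unfolding fork_def Union_branches by blast
    show "s \<in> (\<Union>h\<in>?H. {s. h s = Some s})"
      using s(2) T_gen_relation[OF _ s(2), of Gen_a t] T_gen_relation[OF _ s(2), of Gen_c t]
      unfolding s(1) by (cases l) (simp_all add: left_translation_def)
  qed
  moreover have "fork \<in> constructible_differences"
    unfolding constructible_differences_def using fork_constructible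
    by (intro CollectI exI[of _ fork] exI[of _ "{}"]) simp
  moreover have "fork \<noteq> {}"
    using tip_fork[of "Gen_x 0"] by auto
  ultimately have "finite ?H \<and> ?H \<subseteq> left_inverse_hull \<and> fork \<in> constructible_differences \<and>
      fork \<noteq> {} \<and> fork \<subseteq> (\<Union>h\<in>?H. {s. h s = Some s})"
    by (simp add: left_inverse_hull.left_translation)
  from reg[unfolded Cstar_regular_def, THEN spec, THEN spec, THEN mp, OF this]
  obtain \<Y> where Y: "finite \<Y>" "\<Y> \<subseteq> constructible_differences" "fork \<subseteq> \<Union>\<Y>"
      "\<forall>Y\<in>\<Y>. \<exists>h\<in>?H. \<forall>s\<in>Y. h s = Some s"
    by (elim exE conjE)
  have "\<forall>Y\<in>\<Y>. \<exists>\<G>. finite \<G> \<and> \<G> \<subseteq> branches (T_gen Gen_b) \<and> Y \<inter> fork \<subseteq> \<Union>\<G>"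
  proof
    fix Y assume YY: "Y \<in> \<Y>"
    \<comment> \<open>On Y one of a and c is the identity, but a moves the y-tips and c the
      x-tips.\<close>
    have "\<not> (tip (Gen_x n) \<in> Y \<and> tip (Gen_y n) \<in> Y)" for n
      using Y(4) YY tip_moved[of n] by (auto simp: left_translation_def)
    then have "\<not> (\<exists>n. tip (Gen_x n) \<in> Y \<and> tip (Gen_y n) \<in> Y)"
      by blast
    moreover have "Y \<in> constructible_differences"
      using Y(2) YY by blast
    ultimately show "\<exists>\<G>. finite \<G> \<and> \<G> \<subseteq> branches (T_gen Gen_b) \<and> Y \<inter> fork \<subseteq> \<Union>\<G>"
      using difference_dichotomy[of Y] by (simp only: simp_thms)
  qed
  from bchoice[OF this]
  obtain \<G> where G: "\<forall>Y\<in>\<Y>. finite (\<G> Y) \<and> \<G> Y \<subseteq> branches (T_gen Gen_b) \<and> Y \<inter> fork \<subseteq> \<Union>(\<G> Y)" ..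
  have "finite (\<Union>(\<G> ` \<Y>))" "\<Union>(\<G> ` \<Y>) \<subseteq> branches (T_gen Gen_b)"
    using Y(1) G by auto
  then have "\<exists>n. tip (Gen_x n) \<notin> \<Union>(\<Union>(\<G> ` \<Y>)) \<and> tip (Gen_y n) \<notin> \<Union>(\<Union>(\<G> ` \<Y>))"
    by (rule tip_avoids)
  then obtain n where n: "tip (Gen_x n) \<notin> \<Union>(\<Union>(\<G> ` \<Y>))"
    by (elim exE conjE)
  have fork: "tip (Gen_x n) \<in> fork"
    by (simp only: tip_fork is_leg.simps)
  then obtain Y where "Y \<in> \<Y>" "tip (Gen_x n) \<in> Y"
    using Y(3) by blast
  then show False
    using G fork n by blast
qed

section \<open>The limit character \<chi> (here \<open>fork_char\<close>), given by its
  values\<close>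

definition fork_char :: "T hull_char" where
  "fork_char = restrict (\<lambda>p. fork \<subseteq> dom p) hull_idempotents"

lemma fork_char_pid [simp]: "Z \<in> \<J> \<Longrightarrow> fork_char (pid Z) \<longleftrightarrow> fork \<subseteq> Z"
  by (simp add: fork_char_def)

lemma fork_char_Omega: "fork_char \<in> Omega"
  unfolding Omega_iff
proof (intro conjI allI impI)
  show "fork_char \<in> hull_chars"
    by (rule hull_charI) (auto simp: Int_constructible, simp add: fork_char_def)
  fix X F
  assume XF: "X \<in> \<J>" "finite F" "F \<subseteq> \<J>" "fork_char (pid X)" "\<forall>Y\<in>F. \<not> fork_char (pid Y)"
  then obtain n where "tip (Gen_x n) \<notin> \<Union>F"
    using tip_avoids_ideals[of F] by (auto simp: subset_iff)
  moreover have "tip (Gen_x n) \<in> X"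
    using XF tip_fork[of "Gen_x n"] by auto
  ultimately show "X - \<Union>F \<noteq> {}" by blast
qed

text \<open>This stands in for the convergence of tips to \<chi>: germs of g and h can coincide at
  \<chi> only if g and h agree at both tips of some index.\<close>

lemma nbhds_fork_char:
  assumes "Z \<in> nbhds False fork_char"
  shows "\<exists>n. tip (Gen_x n) \<in> Z \<and> tip (Gen_y n) \<in> Z"
proof -
  obtain X F where Z: "Z = X - \<Union>F" "X \<in> \<J>" "finite F" "F \<subseteq> \<J>" "fork_char \<in> cylinder X F"
    using assms by (rule nbhdsE)
  then have X: "fork \<subseteq> X" and F: "\<And>Y. Y \<in> F \<Longrightarrow> \<not> fork \<subseteq> Y"
    by (auto simp: cylinder_def subset_iff)
  have "\<exists>n. tip (Gen_x n) \<notin> \<Union>F \<and> tip (Gen_y n) \<notin> \<Union>F"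
    using Z(3,4) by (rule tip_avoids_ideals) (rule F)
  then obtain n where "tip (Gen_x n) \<notin> \<Union>F" "tip (Gen_y n) \<notin> \<Union>F"
    by (elim exE conjE)
  then show ?thesis
    unfolding Z(1) using X tip_fork[of "Gen_x n"] tip_fork[of "Gen_y n"] by (intro exI[of _ n]) auto
qed

text \<open>A point of the fork lies in some branch, where its character is 1; but \<chi> is 0 at
  every single branch, as none contains the whole fork.\<close>

lemma fork_char_not_point: "fork_char \<noteq> point_char t"
proof
  assume eq: "fork_char = point_char t"
  have "fork_char (pid fork)"
    by (simp add: fork_constructible)
  then have "t \<in> fork"
    unfolding eq by (simp add: fork_constructible)
  then obtain Z where Z: "Z \<in> branches (T_gen Gen_b)" "t \<in> Z"
    unfolding fork_def by blast
  then have "Z \<in> \<J>"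
    using branches_constructible by blast
  then have "point_char t (pid Z)"
    using Z(2) by simp
  then have "fork \<subseteq> Z"
    using \<open>Z \<in> \<J>\<close> unfolding eq[symmetric] by simp
  moreover obtain n where "tip (Gen_x n) \<notin> \<Union>{Z}"
    using tip_avoids[of "{Z}"] Z(1) by auto
  ultimately show False
    using tip_fork[of "Gen_x n"] by auto
qed

text \<open>Suppose \<phi> is 0 at all branches. If \<phi> were 1 at an ideal Z not containing the
  fork, then Z \<inter> X would lie in finitely many branches, and \<open>Omega_iff\<close> would
  make the empty difference nonempty. So \<phi> agrees with \<chi>.\<close>

lemma char_on_fork:
  assumes \<phi>: "\<phi> \<in> Omega" "\<phi> (pid fork)" "\<phi> \<noteq> fork_char"
  obtains l where "is_leg l" "\<phi> (pid (range ((*) (T_gen Gen_b * T_gen l))))"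
proof -
  have c: "\<phi> \<in> hull_chars"
    using \<phi>(1) by (simp add: Omega_iff)
  have "\<exists>B\<in>branches (T_gen Gen_b). \<phi> (pid B)"
  proof (rule ccontr)
    assume none: "\<not> (\<exists>B\<in>branches (T_gen Gen_b). \<phi> (pid B))"
    have "\<phi> = fork_char"
    proof (rule hull_char_eqI[OF c])
      show "fork_char \<in> hull_chars"
        using fork_char_Omega by (simp add: Omega_iff)
      fix Z :: "T set" assume Z: "Z \<in> \<J>"
      have "\<phi> (pid Z) \<longleftrightarrow> fork \<subseteq> Z"
      proof
        assume "fork \<subseteq> Z"
        then show "\<phi> (pid Z)"
          using hull_char_mono[OF c fork_constructible Z] \<phi>(2) by blast
      next
        assume \<phi>Z: "\<phi> (pid Z)"
        show "fork \<subseteq> Z"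
        proof (rule ccontr)
          assume "\<not> fork \<subseteq> Z"
          with Z obtain \<G> where G: "finite \<G>" "\<G> \<subseteq> branches (T_gen Gen_b)" "Z \<inter> fork \<subseteq> \<Union>\<G>"
            by (rule fork_dichotomy)
          have "Z \<inter> fork - \<Union>\<G> \<noteq> {}"
          proof (rule \<phi>(1)[unfolded Omega_iff, THEN conjunct2, rule_format])
            show "Z \<inter> fork \<in> \<J>"
              using Z fork_constructible by (rule Int_constructible)
            show "\<phi> (pid (Z \<inter> fork))"
              using \<phi>Z \<phi>(2) hull_char_Int[OF c Z fork_constructible] by simp
          qed (use G(1,2) branches_constructible none in blast)+
          then show False
            using G(3) by blast
        qed
      qed
      then show "\<phi> (pid Z) \<longleftrightarrow> fork_char (pid Z)"
        using Z by simp
    qed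
    with \<phi>(3) show False ..
  qed
  then show thesis
    using that unfolding branches_def by blast
qed

section \<open>The function in the kernel\<close>

definition patch :: "T \<Rightarrow> T germ set set" where
  "patch s = bisection (left_translation s) (cylinder fork {})"

lemma dom_left_translation [simp]: "dom (left_translation s) = UNIV"
  by (auto simp: left_translation_def)

lemma valid_left_translation:
  "valid (left_translation s) (\<phi> :: 's::left_cancellative_monoid hull_char) \<longleftrightarrow> \<phi> \<in> Omega"
  by (auto simp: valid_def left_inverse_hull.left_translation mem_char_domain Omega_iff)

lemma germ_class_patch:
  assumes "valid g \<phi>"
  shows "germ_class g \<phi> \<in> patch s \<longleftrightarrow> \<phi> (pid fork) \<and> germ_eqv False g (left_translation s) \<phi>"
proof -
  have "germ_class g \<phi> \<in> patch s \<longleftrightarrow> (\<exists>\<psi>. \<psi> \<in> cylinder fork {} \<and> \<psi> \<in> Omega \<and> germ_class g \<phi> = germ_class (left_translation s) \<psi>)"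
    by (auto simp: patch_def bisection_def valid_left_translation)
  also have "\<dots> \<longleftrightarrow> \<phi> \<in> cylinder fork {} \<and> \<phi> \<in> Omega \<and> germ_eqv False g (left_translation s) \<phi>"
  proof -
    have "germ_class g \<phi> = germ_class (left_translation s) \<psi> \<longleftrightarrow> \<phi> = \<psi> \<and> germ_eqv False g (left_translation s) \<phi>"
      if "\<psi> \<in> Omega" for \<psi>
      using that by (intro germ_class_eq_iff assms) (simp add: valid_left_translation)
    then show ?thesis by blast
  qed
  finally show ?thesis
    using assms valid_hull_char[OF assms] by (auto simp: cylinder_def valid_def)
qed

text \<open>The expansion of (1_a - 1)(1_c - 1), with every bisection restricted to the characters
  living on X.\<close>

definition witness :: "T germ set \<Rightarrow> complex" where
  "witness P = indicator (patch (T_gen Gen_a * T_gen Gen_c)) P - indicator (patch (T_gen Gen_a)) P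
     - indicator (patch (T_gen Gen_c)) P + indicator (patch 1) P"

lemma witness_Cc: "witness \<in> Cc MG"
proof -
  let ?s = "\<lambda>i::nat. [T_gen Gen_a * T_gen Gen_c, T_gen Gen_a, T_gen Gen_c, 1] ! i"
  let ?c = "\<lambda>i::nat. [1, -1, -1, 1] ! i :: complex"
  have "openin (gtop MG) (patch s) \<and> Hausdorff_space (subtopology (gtop MG) (patch s)) \<and>
      indicator (patch s) \<in> Cc_open MG (patch s)" for s
    unfolding patch_def
    by (intro conjI openin_bisection Hausdorff_bisection indicator_bisection_Cc_open openin_cylinder
        left_inverse_hull.left_translation fork_constructible) auto
  moreover have "witness = (\<lambda>P. \<Sum>i<4. ?c i * indicator (patch (?s i)) P)"
    by (simp add: witness_def fun_eq_iff numeral_eq_Suc)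
  ultimately show ?thesis
    unfolding Cc_def
    by (intro CollectI exI[of _ "4 :: nat"] exI[of _ ?c] exI[of _ "\<lambda>i. indicator (patch (?s i))"]
        conjI allI impI) blast+
qed

lemma germ_eqv_leg:
  assumes "\<phi> \<in> Omega" "\<phi> (pid (range ((*) (T_gen Gen_b * T_gen l))))"
    and "\<And>t. s * (T_gen Gen_b * (T_gen l * t)) = s' * (T_gen Gen_b * (T_gen l * t))"
  shows "germ_eqv False (left_translation s) (left_translation s') \<phi>"
proof -
  have "range ((*) (T_gen Gen_b * T_gen l)) \<in> nbhds False \<phi>"
    using assms(1,2) by (intro ideal_nbhds image_constructible UNIV_constructible) (auto simp: Omega_iff)
  then show ?thesis
    unfolding germ_eqv_def using assms(3)
    by (intro bexI[of _ "range ((*) (T_gen Gen_b * T_gen l))"]) (auto simp: left_translation_def mult.assoc)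
qed

text \<open>The four terms cancel in pairs. On an x-branch a acts trivially, also after c, which
  leads to another x-branch: a cancels against 1 and ac against c. On a y-branch c acts trivially: c
  cancels against 1 and ac against a.\<close>

lemma witness_support:
  assumes "H \<in> arrows MG" "witness H \<noteq> 0"
  shows "gsource MG H = fork_char"
proof (rule ccontr)
  obtain g \<phi> where g: "H = germ_class g \<phi>" "valid g \<phi>"
    using assms(1) by (rule arrowsE)
  assume "gsource MG H \<noteq> fork_char"
  then have ne: "\<phi> \<noteq> fork_char"
    using g by simp
  have fork: "\<phi> (pid fork)"
  proof (rule ccontr)
    assume "\<not> \<phi> (pid fork)"
    then have "witness H = 0"
      by (simp add: witness_def g(1) germ_class_patch[OF g(2)] indicator_def)
    with assms(2) show False by blast
  qed
  have \<phi>: "\<phi> \<in> Omega"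
    using g(2) by (simp add: valid_def)
  obtain l where l: "is_leg l" "\<phi> (pid (range ((*) (T_gen Gen_b * T_gen l))))"
    using char_on_fork[OF \<phi> fork ne] by blast
  have same: "H \<in> patch s \<longleftrightarrow> H \<in> patch s'" if "germ_eqv False (left_translation s) (left_translation s') \<phi>" for s s'
    using that germ_eqv_trans germ_eqv_sym unfolding g(1) germ_class_patch[OF g(2)] by metis
  have rel: "T_gen Gen_a * (T_gen Gen_b * (T_gen (Gen_x n) * t)) = T_gen Gen_b * (T_gen (Gen_x n) * t)"
      "T_gen Gen_c * (T_gen Gen_b * (T_gen (Gen_x n) * t)) = T_gen Gen_b * (T_gen (Gen_x (n + 1)) * t)"
      "T_gen Gen_c * (T_gen Gen_b * (T_gen (Gen_y n) * t)) = T_gen Gen_b * (T_gen (Gen_y n) * t)" for n t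
    using T_gen_relation[of Gen_a "Gen_x n" t] T_gen_relation[of Gen_c "Gen_x n" t]
      T_gen_relation[of Gen_c "Gen_y n" t] by simp_all
  have "witness H = 0"
  proof (cases l)
    case (Gen_x n)
    have "H \<in> patch (T_gen Gen_a) \<longleftrightarrow> H \<in> patch 1"
      by (intro same germ_eqv_leg[OF \<phi> l(2)]) (simp add: Gen_x rel)
    moreover have "H \<in> patch (T_gen Gen_a * T_gen Gen_c) \<longleftrightarrow> H \<in> patch (T_gen Gen_c)"
      by (intro same germ_eqv_leg[OF \<phi> l(2)]) (simp add: mult.assoc Gen_x rel)
    ultimately show ?thesis
      by (simp add: witness_def indicator_def)
  next
    case (Gen_y n)
    have "H \<in> patch (T_gen Gen_c) \<longleftrightarrow> H \<in> patch 1"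
      by (intro same germ_eqv_leg[OF \<phi> l(2)]) (simp add: Gen_y rel)
    moreover have "H \<in> patch (T_gen Gen_a * T_gen Gen_c) \<longleftrightarrow> H \<in> patch (T_gen Gen_a)"
      by (intro same germ_eqv_leg[OF \<phi> l(2)]) (simp add: mult.assoc Gen_y rel)
    ultimately show ?thesis
      by (simp add: witness_def indicator_def)
  qed (use l(1) in simp_all)
  with assms(2) show False by blast
qed

text \<open>Every set witnessing agreement near \<chi> contains an x-tip, moved by c, and a y-tip,
  moved by a. So both negative terms vanish at the unit, while the patch of 1 contributes 1 and that
  of ac nothing negative.\<close>

lemma witness_fork_unit: "witness (germ_class (pid UNIV) fork_char) \<noteq> 0"
proof -
  have v: "valid (pid UNIV) fork_char"
    unfolding pid_UNIV using fork_char_Omega by (simp add: valid_left_translation)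
  have not: "\<not> germ_eqv False (pid UNIV) (left_translation s) fork_char"
    if "\<And>n. s * tip (Gen_x n) \<noteq> tip (Gen_x n) \<or> s * tip (Gen_y n) \<noteq> tip (Gen_y n)" for s
  proof
    assume "germ_eqv False (pid UNIV) (left_translation s) fork_char"
    then obtain Z where Z: "Z \<in> nbhds False fork_char" "\<forall>t\<in>Z. pid UNIV t = left_translation s t"
      unfolding germ_eqv_def by blast
    then obtain n where "tip (Gen_x n) \<in> Z" "tip (Gen_y n) \<in> Z"
      using nbhds_fork_char by blast
    then have "pid UNIV (tip (Gen_x n)) = left_translation s (tip (Gen_x n))"
        "pid UNIV (tip (Gen_y n)) = left_translation s (tip (Gen_y n))"
      using Z(2) by blast+
    then show False
      using that[of n] by (simp add: pid_def left_translation_def)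
  qed
  have "germ_class (pid UNIV) fork_char \<notin> patch (T_gen Gen_a)" "germ_class (pid UNIV) fork_char \<notin> patch (T_gen Gen_c)"
    unfolding germ_class_patch[OF v] using not[of "T_gen Gen_a"] not[of "T_gen Gen_c"] tip_moved by blast+
  moreover have "germ_class (pid UNIV) fork_char \<in> patch 1"
    unfolding germ_class_patch[OF v] pid_UNIV[symmetric]
    using v valid_hull_char[OF v] by (simp add: germ_eqv_refl fork_constructible)
  ultimately show ?thesis
    by (simp add: witness_def indicator_def)
qed

text \<open>A nonzero value would give an arrow from \<chi>_e to \<chi>, but arrows starting at a
  point character end at point characters.\<close>

lemma witness_vanishes:
  assumes "H \<in> arrows MG" "P \<in> arrows MG" "gsource MG P = point_char 1" "grange MG H = grange MG P"
  shows "witness H = 0"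
proof (rule ccontr)
  assume "witness H \<noteq> 0"
  then have src: "gsource MG H = fork_char"
    using assms(1) witness_support by blast
  obtain h \<psi> where h: "H = germ_class h \<psi>" "valid h \<psi>" using assms(1) by (rule arrowsE)
  obtain g \<phi> where g: "P = germ_class g \<phi>" "valid g \<phi>" using assms(2) by (rule arrowsE)
  have eq: "\<psi> = fork_char" "\<phi> = point_char 1" "char_act h \<psi> = char_act g \<phi>"
    using src assms h g by simp_all
  show False
    using inv_mult_MG(2,3)[OF h(2) g(2) eq(3)] char_act_point_char fork_char_not_point eq(1,2) by metis
qed

theorem proposition4p1:
  shows "left_cancellative TYPE(T)
    \<and> \<not> Cstar_regular TYPE(T)
    \<and> (\<exists>a \<in> reduced_groupoid_Cstar (monoid_groupoid :: (T germ set, T hull_char) groupoid).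
          a \<noteq> reduced_groupoid_zero monoid_groupoid \<and> reduced_hom a = 0)"
proof (intro conjI bexI)
  show "left_cancellative TYPE(T)"
    unfolding left_cancellative_def using mult_left_cancel by blast
  show "\<not> Cstar_regular TYPE(T)"
    by (rule not_Cstar_regular_T)
  let ?a = "reduced_null MG `` {\<lambda>_. witness}"
  have cauchy: "(\<lambda>_. witness) \<in> reduced_cauchy MG"
    by (simp add: reduced_cauchy_def witness_Cc reduced_norm_0)
  then show "?a \<in> reduced_groupoid_Cstar MG"
    unfolding reduced_groupoid_Cstar_def by (rule quotientI)
  show "reduced_hom ?a = 0"
    using witness_Cc witness_vanishes by (rule reduced_hom_eq_0)
  show "?a \<noteq> reduced_groupoid_zero MG"
  proof
    assume "?a = reduced_groupoid_zero MG"
    moreover have "(\<lambda>_. witness) \<in> ?a"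
      using cauchy by (simp add: reduced_null_def reduced_norm_0)
    \<comment> \<open>The zero sequence stands first in \<open>reduced_null\<close>, hence the
      difference 0 - witness; its norms form a constant sequence.\<close>
    ultimately have "(\<lambda>n::nat. reduced_norm MG (\<lambda>P. 0 - witness P)) \<longlonglongrightarrow> 0"
      by (auto simp: reduced_groupoid_zero_def reduced_null_def)
    then have norm: "reduced_norm MG (\<lambda>P. 0 - witness P) = 0"
      using LIMSEQ_unique tendsto_const by blast
    have tame: "tame (\<lambda>P. 0 - witness P)"
      using tame_diff[OF tame_0 tame_Cc[OF witness_Cc]] .
    have "fibre_rep MG fork_char (\<lambda>P. 0 - witness P) = 0"
      using fibre_rep_le_reduced_norm[OF tame fork_char_Omega] norm by simp
    moreover have "fibre_rep MG fork_char (\<lambda>P. 0 - witness P) \<noteq> 0"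
      using tame fork_char_Omega by (rule fibre_rep_unit) (use witness_fork_unit in simp)
    ultimately show False by blast
  qed
qed

end
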